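(* Let $V$ be an evaluation representation of $\widehat{\mathfrak g}$ and suppose that the endomorphism of $V$ representing $\Lambda=e_0+e$ has a maximal eigenvalue $\lambda$, with eigenvector $\psi\in V$ (unique up to a constant). Then there exists a unique solution $\Psi(x,E):\widetilde{\mathbb C}\to V$ of $$\Psi'(x)+\Big(\frac{\ell}{x}+e+p(x,E)e_0\Big)\Psi(x)=0$$ with asymptotic behaviour $\Psi(x,E)=e^{-\lambda S(x,E)}q(x,E)^{-h}(\psi+o(1))$ as $x\to+\infty$. Moreover, the same asymptotic behaviour holds in the sector $|\arg x|<\frac{\pi}{2(M+1)}$: for every $\delta>0$, $$\Psi(x,E)=e^{-\lambda S(x,E)}q(x,E)^{-h}(\psi+o(1))\quad\text{as }x\to\infty\text{ in }|\arg x|<\tfrac{\pi}{2(M+1)}-\delta.$$ Finally, $\Psi(x,E)$ is an entire function of $E$.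
   Context: $\mathfrak g$ is a simple complex Lie algebra of type $A$, $D$ or $E$ of rank $n$, with Chevalley generators $\{f_i,h_i,e_i\}_{i=1}^n$, Cartan subalgebra $\mathfrak h=\bigoplus\mathbb Ch_i$, simple roots $\alpha_i$, dual Coxeter number $h^\vee$, invariant form $(a|b)=\kappa(a,b)/h^\vee$. $\widehat{\mathfrak g}=\mathfrak g\otimes\mathbb C[t,t^{-1}]\oplus\mathbb Cc$ with $[a\otimes f,b\otimes g]=[a,b]\otimes fg+(a|b)\operatorname{res}_{t=0}(f'g\,dt)c$, $c$ central; $e_0=a_0\otimes t$ with $0\neq a_0\in\mathfrak g_{-\theta}$, $-\theta$ the lowest root; $e=\sum_{i=1}^ne_i$. For a finite-dimensional $\mathfrak g$-module $V$ and $\zeta\in\mathbb C^*$, the evaluation representation $V(\zeta)$ is $V$ with $(a\otimes f(t))v=f(\zeta)(av)$, $cv=0$. $h\in\mathfrak h$ is the element with $\alpha_i(h)=1$ for all $i$ (so $[h,e]=e$, $[h,e_0]=-(h^\vee-1)e_0$). An eigenvalue $\lambda$ of an endomorphism $A$ is maximal if it is real, of algebraic multiplicity one, and $\lambda>\operatorname{Re}\mu$ for every other eigenvalue $\mu$ of $A$. Fix $\ell\in\mathfrak h$, $M>0$, $E\in\mathbb C$; $p(x,E)=x^{Mh^\vee}-E$; $\widetilde{\mathbb C}=\mathbb C\setminus\mathbb R_{\le0}$. Let $s=\lfloor\frac{M+1}{h^\vee M}\rfloor$, $c_0=1$, $c_j(E)=\binom{1/h^\vee}{j}(-E)^j$,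 $q(x,E)=\sum_{j=0}^s c_j(E)x^{M(1-h^\vee j)}$ (the truncation of the large-$x$ expansion of $p(x,E)^{1/h^\vee}$, with branch $q\sim|x|^M$ on the positive axis). The action is $S(x,E)=\int_0^xq(y,E)\,dy$ if $\frac{M+1}{h^\vee M}\notin\mathbb Z_+$, and $S(x,E)=\sum_{j=0}^{s-1}\int_0^xc_j(E)y^{M(1-h^\vee j)}dy+c_s(E)\log x$ if $\frac{M+1}{h^\vee M}\in\mathbb Z_+$. $q(x,E)^{-h}$ denotes $\exp(-h\log q(x,E))$ acting on $V$. *)

theory Defs
  imports "HOL-Complex_Analysis.Complex_Analysis" "HOL-Computational_Algebra.Polynomial"
begin

definition cscale :: "complex \<Rightarrow> complex^'m^'k \<Rightarrow> complex^'m^'k" where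
  "cscale c X = (\<chi> i j. c * X$i$j)"

definition lbr :: "complex^'n^'n \<Rightarrow> complex^'n^'n \<Rightarrow> complex^'n^'n" where
  "lbr X Y = X ** Y - Y ** X"

primrec mpow :: "complex^'n^'n \<Rightarrow> nat \<Rightarrow> complex^'n^'n" where
  "mpow X 0 = mat 1"
| "mpow X (Suc k) = X ** mpow X k"

definition mexp :: "complex^'n^'n \<Rightarrow> complex^'n^'n" where
  "mexp X = (\<chi> i j. \<Sum>k. (mpow X k $ i $ j) / fact k)"

definition charpoly :: "complex^'n^'n \<Rightarrow> complex poly" where
  "charpoly X = det (\<chi> i j. (if i = j then [:0, 1:] else 0) - [: X$i$j :])"

definition is_max_eig :: "complex^'n^'n \<Rightarrow> complex \<Rightarrow> bool" where
  "is_max_eig X lam \<longleftrightarrow> lam \<in> \<real> \<and> poly (charpoly X) lam = 0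
     \<and> order lam (charpoly X) = 1
     \<and> (\<forall>\<mu>. poly (charpoly X) \<mu> = 0 \<and> \<mu> \<noteq> lam \<longrightarrow> Re \<mu> < Re lam)"

definition ADE_cartan :: "nat \<Rightarrow> (nat \<Rightarrow> nat \<Rightarrow> int) \<Rightarrow> bool" where
  "ADE_cartan n A \<longleftrightarrow> n \<ge> 1
     \<and> (\<forall>i<n. A i i = 2)
     \<and> (\<forall>i<n. \<forall>j<n. i \<noteq> j \<longrightarrow> A i j \<in> {0, -1})
     \<and> (\<forall>i<n. \<forall>j<n. A i j = A j i)
     \<and> (\<forall>x::nat \<Rightarrow> real. (\<exists>i<n. x i \<noteq> 0) \<longrightarrow>
            (\<Sum>i<n. \<Sum>j<n. x i * real_of_int (A i j) * x j) > 0)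
     \<and> \<not> (\<exists>I. I \<subseteq> {..<n} \<and> I \<noteq> {} \<and> I \<noteq> {..<n} \<and>
            (\<forall>i\<in>I. \<forall>j\<in>{..<n} - I. A i j = 0))"

definition complex_lie_subalg :: "(complex^'n^'n) set \<Rightarrow> bool" where
  "complex_lie_subalg K \<longleftrightarrow> 0 \<in> K \<and> (\<forall>X\<in>K. \<forall>Y\<in>K. X + Y \<in> K \<and> lbr X Y \<in> K)
     \<and> (\<forall>c. \<forall>X\<in>K. cscale c X \<in> K)"

definition lie_generated :: "(complex^'n^'n) set \<Rightarrow> (complex^'n^'n) set" where
  "lie_generated S = \<Inter> {K. complex_lie_subalg K \<and> S \<subseteq> K}"

text \<open>G is the Lie algebra generated by Chevalley generators satisfying the
  Chevalley--Serre relations for the Cartan matrix A, and G is nonzero.  By Serre's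
  theorem G is then isomorphic to the simple Lie algebra with Cartan matrix A.\<close>
definition chevalley_serre ::
  "(complex^'n^'n) set \<Rightarrow> nat \<Rightarrow> (nat \<Rightarrow> nat \<Rightarrow> int) \<Rightarrow>
   (nat \<Rightarrow> complex^'n^'n) \<Rightarrow> (nat \<Rightarrow> complex^'n^'n) \<Rightarrow> (nat \<Rightarrow> complex^'n^'n) \<Rightarrow> bool" where
  "chevalley_serre G n A e f h \<longleftrightarrow>
     G = lie_generated (e ` {..<n} \<union> f ` {..<n} \<union> h ` {..<n}) \<and> G \<noteq> {0}
     \<and> (\<forall>i<n. \<forall>j<n.
          lbr (h i) (h j) = 0
        \<and> lbr (h i) (e j) = cscale (of_int (A i j)) (e j)
        \<and> lbr (h i) (f j) = cscale (- of_int (A i j)) (f j)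
        \<and> lbr (e i) (f j) = (if i = j then h i else 0)
        \<and> (i \<noteq> j \<longrightarrow> ((lbr (e i)) ^^ nat (1 - A i j)) (e j) = 0
                    \<and> ((lbr (f i)) ^^ nat (1 - A i j)) (f j) = 0))"

definition cartan_sub :: "nat \<Rightarrow> (nat \<Rightarrow> complex^'n^'n) \<Rightarrow> (complex^'n^'n) set" where
  "cartan_sub n h = {X. \<exists>c. X = (\<Sum>i<n. cscale (c i) (h i))}"

text \<open>Root space for the weight \<open>\<Sum>j k j \<alpha>_j\<close>; note \<open>\<alpha>_j(h_i) = A i j\<close>.\<close>
definition root_space ::
  "(complex^'n^'n) set \<Rightarrow> nat \<Rightarrow> (nat \<Rightarrow> nat \<Rightarrow> int) \<Rightarrow> (nat \<Rightarrow> complex^'n^'n)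
    \<Rightarrow> (nat \<Rightarrow> int) \<Rightarrow> (complex^'n^'n) set" where
  "root_space G n A h k = {X \<in> G. \<forall>i<n. lbr (h i) X = cscale (of_int (\<Sum>j<n. k j * A i j)) X}"

definition height :: "nat \<Rightarrow> (nat \<Rightarrow> int) \<Rightarrow> int" where
  "height n k = (\<Sum>j<n. k j)"

definition is_root ::
  "(complex^'n^'n) set \<Rightarrow> nat \<Rightarrow> (nat \<Rightarrow> nat \<Rightarrow> int) \<Rightarrow> (nat \<Rightarrow> complex^'n^'n)
    \<Rightarrow> (nat \<Rightarrow> int) \<Rightarrow> bool" where
  "is_root G n A h k \<longleftrightarrow> (\<forall>j\<ge>n. k j = 0) \<and> (\<exists>j<n. k j \<noteq> 0) \<and> root_space G n A h k \<noteq> {0}"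

definition lowest_root ::
  "(complex^'n^'n) set \<Rightarrow> nat \<Rightarrow> (nat \<Rightarrow> nat \<Rightarrow> int) \<Rightarrow> (nat \<Rightarrow> complex^'n^'n)
    \<Rightarrow> (nat \<Rightarrow> int) \<Rightarrow> bool" where
  "lowest_root G n A h k0 \<longleftrightarrow> is_root G n A h k0 \<and>
     (\<forall>k. is_root G n A h k \<longrightarrow> height n k0 \<le> height n k)"

text \<open>Dual Coxeter number (simply laced): \<open>1 + ht \<theta>\<close>.\<close>
definition dual_coxeter :: "nat \<Rightarrow> (nat \<Rightarrow> int) \<Rightarrow> real" where
  "dual_coxeter n k0 = 1 - real_of_int (height n k0)"

definition lie_rep :: "(complex^'n^'n) set \<Rightarrow> (complex^'n^'n \<Rightarrow> complex^'v^'v) \<Rightarrow> bool" where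
  "lie_rep G \<rho> \<longleftrightarrow> (\<forall>X\<in>G. \<forall>Y\<in>G. \<rho> (X + Y) = \<rho> X + \<rho> Y \<and> \<rho> (lbr X Y) = lbr (\<rho> X) (\<rho> Y))
     \<and> (\<forall>c. \<forall>X\<in>G. \<rho> (cscale c X) = cscale c (\<rho> X))"

definition ctilde :: "complex set" where
  "ctilde = UNIV - \<real>\<^sub>\<le>\<^sub>0"

definition pfun :: "real \<Rightarrow> real \<Rightarrow> complex \<Rightarrow> complex \<Rightarrow> complex" where
  "pfun hv M E x = x powr (of_real (M * hv)) - E"

definition sidx :: "real \<Rightarrow> real \<Rightarrow> nat" where
  "sidx hv M = nat \<lfloor>(M + 1) / (hv * M)\<rfloor>"

definition cco :: "real \<Rightarrow> complex \<Rightarrow> nat \<Rightarrow> complex" where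
  "cco hv E j = (of_real (1 / hv) gchoose j) * (- E) ^ j"

definition qexp :: "real \<Rightarrow> real \<Rightarrow> nat \<Rightarrow> real" where
  "qexp hv M j = M * (1 - hv * real j)"

definition qfun :: "real \<Rightarrow> real \<Rightarrow> complex \<Rightarrow> complex \<Rightarrow> complex" where
  "qfun hv M E x = (\<Sum>j\<le>sidx hv M. cco hv E j * x powr of_real (qexp hv M j))"

definition log_case :: "real \<Rightarrow> real \<Rightarrow> bool" where
  "log_case hv M \<longleftrightarrow> (\<exists>m::nat. m > 0 \<and> (M + 1) / (hv * M) = real m)"

definition Sfun :: "real \<Rightarrow> real \<Rightarrow> complex \<Rightarrow> complex \<Rightarrow> complex" where
  "Sfun hv M E x =
     (if log_case hv M then
        (\<Sum>j<sidx hv M. contour_integral (linepath 0 x)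
             (\<lambda>y. cco hv E j * y powr of_real (qexp hv M j)))
        + cco hv E (sidx hv M) * Ln x
      else contour_integral (linepath 0 x) (\<lambda>y. qfun hv M E y))"

definition ode_sol :: "(complex \<Rightarrow> complex^'v^'v) \<Rightarrow> (complex \<Rightarrow> complex^'v) \<Rightarrow> bool" where
  "ode_sol L \<Psi> \<longleftrightarrow> (\<forall>x\<in>ctilde. \<forall>i.
      ((\<lambda>z. \<Psi> z $ i) has_field_derivative (- (L x *v \<Psi> x) $ i)) (at x))"

definition asymp_along ::
  "complex filter \<Rightarrow> (complex \<Rightarrow> complex) \<Rightarrow> (complex \<Rightarrow> complex) \<Rightarrow> complex^'v^'v \<Rightarrow>
   complex \<Rightarrow> complex^'v \<Rightarrow> (complex \<Rightarrow> complex^'v) \<Rightarrow> bool" where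
  "asymp_along F S q H lam \<psi> \<Psi> \<longleftrightarrow> (\<exists>r. (r \<longlongrightarrow> 0) F \<and>
     (\<forall>\<^sub>F x in F. \<Psi> x = exp (- lam * S x) *s (mexp (cscale (- Ln (q x)) H) *v (\<psi> + r x))))"

end

theory Submission
  imports Defs
begin

text \<open>
  Put \<open>\<Lambda> = e + \<zeta>a\<^sub>0\<close> and \<open>\<Psi> = e\<^bsup>-\<lambda>S\<^esup> q\<^bsup>-h\<^esup> Y\<^sub>0\<close>. In the variable \<open>w = x\<^bsup>M+1\<^esup>\<close>, which maps
  the sector onto the right half plane, the equation becomes
  \<open>Y\<^sub>0' = - (g\<kappa>(\<Lambda> - \<lambda>) + (g/w)(\<ell> - Mh) + O(|w|\<^bsup>-1-\<epsilon>\<^esup>)) Y\<^sub>0\<close> with \<open>g = 1/(M+1)\<close> and \<open>\<kappa> \<rightarrow> 1\<close>.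
  No root lies below the lowest one, so \<open>[\<Lambda>, f\<^sub>i] = h\<^sub>i\<close>; hence \<open>\<ell> - Mh = [\<Lambda>, X]\<close> for a
  combination \<open>X\<close> of the \<open>f\<^sub>i\<close>, and passing to \<open>Y = (1 + X/w) Y\<^sub>0\<close> removes the non-integrable
  \<open>1/w\<close> term. Since \<open>\<lambda>\<close> is simple and all other eigenvalues have smaller real part, there is an
  inner product for which \<open>\<Lambda> - \<lambda>\<close> is dissipative, so along nearly horizontal lines in the
  \<open>w\<close>-plane the norm of \<open>Y\<close> cannot grow when one moves back from infinity, up to a factor
  \<open>exp O((Re w)\<^bsup>-\<epsilon>\<^esup>)\<close>. This gives uniqueness at once. For existence, the solutions with
  \<open>Y\<^sub>0(m) = \<psi>\<close> converge as \<open>m \<rightarrow> \<infinity>\<close>, locally uniformly in \<open>E\<close>, to a solution with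
  \<open>Y\<^sub>0 \<rightarrow> \<psi>\<close> as \<open>Re w \<rightarrow> \<infinity>\<close>. In the variable \<open>t = log x\<close> the equation is linear with entire
  coefficients, so all solutions extend to the slit plane and depend holomorphically on \<open>E\<close>.
\<close>

text \<open>Only the eigenvalue lam of \<open>\<Lambda>\<close> is controlled:
  \<open>\<Lambda>\<close> may fail to be diagonalizable, and the other eigenvalues may be far from
  the real axis. So no fundamental system at infinity is built, and a quadratic form adapted to
  \<open>\<Lambda>\<close> takes the place of a diagonalization. Relative to the wanted solution all
  others can only grow towards infinity, so moving inwards from a remote point is the stable
  direction. The form is monotone not only along the real axis but in a whole cone |Im d| <=
  \<theta> Re d of directions. This gives the full sector: every point of a half plane Re w >= W
  lies in the backward cone of a sufficiently remote real point, however narrow the cone is. The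
  truncation index s of the action is the least one for which the first omitted power of w is
  integrable at infinity. All constants depend on E only through a bound R for |E|; the solutions
  found on different discs in E are glued by uniqueness.\<close>

no_notation fps_nth (infixl "$" 75)

section \<open>Matrix Lie algebras and Chevalley generators\<close>

lemma cscale_nth [simp]: "cscale c A $ i $ j = c * A $ i $ j"
  by (simp add: cscale_def)

lemma cscale_add_right: "cscale c (A + B) = cscale c A + cscale c B"
  and cscale_diff_right: "cscale c (A - B) = cscale c A - cscale c B"
  and cscale_add_left: "cscale (c + d) A = cscale c A + cscale d A"
  and cscale_diff_left: "cscale (c - d) A = cscale c A - cscale d A"
  and cscale_cscale [simp]: "cscale c (cscale d A) = cscale (c * d) A"
  and cscale_one [simp]: "cscale 1 A = A"
  and cscale_zero_left [simp]: "cscale 0 A = 0"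
  and cscale_zero_right [simp]: "cscale c 0 = 0"
  and cscale_minus_left: "cscale (- c) A = - cscale c A"
  and cscale_minus_right: "cscale c (- A) = - cscale c A"
  by (simp_all add: vec_eq_iff algebra_simps)

lemma cscale_sum_right: "cscale c (\<Sum>i\<in>I. A i) = (\<Sum>i\<in>I. cscale c (A i))"
  by (induction I rule: infinite_finite_induct) (simp_all add: cscale_add_right)

lemma cscale_sum_left: "cscale (\<Sum>i\<in>I. c i) A = (\<Sum>i\<in>I. cscale (c i) A)"
  by (induction I rule: infinite_finite_induct) (simp_all add: cscale_add_left)

lemma cscale_mult_left [simp]: "cscale c A ** B = cscale c (A ** B)"
  and cscale_mult_right [simp]: "A ** cscale c B = cscale c (A ** B)"
  by (simp_all add: vec_eq_iff matrix_matrix_mult_def sum_distrib_left mult_ac)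

lemma cscale_mult_vec [simp]: "cscale c A *v v = c *s (A *v v)"
  by (simp add: vec_eq_iff matrix_vector_mult_def sum_distrib_left mult_ac)

lemma mult_vec_smult [simp]: "A *v (c *s v) = c *s (A *v v)" for A :: "complex^'m^'k"
  by (simp add: vec_eq_iff matrix_vector_mult_def sum_distrib_left mult_ac)

lemma cscale_eq_0_iff: "cscale c A = 0 \<longleftrightarrow> c = 0 \<or> A = 0"
  by (auto simp: vec_eq_iff)

lemma matrix_diff_distrib_left: "A ** (B - C) = A ** B - A ** C"
  and matrix_diff_distrib_right: "(B - C) ** D = B ** D - C ** D"
  and matrix_add_distrib_right: "(B + C) ** D = B ** D + C ** D"
  and matrix_minus_left: "(- B) ** D = - (B ** D)"
  and matrix_minus_right: "A ** (- B) = - (A ** B)"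
  for A B C D :: "complex^'m^'m"
  by (simp_all add: vec_eq_iff matrix_matrix_mult_def sum_subtractf sum.distrib sum_negf algebra_simps)

lemmas matrix_distribs = matrix_add_ldistrib matrix_add_distrib_right
  matrix_diff_distrib_left matrix_diff_distrib_right matrix_minus_left matrix_minus_right

lemma matrix_mult_zero [simp]: "A ** 0 = 0" for A :: "complex^'m^'m"
  by (simp add: vec_eq_iff matrix_matrix_mult_def)

lemma lbr_add_left: "lbr (A + B) C = lbr A C + lbr B C"
  and lbr_add_right: "lbr A (B + C) = lbr A B + lbr A C"
  and lbr_diff_left: "lbr (A - B) C = lbr A C - lbr B C"
  and lbr_cscale_left: "lbr (cscale c A) B = cscale c (lbr A B)"
  and lbr_cscale_right: "lbr A (cscale c B) = cscale c (lbr A B)"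
  and lbr_zero_left [simp]: "lbr 0 A = 0"
  and lbr_zero_right [simp]: "lbr A 0 = 0"
  by (simp_all add: lbr_def matrix_distribs cscale_diff_right)

lemma lbr_sum_left: "lbr (\<Sum>i\<in>I. A i) B = (\<Sum>i\<in>I. lbr (A i) B)"
  by (induction I rule: infinite_finite_induct) (simp_all add: lbr_add_left)

lemma lbr_sum_right: "lbr B (\<Sum>i\<in>I. A i) = (\<Sum>i\<in>I. lbr B (A i))"
  by (induction I rule: infinite_finite_induct) (simp_all add: lbr_add_right)

lemma lbr_jacobi: "lbr A (lbr B C) = lbr (lbr A B) C + lbr B (lbr A C)"
  by (simp add: lbr_def matrix_distribs matrix_mul_assoc)

lemma complex_lie_subalg_lie_generated: "complex_lie_subalg (lie_generated S)"
  unfolding complex_lie_subalg_def lie_generated_def by blast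

lemma lie_generated_superset: "S \<subseteq> lie_generated S"
  unfolding lie_generated_def by blast

lemma lie_generated_zero:
  assumes "S \<subseteq> {0}"
  shows "lie_generated S = {0}"
proof -
  have "complex_lie_subalg {0}" by (simp add: complex_lie_subalg_def)
  then have "lie_generated S \<subseteq> {0}" using assms unfolding lie_generated_def by blast
  then show ?thesis
    using complex_lie_subalg_lie_generated[of S] unfolding complex_lie_subalg_def by blast
qed

lemma complex_lie_subalg_sum:
  assumes K: "complex_lie_subalg K" and X: "\<And>i. i \<in> I \<Longrightarrow> X i \<in> K"
  shows "(\<Sum>i\<in>I. cscale (c i) (X i)) \<in> K"
  using X
proof (induction I rule: infinite_finite_induct)
  case (insert i I)
  then show ?case using K by (simp add: complex_lie_subalg_def)
qed (use K in \<open>simp_all add: complex_lie_subalg_def\<close>)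

section \<open>Consequences of the Chevalley relations, carried over to the representation\<close>

locale chevalley =
  fixes n :: nat and A :: "nat \<Rightarrow> nat \<Rightarrow> int"
    and G :: "(complex^'n^'n) set" and e f h :: "nat \<Rightarrow> complex^'n^'n"
    and \<rho> :: "complex^'n^'n \<Rightarrow> complex^'v^'v"
    and k0 :: "nat \<Rightarrow> int" and a0 :: "complex^'n^'n"
  assumes ADE: "ADE_cartan n A"
    and CS: "chevalley_serre G n A e f h"
    and rep: "lie_rep G \<rho>"
    and low: "lowest_root G n A h k0"
    and a0: "a0 \<in> root_space G n A h k0" "a0 \<noteq> 0"
begin

lemma G_subalg: "complex_lie_subalg G"
  using CS complex_lie_subalg_lie_generated unfolding chevalley_serre_def by metis

lemma generators_in_G: "i < n \<Longrightarrow> e i \<in> G" "i < n \<Longrightarrow> f i \<in> G" "i < n \<Longrightarrow> h i \<in> G"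
  using CS lie_generated_superset[of "e ` {..<n} \<union> f ` {..<n} \<union> h ` {..<n}"]
  unfolding chevalley_serre_def by blast+

lemma chevalley_relations:
  assumes "i < n" "j < n"
  shows "lbr (h i) (h j) = 0"
    and "lbr (h i) (e j) = cscale (of_int (A i j)) (e j)"
    and "lbr (h i) (f j) = cscale (- of_int (A i j)) (f j)"
    and "lbr (e i) (f j) = (if i = j then h i else 0)"
  using CS assms unfolding chevalley_serre_def by blast+

lemma cartan_diag: "i < n \<Longrightarrow> A i i = 2"
  using ADE by (simp add: ADE_cartan_def)

text \<open>If e_i = 0, then h_i = [e_i, f_i] = 0, and [h_i, e_j] = A i j e_j kills every e_j
  adjacent to i. The vanishing indices thus form a union of components of the Dynkin diagram; as
  this is connected, all generators vanish, against \<open>G \<noteq> {0}\<close>.\<close>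

lemma e_nonzero:
  assumes "i < n"
  shows "e i \<noteq> 0"
proof
  assume ei: "e i = 0"
  define I where "I = {i. i < n \<and> e i = 0}"
  have hI: "h i = 0" if "i \<in> I" for i
    using that chevalley_relations(4)[of i i] by (simp add: I_def)
  have "A i j = 0" if "i \<in> I" "j \<in> {..<n} - I" for i j
    using that chevalley_relations(2)[of i j] hI[of i] by (auto simp: I_def cscale_eq_0_iff)
  moreover have "I \<noteq> {}" "I \<subseteq> {..<n}" using assms ei by (auto simp: I_def)
  moreover have "\<not> (\<exists>I. I \<subseteq> {..<n} \<and> I \<noteq> {} \<and> I \<noteq> {..<n} \<and>
      (\<forall>i\<in>I. \<forall>j\<in>{..<n} - I. A i j = 0))"
    using ADE unfolding ADE_cartan_def by (elim conjE)
  ultimately have I: "I = {..<n}" by meson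
  have h0: "h i = 0" if "i < n" for i using hI I that by auto
  moreover have "e i = 0" if "i < n" for i using I that by (auto simp: I_def)
  moreover have "f i = 0" if "i < n" for i
    using chevalley_relations(3)[OF that that] h0[OF that] cartan_diag[OF that]
    by (simp add: cscale_eq_0_iff)
  ultimately have "e ` {..<n} \<union> f ` {..<n} \<union> h ` {..<n} \<subseteq> {0}" by auto
  then show False using CS lie_generated_zero unfolding chevalley_serre_def by metis
qed

lemma f_nonzero:
  assumes "i < n"
  shows "f i \<noteq> 0"
proof
  assume "f i = 0"
  then have "h i = 0" using chevalley_relations(4)[OF assms assms] by simp
  then show False
    using chevalley_relations(2)[OF assms assms] cartan_diag[OF assms] e_nonzero[OF assms]
    by (simp add: cscale_eq_0_iff)
qed

lemma n_pos: "0 < n" using ADE by (simp add: ADE_cartan_def)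

lemma height_delta: "i < n \<Longrightarrow> height n (\<lambda>j. if j = i then c else 0) = c"
  by (simp add: height_def)

text \<open>The negative of a simple root is a root of height -1, and the lowest root is not higher.
  Hence the dual Coxeter number is an integer and at least 2.\<close>

lemma height_k0: "height n k0 \<le> -1"
proof -
  let ?k = "\<lambda>j. if j = (0::nat) then -1 else (0::int)"
  have "f 0 \<in> root_space G n A h ?k"
    using generators_in_G n_pos chevalley_relations(3)[OF _ n_pos]
    by (auto simp: root_space_def if_distrib[where f = "\<lambda>x. x * _"] cong: if_cong)
  then have "is_root G n A h ?k"
    using f_nonzero[OF n_pos] n_pos by (auto simp: is_root_def)
  then show ?thesis using low height_delta[OF n_pos, of "-1"] by (auto simp: lowest_root_def)
qed

lemma a0_in_G: "a0 \<in> G" using a0 by (simp add: root_space_def)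

lemma h_a0: "i < n \<Longrightarrow> lbr (h i) a0 = cscale (of_int (\<Sum>j<n. k0 j * A i j)) a0"
  using a0 by (simp add: root_space_def)

lemma a0_f:
  assumes i: "i < n"
  shows "lbr a0 (f i) = 0"
proof (rule ccontr)
  assume nz: "lbr a0 (f i) \<noteq> 0"
  define k where "k = (\<lambda>j. k0 j - (if j = i then 1 else 0))"
  have k: "(\<Sum>j<n. k j * A l j) = (\<Sum>j<n. k0 j * A l j) - A l i" for l
    using i by (simp add: k_def left_diff_distrib sum_subtractf if_distrib[where f = "\<lambda>x. x * _"]
      cong: if_cong)
  have hk: "height n k = height n k0 - 1"
    using i by (simp add: k_def height_def sum_subtractf)
  have "lbr (h l) (lbr a0 (f i)) = cscale (of_int (\<Sum>j<n. k j * A l j)) (lbr a0 (f i))"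
    if "l < n" for l
    unfolding lbr_jacobi[of "h l"] h_a0[OF that] chevalley_relations(3)[OF that i]
      lbr_cscale_left lbr_cscale_right k
    by (simp only: cscale_add_left[symmetric] of_int_add of_int_minus diff_conv_add_uminus)
  moreover have "lbr a0 (f i) \<in> G"
    using G_subalg a0_in_G generators_in_G i by (auto simp: complex_lie_subalg_def)
  ultimately have "lbr a0 (f i) \<in> root_space G n A h k" by (simp add: root_space_def)
  moreover have "\<forall>j\<ge>n. k j = 0"
    using low i by (auto simp: k_def lowest_root_def is_root_def)
  \<comment> \<open>\<open>is_root\<close> excludes the zero weight. The new weight is not zero,
    because its height is at most -2.\<close>
  moreover have "\<exists>j<n. k j \<noteq> 0"
  proof (rule ccontr)
    assume "\<not> (\<exists>j<n. k j \<noteq> 0)"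
    then have "height n k = 0" by (simp add: height_def)
    then show False using hk height_k0 by simp
  qed
  ultimately have "is_root G n A h k" using nz by (auto simp: is_root_def)
  then show False using low hk by (auto simp: lowest_root_def)
qed

lemma rep_add: "X \<in> G \<Longrightarrow> Y \<in> G \<Longrightarrow> \<rho> (X + Y) = \<rho> X + \<rho> Y"
  and rep_lbr: "X \<in> G \<Longrightarrow> Y \<in> G \<Longrightarrow> \<rho> (lbr X Y) = lbr (\<rho> X) (\<rho> Y)"
  and rep_cscale: "X \<in> G \<Longrightarrow> \<rho> (cscale c X) = cscale c (\<rho> X)"
  using rep by (simp_all add: lie_rep_def)

lemma rep_zero: "\<rho> 0 = 0"
  using rep_cscale[OF a0_in_G, of 0] by simp

lemma rep_sum:
  assumes "\<And>i. i \<in> I \<Longrightarrow> X i \<in> G"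
  shows "\<rho> (\<Sum>i\<in>I. cscale (c i) (X i)) = (\<Sum>i\<in>I. cscale (c i) (\<rho> (X i)))"
  using assms
proof (induction I rule: infinite_finite_induct)
  case (insert i I)
  have "cscale (c i) (X i) \<in> G" "(\<Sum>i\<in>I. cscale (c i) (X i)) \<in> G"
    using insert.prems G_subalg complex_lie_subalg_sum[OF G_subalg, of I X c]
    by (auto simp: complex_lie_subalg_def)
  then show ?case using insert by (simp add: rep_add rep_cscale)
qed (simp_all add: rep_zero)

lemma cartan_sub_in_G: "X \<in> cartan_sub n h \<Longrightarrow> X \<in> G"
  unfolding cartan_sub_def
  using complex_lie_subalg_sum[OF G_subalg, of "{..<n}" h] generators_in_G by auto

lemma rep_cartan_commute:
  assumes "X \<in> cartan_sub n h" "Y \<in> cartan_sub n h"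
  shows "lbr (\<rho> X) (\<rho> Y) = 0"
proof -
  obtain c d where X: "X = (\<Sum>i<n. cscale (c i) (h i))" and Y: "Y = (\<Sum>i<n. cscale (d i) (h i))"
    using assms by (auto simp: cartan_sub_def)
  have "lbr X Y = 0"
    unfolding X Y lbr_sum_left lbr_sum_right lbr_cscale_left lbr_cscale_right
    by (simp add: chevalley_relations(1))
  then show ?thesis
    using rep_lbr[of X Y] cartan_sub_in_G assms by (simp add: rep_zero)
qed

lemma rep_principal_e:
  assumes hh: "hh \<in> cartan_sub n h" "\<forall>i<n. lbr hh (e i) = e i"
  shows "lbr (\<rho> hh) (\<Sum>i<n. \<rho> (e i)) = (\<Sum>i<n. \<rho> (e i))"
  unfolding lbr_sum_right
  using hh cartan_sub_in_G generators_in_G by (auto simp: rep_lbr[symmetric])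

text \<open>As e_j is nonzero, [hh, e_j] = e_j forces the j-th simple root to take the value 1 at
  hh. So hh grades the root spaces by height.\<close>

lemma rep_principal_a0:
  assumes hh: "hh \<in> cartan_sub n h" "\<forall>i<n. lbr hh (e i) = e i"
  shows "lbr (\<rho> hh) (\<rho> a0) = cscale (of_int (height n k0)) (\<rho> a0)"
proof -
  obtain c where c: "hh = (\<Sum>i<n. cscale (c i) (h i))"
    using hh by (auto simp: cartan_sub_def)
  have c1: "(\<Sum>i<n. c i * of_int (A i j)) = 1" if j: "j < n" for j
  proof -
    have "lbr hh (e j) = cscale (\<Sum>i<n. c i * of_int (A i j)) (e j)"
      unfolding c lbr_sum_left lbr_cscale_left cscale_sum_left
      by (simp add: chevalley_relations(2)[OF _ j])
    then have "cscale ((\<Sum>i<n. c i * of_int (A i j)) - 1) (e j) = 0"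
      using hh j by (simp add: cscale_diff_left)
    then show ?thesis using e_nonzero[OF j] by (simp add: cscale_eq_0_iff)
  qed
  have "lbr hh a0 = cscale (\<Sum>i<n. c i * of_int (\<Sum>j<n. k0 j * A i j)) a0"
    unfolding c lbr_sum_left lbr_cscale_left cscale_sum_left by (simp add: h_a0)
  also have "(\<Sum>i<n. c i * of_int (\<Sum>j<n. k0 j * A i j))
      = (\<Sum>j<n. of_int (k0 j) * (\<Sum>i<n. c i * of_int (A i j)))"
    unfolding of_int_sum sum_distrib_left by (subst sum.swap) (simp add: mult_ac)
  also have "\<dots> = of_int (height n k0)"
    using c1 by (simp add: height_def)
  finally show ?thesis
    using rep_lbr[of hh a0] rep_cscale[OF a0_in_G] a0_in_G hh(1) cartan_sub_in_G by metis
qed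

text \<open>No root lies below the lowest one, so \<open>a\<^sub>0\<close> commutes with all \<open>f\<^sub>i\<close> and hence
  \<open>[e + a\<^sub>0, f\<^sub>i] = h\<^sub>i\<close>.\<close>
lemma rep_cartan_is_bracket:
  assumes "X \<in> cartan_sub n h" "Y \<in> cartan_sub n h"
  obtains Z where "lbr ((\<Sum>i<n. \<rho> (e i)) + cscale \<zeta> (\<rho> a0)) Z = \<rho> X - cscale m (\<rho> Y)"
proof -
  obtain c d where X: "X = (\<Sum>i<n. cscale (c i) (h i))" and Y: "Y = (\<Sum>i<n. cscale (d i) (h i))"
    using assms by (auto simp: cartan_sub_def)
  define k where "k i = c i - m * d i" for i
  have rs: "\<rho> (\<Sum>i<n. cscale (k i) (h i)) = (\<Sum>i<n. cscale (k i) (\<rho> (h i)))" for k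
    by (rule rep_sum) (simp add: generators_in_G)
  have rX: "\<rho> X - cscale m (\<rho> Y) = (\<Sum>i<n. cscale (k i) (\<rho> (h i)))"
    unfolding X Y
    by (simp add: rs cscale_sum_right k_def cscale_diff_left sum_subtractf)
  have ef: "lbr (\<rho> (e j)) (\<rho> (f i)) = (if i = j then \<rho> (h i) else 0)" if "i < n" "j < n" for i j
    using that rep_lbr[of "e j" "f i"] generators_in_G chevalley_relations(4)[of j i]
    by (auto simp: rep_zero)
  have af: "lbr (\<rho> a0) (\<rho> (f i)) = 0" if "i < n" for i
    using that rep_lbr[of a0 "f i"] a0_in_G generators_in_G a0_f by (auto simp: rep_zero)
  have "lbr ((\<Sum>i<n. \<rho> (e i)) + cscale \<zeta> (\<rho> a0)) (\<Sum>i<n. cscale (k i) (\<rho> (f i)))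
      = \<rho> X - cscale m (\<rho> Y)"
    unfolding rX lbr_sum_right lbr_cscale_right lbr_add_left lbr_sum_left lbr_cscale_left
    by (rule sum.cong) (simp_all add: af ef cscale_sum_right if_distrib[where f = "cscale _"] cong: if_cong)
  then show ?thesis using that by blast
qed

end

section \<open>Matrix exponentials\<close>

text \<open>Derivatives are taken entry by entry, so that the scalar theorems on primitives, power
  series and uniform limits apply directly.\<close>

definition has_vec_deriv :: "(complex \<Rightarrow> complex^'v) \<Rightarrow> complex^'v \<Rightarrow> complex \<Rightarrow> bool" where
  "has_vec_deriv F D z \<longleftrightarrow> (\<forall>i. ((\<lambda>z. F z $ i) has_field_derivative D $ i) (at z))"

definition has_mat_deriv :: "(complex \<Rightarrow> complex^'m^'k) \<Rightarrow> complex^'m^'k \<Rightarrow> complex \<Rightarrow> bool" where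
  "has_mat_deriv F D z \<longleftrightarrow> (\<forall>i j. ((\<lambda>z. F z $ i $ j) has_field_derivative D $ i $ j) (at z))"

lemma has_mat_deriv_const: "has_mat_deriv (\<lambda>_. A) 0 z"
  by (simp add: has_mat_deriv_def)

lemma has_mat_deriv_add:
  "has_mat_deriv F D z \<Longrightarrow> has_mat_deriv G D' z \<Longrightarrow> has_mat_deriv (\<lambda>z. F z + G z) (D + D') z"
  by (auto simp: has_mat_deriv_def intro!: derivative_intros)

lemma has_mat_deriv_mult:
  assumes "has_mat_deriv F D z" "has_mat_deriv G D' z"
  shows "has_mat_deriv (\<lambda>z. F z ** G z) (D ** G z + F z ** D') z"
  using assms unfolding has_mat_deriv_def matrix_matrix_mult_def
  by (auto intro!: derivative_eq_intros simp: sum.distrib mult.commute)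

lemma has_vec_deriv_mult:
  assumes "has_mat_deriv F D z" "has_vec_deriv G D' z"
  shows "has_vec_deriv (\<lambda>z. F z *v G z) (D *v G z + F z *v D') z"
  using assms unfolding has_mat_deriv_def has_vec_deriv_def matrix_vector_mult_def
  by (auto intro!: derivative_eq_intros simp: sum.distrib mult.commute)

lemma has_mat_deriv_cscale:
  assumes "(f has_field_derivative d) (at z)" "has_mat_deriv F D z"
  shows "has_mat_deriv (\<lambda>z. cscale (f z) (F z)) (cscale d (F z) + cscale (f z) D) z"
  using assms unfolding has_mat_deriv_def by (auto intro!: derivative_eq_intros)

lemma has_vec_deriv_smult:
  assumes "(f has_field_derivative d) (at z)" "has_vec_deriv F D z"
  shows "has_vec_deriv (\<lambda>z. f z *s F z) (d *s F z + f z *s D) z"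
  using assms unfolding has_vec_deriv_def by (auto intro!: derivative_eq_intros)

lemma has_mat_deriv_compose:
  assumes "(f has_field_derivative d) (at z)" "has_mat_deriv F D (f z)"
  shows "has_mat_deriv (\<lambda>z. F (f z)) (cscale d D) z"
proof -
  have "((\<lambda>z. F (f z) $ i $ j) has_field_derivative D $ i $ j * d) (at z)" for i j
    using assms DERIV_chain2[of "\<lambda>z. F z $ i $ j"] by (simp add: has_mat_deriv_def)
  then show ?thesis by (simp add: has_mat_deriv_def mult.commute)
qed

lemma has_vec_deriv_compose:
  assumes "(f has_field_derivative d) (at z)" "has_vec_deriv F D (f z)"
  shows "has_vec_deriv (\<lambda>z. F (f z)) (d *s D) z"
proof -
  have "((\<lambda>z. F (f z) $ i) has_field_derivative D $ i * d) (at z)" for i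
    using assms DERIV_chain2[of "\<lambda>z. F z $ i"] by (simp add: has_vec_deriv_def)
  then show ?thesis by (simp add: has_vec_deriv_def mult.commute)
qed

lemma has_mat_deriv_zero_constant:
  assumes "\<And>z. has_mat_deriv F 0 z"
  shows "F z = F w"
proof -
  have "F z $ i $ j = F w $ i $ j" for i j
    using has_field_derivative_zero_constant[of UNIV "\<lambda>z. F z $ i $ j"] assms
    by (auto simp: has_mat_deriv_def)
  then show ?thesis by (simp add: vec_eq_iff)
qed

lemma mpow_bound: "norm (mpow X k $ i $ j) \<le> (\<Sum>i\<in>UNIV. \<Sum>j\<in>UNIV. norm (X $ i $ j)) ^ k"
proof (induction k arbitrary: i)
  case 0
  then show ?case by (simp add: mat_def)
next
  case (Suc k)
  let ?B = "\<Sum>i\<in>UNIV. \<Sum>j\<in>UNIV. norm (X $ i $ j)"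
  have "norm (mpow X (Suc k) $ i $ j) \<le> (\<Sum>l\<in>UNIV. norm (X $ i $ l * mpow X k $ l $ j))"
    by (simp add: matrix_matrix_mult_def norm_sum)
  also have "\<dots> \<le> (\<Sum>l\<in>UNIV. norm (X $ i $ l) * ?B ^ k)"
    by (intro sum_mono) (simp add: norm_mult mult_left_mono Suc.IH)
  also have "\<dots> = (\<Sum>l\<in>UNIV. norm (X $ i $ l)) * ?B ^ k" by (simp add: sum_distrib_right)
  also have "\<dots> \<le> ?B * ?B ^ k"
    by (intro mult_right_mono member_le_sum[where f = "\<lambda>i. \<Sum>l\<in>UNIV. norm (X $ i $ l)"])
      (auto intro!: sum_nonneg zero_le_power)
  finally show ?case by simp
qed

lemma mpow_cscale: "mpow (cscale c X) k = cscale (c ^ k) (mpow X k)"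
  by (induction k) (simp_all add: mult_ac)

lemma mpow_commute: "mpow X k ** X = X ** mpow X k"
  by (induction k) (simp_all add: matrix_mul_assoc[symmetric])

lemma summable_mexp: "summable (\<lambda>k. mpow X k $ i $ j / fact k * c ^ k)"
proof (rule summable_comparison_test')
  let ?B = "\<Sum>i\<in>UNIV. \<Sum>j\<in>UNIV. norm (X $ i $ j)"
  show "summable (\<lambda>k. (?B * norm c) ^ k /\<^sub>R fact k)" by (rule summable_exp_generic)
  show "norm (mpow X k $ i $ j / fact k * c ^ k) \<le> (?B * norm c) ^ k /\<^sub>R fact k" for k
    using mpow_bound[of X k i j]
    by (simp add: norm_mult norm_divide norm_power power_mult_distrib divide_simps mult_right_mono)
qed

lemma mexp_cscale_nth: "mexp (cscale c X) $ i $ j = (\<Sum>k. mpow X k $ i $ j / fact k * c ^ k)"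
  by (simp add: mexp_def mpow_cscale mult_ac)

lemma mexp_zero [simp]: "mexp 0 = mat 1"
proof -
  \<comment> \<open>Zero is written as \<open>cscale 0 0\<close>, which makes the series a power
    series evaluated at its centre.\<close>
  have "mexp (cscale 0 (0::complex^'a^'a)) $ i $ j = mat 1 $ i $ j" for i j
    unfolding mexp_cscale_nth by (subst powser_zero) simp
  then show ?thesis by (simp add: vec_eq_iff)
qed

text \<open>The right side is the termwise derivative in c of the series for
  \<open>mexp (cscale c X)\<close>; multiplication by X shifts the coefficients by one.\<close>

lemma mexp_mult_nth:
  "(X ** mexp (cscale c X)) $ i $ j = (\<Sum>k. mpow X (Suc k) $ i $ j / fact k * c ^ k)"
proof -
  have "(X ** mexp (cscale c X)) $ i $ j
      = (\<Sum>l\<in>UNIV. \<Sum>k. X $ i $ l * (mpow X k $ l $ j / fact k * c ^ k))"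
    unfolding matrix_matrix_mult_def vec_lambda_beta mexp_cscale_nth
    by (intro sum.cong refl suminf_mult[symmetric] summable_mexp)
  also have "\<dots> = (\<Sum>k. \<Sum>l\<in>UNIV. X $ i $ l * (mpow X k $ l $ j / fact k * c ^ k))"
    by (intro suminf_sum[symmetric] summable_mult summable_mexp)
  also have "\<dots> = (\<Sum>k. mpow X (Suc k) $ i $ j / fact k * c ^ k)"
    by (simp add: matrix_matrix_mult_def sum_distrib_right sum_divide_distrib mult.assoc)
  finally show ?thesis .
qed

lemma mexp_commute: "X ** mexp (cscale c X) = mexp (cscale c X) ** X"
proof -
  have "(mexp (cscale c X) ** X) $ i $ j = (\<Sum>k. mpow X (Suc k) $ i $ j / fact k * c ^ k)" for i j
  proof -
    have "(mexp (cscale c X) ** X) $ i $ j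
        = (\<Sum>l\<in>UNIV. \<Sum>k. mpow X k $ i $ l / fact k * c ^ k * X $ l $ j)"
      unfolding matrix_matrix_mult_def vec_lambda_beta mexp_cscale_nth
      by (intro sum.cong refl suminf_mult2 summable_mexp)
    also have "\<dots> = (\<Sum>k. \<Sum>l\<in>UNIV. mpow X k $ i $ l / fact k * c ^ k * X $ l $ j)"
      by (intro suminf_sum[symmetric] summable_mult2 summable_mexp)
    also have "\<dots> = (\<Sum>k. (mpow X k ** X) $ i $ j / fact k * c ^ k)"
      by (simp add: matrix_matrix_mult_def sum_distrib_right sum_divide_distrib mult.assoc
        mult.commute[of "X $ _ $ _"])
    finally show ?thesis by (simp add: mpow_commute)
  qed
  then show ?thesis by (simp add: vec_eq_iff mexp_mult_nth)
qed

lemma has_mat_deriv_mexp: "has_mat_deriv (\<lambda>c. mexp (cscale c X)) (X ** mexp (cscale c X)) c"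
proof -
  have "((\<lambda>c. mexp (cscale c X) $ i $ j) has_field_derivative
      (\<Sum>k. diffs (\<lambda>k. mpow X k $ i $ j / fact k) k * c ^ k)) (at c)" for i j
    unfolding mexp_cscale_nth by (rule termdiffs_strong_converges_everywhere) (rule summable_mexp)
  moreover have "diffs (\<lambda>k. mpow X k $ i $ j / fact k) k = mpow X (Suc k) $ i $ j / fact k" for i j k
  proof -
    have "of_nat (Suc k) * (y / fact (Suc k)) = y / (fact k :: complex)" for y
      by (simp add: field_simps del: of_nat_Suc)
    then show ?thesis by (simp add: diffs_def del: mpow.simps of_nat_Suc fact_Suc)
  qed
  ultimately show ?thesis by (simp add: has_mat_deriv_def mexp_mult_nth del: mpow.simps)
qed

lemma has_mat_deriv_mexp_compose:
  assumes "(f has_field_derivative d) (at z)"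
  shows "has_mat_deriv (\<lambda>z. mexp (cscale (f z) X)) (cscale d (X ** mexp (cscale (f z) X))) z"
  by (rule has_mat_deriv_compose[OF assms has_mat_deriv_mexp])

text \<open>Differentiating a conjugation produces a bracket. For B = 1 the bracket is 0, which
  yields the inverse of the exponential; for an eigenvector B of the bracket it yields
  \<open>mexp_intertwine\<close>.\<close>

lemma mexp_conj_deriv:
  "has_mat_deriv (\<lambda>c. mexp (cscale c X) ** B ** mexp (cscale (- c) X))
     (mexp (cscale c X) ** lbr X B ** mexp (cscale (- c) X)) c"
proof -
  have "has_mat_deriv (\<lambda>c. mexp (cscale (- c) X)) (cscale (- 1) (X ** mexp (cscale (- c) X))) c"
    by (rule has_mat_deriv_mexp_compose) (auto intro!: derivative_eq_intros)
  from has_mat_deriv_mult[OF has_mat_deriv_mult[OF has_mat_deriv_mexp has_mat_deriv_const] this]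
  have "has_mat_deriv (\<lambda>c. mexp (cscale c X) ** B ** mexp (cscale (- c) X))
      ((X ** mexp (cscale c X) ** B + mexp (cscale c X) ** 0) ** mexp (cscale (- c) X)
        + mexp (cscale c X) ** B ** cscale (- 1) (X ** mexp (cscale (- c) X))) c" .
  then show ?thesis
    by (simp add: lbr_def matrix_distribs mexp_commute matrix_mul_assoc cscale_minus_left)
qed

lemma mexp_right_inverse: "mexp (cscale c X) ** mexp (cscale (- c) X) = mat 1"
proof -
  have "has_mat_deriv (\<lambda>c. mexp (cscale c X) ** mexp (cscale (- c) X)) 0 c" for c
    using mexp_conj_deriv[of X "mat 1" c] by (simp add: lbr_def)
  from has_mat_deriv_zero_constant[OF this, of c 0] show ?thesis by simp
qed

lemma mexp_left_inverse: "mexp (cscale (- c) X) ** mexp (cscale c X) = mat 1"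
  using mexp_right_inverse[of "- c" X] by simp

text \<open>The factor exp(-k c) compensates the growth of the conjugated B, so \<open>Z\<close> has
  derivative 0. Applied to the grading element, this turns conjugation by q^h into multiplication by
  a power of q.\<close>

lemma mexp_intertwine:
  assumes "lbr X B = cscale k B"
  shows "mexp (cscale c X) ** B = cscale (exp (k * c)) (B ** mexp (cscale c X))"
proof -
  define Z where "Z c = cscale (exp (- k * c)) (mexp (cscale c X) ** B ** mexp (cscale (- c) X))" for c
  have "has_mat_deriv Z 0 c" for c
  proof -
    have "((\<lambda>c. exp (- k * c)) has_field_derivative exp (- k * c) * (- k)) (at c)"
      by (auto intro!: derivative_eq_intros)
    from has_mat_deriv_cscale[OF this mexp_conj_deriv[of X B c]]
    show ?thesis
      unfolding Z_def assms by (simp add: cscale_add_left[symmetric] mult_ac)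
  qed
  from has_mat_deriv_zero_constant[OF this, of c 0] have "Z c = B" by (simp add: Z_def)
  then have "cscale (exp (k * c)) (Z c ** mexp (cscale c X))
      = cscale (exp (k * c)) (B ** mexp (cscale c X))" by simp
  then show ?thesis
    by (simp add: Z_def matrix_mul_assoc[symmetric] mexp_left_inverse exp_minus)
qed

section \<open>Spectral projections and Lyapunov forms\<close>

text \<open>The adjugate. Its cofactors are determinants of full size with row j replaced by a unit
  vector, so the entries are visibly polynomial in those of B.\<close>

definition adjm :: "complex^'n^'n \<Rightarrow> complex^'n^'n" where
  "adjm B = (\<chi> i j. det (\<chi> k. if k = j then axis i 1 else B $ k))"

text \<open>By linearity in row j, entry (r, j) of the product is the determinant of B with row j
  replaced by row r; for r \<noteq> j two rows coincide.\<close>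

lemma matrix_mult_adjm: "B ** adjm B = cscale (det B) (mat 1)"
proof -
  have "(B ** adjm B) $ r $ j = det B * mat 1 $ r $ j" for r j
  proof -
    have "(B ** adjm B) $ r $ j
        = (\<Sum>i\<in>UNIV. det (\<chi> k. if k = j then B $ r $ i *s axis i 1 else B $ k))"
      using det_row_mul[of j "B $ r $ _" "\<lambda>_. axis _ 1" "\<lambda>k. B $ k"]
      by (simp add: matrix_matrix_mult_def adjm_def)
    also have "\<dots> = det (\<chi> k. if k = j then (\<Sum>i\<in>UNIV. B $ r $ i *s axis i 1) else B $ k)"
      using det_linear_row_sum[of UNIV j "\<lambda>_ i. B $ r $ i *s axis i 1" "\<lambda>k. B $ k"] by simp
    also have "(\<Sum>i\<in>UNIV. B $ r $ i *s axis i 1) = B $ r" by (rule basis_expansion)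
    also have "det (\<chi> k. if k = j then B $ r else B $ k) = det B * mat 1 $ r $ j"
    proof (cases "r = j")
      case True
      then have "(\<chi> k. if k = j then B $ r else B $ k) = B" by (simp add: vec_eq_iff)
      then show ?thesis using True by (simp add: mat_def)
    next
      case False
      have "det (\<chi> k. if k = j then B $ r else B $ k) = 0"
        by (rule det_identical_rows[OF False]) (use False in \<open>simp add: row_def vec_eq_iff\<close>)
      then show ?thesis using False by (simp add: mat_def)
    qed
    finally show ?thesis .
  qed
  then show ?thesis by (simp add: vec_eq_iff)
qed

lemma holomorphic_on_det:
  assumes "\<And>i j. (\<lambda>z. B z $ i $ j) holomorphic_on S"
  shows "(\<lambda>z. det (B z)) holomorphic_on S"
  unfolding det_def using assms by (intro holomorphic_intros)

lemma poly_charpoly: "poly (charpoly X) z = det (cscale z (mat 1) - X)"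
proof -
  have "poly (charpoly X) z = (\<Sum>p | p permutes UNIV. of_int (sign p)
      * (\<Prod>i\<in>UNIV. poly ((if i = p i then [:0, 1:] else 0) - [: X $ i $ p i :]) z))"
    by (simp add: charpoly_def det_def poly_sum poly_prod)
  also have "\<dots> = det (cscale z (mat 1) - X)"
    unfolding det_def
    by (intro sum.cong arg_cong2[where f = "(*)"] prod.cong refl) (auto simp: mat_def)
  finally show ?thesis .
qed

lemma charpoly_eigenvector:
  assumes "A *v v = z *s v" "v \<noteq> 0"
  shows "poly (charpoly A) z = 0"
proof (rule ccontr)
  assume "poly (charpoly A) z \<noteq> 0"
  then have "invertible (cscale z (mat 1) - A)"
    by (simp add: poly_charpoly invertible_det_nz)
  moreover have "(cscale z (mat 1) - A) *v v = 0"
    using assms by (simp add: matrix_vector_mult_diff_rdistrib)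
  ultimately show False using \<open>v \<noteq> 0\<close>
    by (metis invertible_def matrix_left_invertible_ker)
qed

text \<open>Let T(w) = w - A, let C(w) be its adjugate and p the characteristic polynomial.
  Differentiating T(w) C(w) = p(w) at the simple root z gives C(z) + T(z) C'(z) = p'(z). Division by
  p'(z) yields P and R.\<close>

lemma right_spectral_projection:
  assumes root: "poly (charpoly A) z = 0" and simple: "poly (pderiv (charpoly A)) z \<noteq> 0"
  obtains P R where "P + (cscale z (mat 1) - A) ** R = mat 1" "(cscale z (mat 1) - A) ** P = 0"
proof -
  define T where "T w = cscale w (mat 1) - A" for w
  define C where "C w = adjm (T w)" for w
  have T_nth: "T w $ i $ j = (if i = j then w else 0) - A $ i $ j" for w i j
    by (simp add: T_def mat_def)
  have TC: "T w ** C w = cscale (poly (charpoly A) w) (mat 1)" for w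
    by (simp add: C_def matrix_mult_adjm poly_charpoly T_def)
  have "(\<lambda>w. C w $ i $ j) holomorphic_on UNIV" for i j
    unfolding C_def adjm_def vec_lambda_beta
  proof (rule holomorphic_on_det)
    fix k l
    show "(\<lambda>z. (\<chi> k. if k = j then axis i 1 else T z $ k) $ k $ l) holomorphic_on UNIV"
      by (cases "k = j"; cases "k = l") (auto simp: T_nth intro!: holomorphic_intros)
  qed
  then have dC: "((\<lambda>w. C w $ i $ j) has_field_derivative deriv (\<lambda>w. C w $ i $ j) w) (at w)" for i j w
    by (meson holomorphic_derivI open_UNIV UNIV_I)
  define D where "D = (\<chi> i j. deriv (\<lambda>w. C w $ i $ j) z)"
  have "(C z + T z ** D) $ i $ j = poly (pderiv (charpoly A)) z * mat 1 $ i $ j" for i j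
  proof -
    have d1: "((\<lambda>w. \<Sum>k\<in>UNIV. ((if i = k then w else 0) - A $ i $ k) * C w $ k $ j) has_field_derivative
       (\<Sum>k\<in>UNIV. (if i = k then 1 else 0) * C z $ k $ j + T z $ i $ k * D $ k $ j)) (at z)"
      unfolding D_def T_nth vec_lambda_beta
      by (rule DERIV_sum) (auto intro!: derivative_eq_intros dC)
    have eq: "(\<lambda>w. \<Sum>k\<in>UNIV. ((if i = k then w else 0) - A $ i $ k) * C w $ k $ j)
        = (\<lambda>w. poly (charpoly A) w * mat 1 $ i $ j)"
    proof
      fix w
      show "(\<Sum>k\<in>UNIV. ((if i = k then w else 0) - A $ i $ k) * C w $ k $ j)
          = poly (charpoly A) w * mat 1 $ i $ j"
        using TC[of w, THEN arg_cong, of "\<lambda>X. X $ i $ j"]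
        by (simp add: matrix_matrix_mult_def T_nth)
    qed
    have d2: "((\<lambda>w. poly (charpoly A) w * mat 1 $ i $ j) has_field_derivative
        poly (pderiv (charpoly A)) z * mat 1 $ i $ j) (at z)"
      by (intro DERIV_cmult_right poly_DERIV)
    have "(\<Sum>k\<in>UNIV. (if i = k then 1 else 0) * C z $ k $ j + T z $ i $ k * D $ k $ j)
        = poly (pderiv (charpoly A)) z * mat 1 $ i $ j"
      by (rule DERIV_unique[OF d1[unfolded eq] d2])
    moreover have "(\<Sum>k\<in>UNIV. (if i = k then 1 else 0) * C z $ k $ j)
        = (\<Sum>k\<in>UNIV. if i = k then C z $ k $ j else 0)"
      by (rule sum.cong) auto
    moreover have "\<dots> = C z $ i $ j" by simp
    ultimately show ?thesis
      unfolding sum.distrib by (simp add: matrix_matrix_mult_def)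
  qed
  then have CD: "C z + T z ** D = cscale (poly (pderiv (charpoly A)) z) (mat 1)"
    by (simp add: vec_eq_iff)
  let ?d = "inverse (poly (pderiv (charpoly A)) z)"
  have "cscale ?d (C z) + T z ** cscale ?d D = mat 1"
    using CD[THEN arg_cong, of "cscale ?d"] simple by (simp add: cscale_add_right)
  moreover have "T z ** cscale ?d (C z) = 0" using TC[of z] root by simp
  ultimately show ?thesis using that unfolding T_def by blast
qed

lemma charpoly_transpose: "charpoly (transpose A) = charpoly A"
proof -
  have "transpose (cscale z (mat 1) - A) = cscale z (mat 1) - transpose A" for z
    by (simp add: transpose_def vec_eq_iff mat_def)
  then have "poly (charpoly (transpose A)) z = poly (charpoly A) z" for z
    unfolding poly_charpoly using det_transpose by metis
  then show ?thesis by (simp add: poly_eq_poly_eq_iff[symmetric] fun_eq_iff)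
qed

text \<open>The transposed matrix supplies a second projection P1, with the factors on the other
  side. Inserting each decomposition of the identity shows that P and the transpose of P1 both equal
  their product, so a single P is annihilated from both sides.\<close>

lemma spectral_projection:
  assumes root: "poly (charpoly A) z = 0" and simple: "poly (pderiv (charpoly A)) z \<noteq> 0"
  obtains P R where "P + R ** (A - cscale z (mat 1)) = mat 1"
    "(A - cscale z (mat 1)) ** P = 0" "P ** (A - cscale z (mat 1)) = 0"
proof -
  let ?T = "cscale z (mat 1) - A"
  obtain P R where P: "P + ?T ** R = mat 1" "?T ** P = 0"
    using right_spectral_projection[OF root simple] .
  obtain P1 R1 where P1: "P1 + (cscale z (mat 1) - transpose A) ** R1 = mat 1"
      "(cscale z (mat 1) - transpose A) ** P1 = 0"
    using right_spectral_projection[of "transpose A" z] root simple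
    by (auto simp: charpoly_transpose)
  have T: "transpose (cscale z (mat 1) - transpose A) = ?T"
    by (simp add: transpose_def vec_eq_iff mat_def)
  have tr: "transpose (X + Y) = transpose X + transpose Y" for X Y :: "complex^'n^'n"
    by (simp add: transpose_def vec_eq_iff)
  have P1': "transpose P1 + transpose R1 ** ?T = mat 1" "transpose P1 ** ?T = 0"
    using P1[THEN arg_cong, of transpose]
    by (simp_all add: tr matrix_transpose_mul T transpose_mat)
      (simp add: transpose_def zero_vec_def)
  have "P = (transpose P1 + transpose R1 ** ?T) ** P" using P1' by simp
  also have "\<dots> = transpose P1 ** P"
    using P(2) by (simp add: matrix_distribs(2) matrix_mul_assoc[symmetric])
  also have "\<dots> = transpose P1 ** (P + ?T ** R)"
    using P1'(2) by (simp add: matrix_add_ldistrib matrix_mul_assoc)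
  finally have "P = transpose P1" using P(1) by simp
  then have *: "P ** ?T = 0" "P + (- transpose R1) ** (- ?T) = mat 1" "?T ** P = 0"
    using P1' P(2) by (simp_all only: matrix_minus_left matrix_minus_right minus_minus)
  have T': "A - cscale z (mat 1) = - ?T" by simp
  show ?thesis using * that[of P "- transpose R1"]
    unfolding T' by (simp only: matrix_minus_left matrix_minus_right minus_minus neg_equal_0_iff_equal)
qed

section \<open>Products of linear factors N - r, applied to a vector\<close>

primrec lin_prod :: "complex^'v^'v \<Rightarrow> complex list \<Rightarrow> complex^'v \<Rightarrow> complex^'v" where
  "lin_prod N [] v = v"
| "lin_prod N (r # rs) v = lin_prod N rs (N *v v - r *s v)"

lemma lin_prod_add: "lin_prod N rs (u + v) = lin_prod N rs u + lin_prod N rs v"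
proof (induction rs arbitrary: u v)
  case (Cons r rs)
  have "N *v (u + v) - r *s (u + v) = (N *v u - r *s u) + (N *v v - r *s v)"
    by (simp add: matrix_vector_right_distrib vector_add_ldistrib)
  then show ?case by (simp only: lin_prod.simps Cons.IH)
qed simp

lemma lin_prod_smult: "lin_prod N rs (c *s v) = c *s lin_prod N rs v"
proof (induction rs arbitrary: v)
  case (Cons r rs)
  have "N *v (c *s v) - r *s (c *s v) = c *s (N *v v - r *s v)"
    by (simp add: vec_eq_iff algebra_simps)
  then show ?case by (simp only: lin_prod.simps Cons.IH)
qed simp

lemma lin_prod_zero [simp]: "lin_prod N rs 0 = 0"
  using lin_prod_smult[of N rs 0 0] by simp

lemma lin_prod_diff: "lin_prod N rs (u - v) = lin_prod N rs u - lin_prod N rs v"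
  using lin_prod_add[of N rs u "(-1) *s v"] lin_prod_smult[of N rs "-1" v]
  by (simp add: vector_sneg_minus1[symmetric])

lemma lin_prod_sum: "lin_prod N rs (\<Sum>i\<in>I. v i) = (\<Sum>i\<in>I. lin_prod N rs (v i))"
  by (induction I rule: infinite_finite_induct) (simp_all add: lin_prod_add)

lemma lin_prod_mult: "lin_prod N rs (N *v v) = N *v lin_prod N rs v"
proof (induction rs arbitrary: v)
  case (Cons r rs)
  have "N *v (N *v v) - r *s (N *v v) = N *v (N *v v - r *s v)"
    by (simp add: matrix_vector_mult_diff_distrib)
  then show ?case by (simp only: lin_prod.simps Cons.IH)
qed simp

lemma lin_prod_append: "lin_prod N (rs @ ss) v = lin_prod N ss (lin_prod N rs v)"
  by (induction rs arbitrary: v) simp_all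

text \<open>All factors are polynomials in the same N. As order is immaterial, concatenating two
  lists annihilates whatever either of them annihilates.\<close>

lemma lin_prod_commute: "lin_prod N rs (lin_prod N ss v) = lin_prod N ss (lin_prod N rs v)"
proof (induction ss arbitrary: v)
  case (Cons s ss)
  then show ?case by (simp add: lin_prod_diff lin_prod_mult lin_prod_smult)
qed simp

definition poly_apply :: "complex^'v^'v \<Rightarrow> complex poly \<Rightarrow> complex^'v \<Rightarrow> complex^'v" where
  "poly_apply N p v = (\<Sum>i\<le>degree p. coeff p i *s (mpow N i *v v))"

lemma poly_apply_altdef:
  assumes "degree p \<le> m"
  shows "poly_apply N p v = (\<Sum>i\<le>m. coeff p i *s (mpow N i *v v))"
  unfolding poly_apply_def
  using assms by (intro sum.mono_neutral_left) (auto simp: coeff_eq_0)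

lemma mpow_Suc_right: "mpow N (Suc i) = mpow N i ** N"
  by (induction i) (simp_all add: matrix_mul_assoc)

lemma poly_apply_linear_factor:
  "poly_apply N ([:- r, 1:] * q) v = poly_apply N q (N *v v - r *s v)"
proof -
  let ?m = "degree q"
  have d: "degree ([:- r, 1:] * q) \<le> Suc ?m"
    using degree_mult_le[of "[:- r, 1:]" q] by simp
  have c: "coeff ([:- r, 1:] * q) i = (case i of 0 \<Rightarrow> 0 | Suc k \<Rightarrow> coeff q k) - r * coeff q i" for i
    by (simp add: coeff_pCons split: nat.split)
  have "poly_apply N ([:- r, 1:] * q) v
      = (\<Sum>i\<le>Suc ?m. (case i of 0 \<Rightarrow> 0 | Suc k \<Rightarrow> coeff q k) *s (mpow N i *v v))
        - r *s (\<Sum>i\<le>Suc ?m. coeff q i *s (mpow N i *v v))"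
    unfolding poly_apply_altdef[OF d] c
    by (simp add: vector_sub_rdistrib sum_subtractf vec.scale_sum_right vector_smult_assoc)
  also have "(\<Sum>i\<le>Suc ?m. coeff q i *s (mpow N i *v v)) = poly_apply N q v"
    by (rule poly_apply_altdef[symmetric]) simp
  also have "(\<Sum>i\<le>Suc ?m. (case i of 0 \<Rightarrow> 0 | Suc k \<Rightarrow> coeff q k) *s (mpow N i *v v))
      = poly_apply N q (N *v v)"
    unfolding sum.atMost_Suc_shift poly_apply_def
    by (simp add: mpow_Suc_right matrix_vector_mul_assoc del: mpow.simps)
  finally show ?thesis
    by (simp add: poly_apply_def matrix_vector_mult_diff_distrib vector_ssub_ldistrib
        sum_subtractf vec.scale_sum_right vector_smult_assoc mult.commute)
qed

text \<open>A nonconstant polynomial has a complex root r; the factor N - r is absorbed into the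
  vector and the degree drops.\<close>

lemma lin_prod_annihilates_of_poly:
  assumes "p \<noteq> 0" "poly_apply N p v = 0"
  shows "\<exists>rs. lin_prod N rs v = 0"
  using assms
proof (induction "degree p" arbitrary: p v rule: less_induct)
  case less
  show ?case
  proof (cases "degree p = 0")
    case True
    then have "coeff p 0 *s v = 0" "coeff p 0 \<noteq> 0"
      using less.prems leading_coeff_0_iff[of p] by (auto simp: poly_apply_def)
    then have "lin_prod N [] v = 0" by (simp add: vec_eq_iff)
    then show ?thesis by blast
  next
    case False
    then have "\<exists>i\<in>{1..degree p}. coeff p i \<noteq> 0"
      by (intro bexI[of _ "degree p"]) auto
    then obtain r where "poly p r = 0"
      using fundamental_theorem_of_algebra[of "coeff p" "degree p"] by (auto simp: poly_altdef)
    then obtain q where q: "p = [:- r, 1:] * q" by (auto simp: poly_eq_0_iff_dvd)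
    have "q \<noteq> 0" using q less.prems by auto
    moreover from this have "degree q < degree p" unfolding q by (subst degree_mult_eq) auto
    moreover have "poly_apply N q (N *v v - r *s v) = 0"
      using less.prems poly_apply_linear_factor q by metis
    ultimately obtain rs where "lin_prod N rs (N *v v - r *s v) = 0"
      using less.hyps by blast
    then have "lin_prod N (r # rs) v = 0" by simp
    then show ?thesis by blast
  qed
qed

lemma linear_dependence_sequence:
  fixes f :: "nat \<Rightarrow> complex^'v"
  shows "\<exists>m c. (\<exists>k\<le>m. c k \<noteq> 0) \<and> (\<Sum>k\<le>m. c k *s f k) = 0"
proof -
  let ?m = "vec.dim (UNIV :: (complex^'v) set)"
  show ?thesis
  proof (cases "inj_on f {..?m}")
    case True
    have "vec.dependent (f ` {..?m})"
    proof (rule ccontr)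
      assume "vec.independent (f ` {..?m})"
      then have "card (f ` {..?m}) \<le> ?m" by (intro vec.independent_card_le_dim) auto
      then show False using True by (simp add: card_image)
    qed
    then obtain u where "\<exists>v\<in>f ` {..?m}. u v \<noteq> 0" "(\<Sum>v\<in>f ` {..?m}. u v *s v) = 0"
      by (auto simp: vec.dependent_finite)
    then have "\<exists>k\<le>?m. (u \<circ> f) k \<noteq> 0" "(\<Sum>k\<le>?m. (u \<circ> f) k *s f k) = 0"
      using True by (auto simp: sum.reindex)
    then show ?thesis by blast
  next
    case False
    \<comment> \<open>A repeated value is treated separately, since the set of values would then be
      too small to be dependent by counting. The relation is the difference of the two equal
      terms.\<close>
    then obtain i j where ij: "i \<le> ?m" "j \<le> ?m" "i \<noteq> j" "f i = f j" by (auto simp: inj_on_def)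
    let ?c = "\<lambda>k. if k = i then 1 else if k = j then - 1 else (0::complex)"
    have "(\<Sum>k\<le>?m. ?c k *s f k) = (\<Sum>k\<in>{i, j}. ?c k *s f k)"
      using ij by (intro sum.mono_neutral_right) auto
    also have "\<dots> = 0" using ij by simp
    finally show ?thesis using ij by (intro exI[of _ ?m] exI[of _ ?c]) auto
  qed
qed

text \<open>The iterates N^k v are linearly dependent, so a nonzero polynomial in N kills this one
  vector, and it splits into linear factors.\<close>

lemma lin_prod_annihilates: "\<exists>rs. lin_prod N rs v = 0"
proof -
  obtain m c where c: "\<exists>k\<le>m. c k \<noteq> 0" "(\<Sum>k\<le>m. c k *s (mpow N k *v v)) = 0"
    using linear_dependence_sequence[of "\<lambda>k. mpow N k *v v"] by blast
  define p where "p = (\<Sum>k\<le>m. monom (c k) k)"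
  have co: "coeff p i = (if i \<le> m then c i else 0)" for i
    by (simp add: p_def coeff_sum)
  then have "p \<noteq> 0" using c(1) by (metis coeff_0)
  moreover have "degree p \<le> m" by (rule degree_le) (simp add: co)
  then have "poly_apply N p v = 0" using c(2) by (simp add: poly_apply_altdef co)
  ultimately show ?thesis by (rule lin_prod_annihilates_of_poly)
qed

text \<open>The kernel of P is invariant under N, and there N - r is injective for every r outside
  \<open>good\<close>; such factors can be cancelled. Later \<open>good\<close> is the open left
  half plane, so that only decaying modes are left.\<close>

lemma lin_prod_drop_injective_factors:
  assumes inj: "\<And>r v. r \<notin> good \<Longrightarrow> P *v v = 0 \<Longrightarrow> N *v v = r *s v \<Longrightarrow> v = 0"
    and PN: "P ** N = N ** P"
  shows "P *v v = 0 \<Longrightarrow> lin_prod N rs v = 0 \<Longrightarrow> \<exists>ss. set ss \<subseteq> good \<and> lin_prod N ss v = 0"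
proof (induction rs arbitrary: v)
  case Nil
  then show ?case by (intro exI[of _ "[]"]) simp
next
  case (Cons r rs)
  have inv: "P *v (N *v u - r *s u) = 0" if "P *v u = 0" for u r
    using that by (simp add: matrix_vector_mult_diff_distrib matrix_vector_mul_assoc PN)
      (simp add: matrix_vector_mul_assoc[symmetric])
  have inv_list: "P *v lin_prod N ss u = 0" if "P *v u = 0" for ss u
    using that by (induction ss arbitrary: u) (simp_all add: inv)
  obtain ss where ss: "set ss \<subseteq> good" "lin_prod N ss (N *v v - r *s v) = 0"
    using Cons.IH[OF inv[OF Cons.prems(1), of r]] Cons.prems(2) by auto
  show ?case
  proof (cases "r \<in> good")
    case True
    then show ?thesis using ss by (intro exI[of _ "r # ss"]) simp
  next
    case False
    have "N *v lin_prod N ss v = r *s lin_prod N ss v"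
      using ss(2) by (simp add: lin_prod_diff lin_prod_mult lin_prod_smult)
    then have "lin_prod N ss v = 0" using inj[OF False inv_list[OF Cons.prems(1)]] by blast
    then show ?thesis using ss(1) by blast
  qed
qed

lemma lin_prod_annihilates_uniform:
  fixes v :: "'i \<Rightarrow> complex^'v"
  assumes "finite I" "\<And>i. i \<in> I \<Longrightarrow> \<exists>rs. set rs \<subseteq> good \<and> lin_prod N rs (v i) = 0"
  shows "\<exists>rs. set rs \<subseteq> good \<and> (\<forall>i\<in>I. lin_prod N rs (v i) = 0)"
  using assms
proof (induction I)
  case (insert i I)
  then obtain rs ss where "set rs \<subseteq> good" "\<forall>i\<in>I. lin_prod N rs (v i) = 0"
      "set ss \<subseteq> good" "lin_prod N ss (v i) = 0" by (metis insertCI)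
  then show ?case
    by (intro exI[of _ "rs @ ss"]) (auto simp: lin_prod_append lin_prod_commute[of N ss rs "v i"])
qed (auto intro: exI[of _ "[]"])

section \<open>Quadratic forms that decrease along the linear flow\<close>

lemma norm_smult_vec [simp]: "norm (c *s v) = cmod c * norm v" for v :: "complex^'v"
  by (simp add: norm_vec_def norm_mult L2_set_right_distrib)

lemma inner_smult_vec: "inner v (c *s v) = Re c * (norm v)\<^sup>2" for v :: "complex^'v"
proof -
  have "inner z (c * z) = Re c * inner z z" for z by (simp add: inner_complex_def algebra_simps)
  then show ?thesis
    by (simp add: inner_vec_def power2_norm_eq_inner sum_distrib_left)
qed

lemma bounded_linear_matrix_vector: "bounded_linear (\<lambda>u. N *v u)" for N :: "complex^'v^'v"
  by (rule linear_conv_bounded_linear[THEN iffD1], rule linearI)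
    (auto simp: vec_eq_iff matrix_vector_mult_def algebra_simps sum.distrib scaleR_sum_right)

lemma bounded_bilinear_form_add:
  fixes b :: "'a::real_normed_vector \<Rightarrow> 'a \<Rightarrow> real" and L' :: "'b::real_normed_vector \<Rightarrow> 'c::real_inner"
  assumes L': "bounded_linear L'" and b: "bounded_bilinear b" and L: "bounded_linear L"
  shows "bounded_bilinear (\<lambda>u v. inner (L' u) (L' v) + K * b (L u) (L v))"
proof -
  interpret p: bounded_bilinear "\<lambda>u v. inner (L' u) (L' v)"
    by (rule bounded_bilinear.comp[OF bounded_bilinear_inner L' L'])
  interpret q: bounded_bilinear "\<lambda>u v. b (L u) (L v)"
    by (rule bounded_bilinear.comp[OF b L L])
  obtain B1 where B1: "\<And>u v. norm (inner (L' u) (L' v)) \<le> norm u * norm v * B1" using p.bounded by blast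
  obtain B2 where B2: "\<And>u v. norm (b (L u) (L v)) \<le> norm u * norm v * B2" using q.bounded by blast
  show ?thesis
  proof
    have "norm (inner (L' u) (L' v) + K * b (L u) (L v)) \<le> norm u * norm v * (B1 + \<bar>K\<bar> * B2)" for u v
    proof -
      have "norm (inner (L' u) (L' v) + K * b (L u) (L v))
          \<le> norm (inner (L' u) (L' v)) + \<bar>K\<bar> * norm (b (L u) (L v))"
        using norm_triangle_ineq[of "inner (L' u) (L' v)" "K * b (L u) (L v)"] by (simp add: abs_mult)
      also have "\<dots> \<le> norm u * norm v * B1 + \<bar>K\<bar> * (norm u * norm v * B2)"
        by (intro add_mono mult_left_mono B1 B2) simp
      finally show ?thesis by (simp add: algebra_simps)
    qed
    then show "\<exists>B. \<forall>u v. norm (inner (L' u) (L' v) + K * b (L u) (L v)) \<le> norm u * norm v * B"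
      by blast
  qed (simp_all add: p.add_left p.add_right q.add_left q.add_right p.scaleR_left p.scaleR_right
      q.scaleR_left q.scaleR_right algebra_simps)
qed

text \<open>On the subspace annihilated by the product, \<open>N\<close> is lower triangular in the
  coordinates \<open>u, (N - r\<^sub>1)u, (N - r\<^sub>2)(N - r\<^sub>1)u, \<dots>\<close>; weighting the later
  coordinates heavily makes the off-diagonal part harmless.\<close>
lemma lyapunov_form_lin_prod:
  fixes N :: "complex^'v^'v"
  assumes "\<forall>r\<in>set rs. Re r < 0"
  shows "\<exists>b c \<eta> \<gamma>. bounded_bilinear b \<and> (\<forall>u v. b u v = b v u) \<and> (\<forall>u. 0 \<le> b u u) \<and>
    (0::real) < c \<and> (0::real) < \<eta> \<and> \<eta> \<le> 1 \<and> (0::real) < \<gamma> \<and>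
    (\<forall>u. lin_prod N rs u = 0 \<longrightarrow> c * (norm u)\<^sup>2 \<le> b u u \<and>
       (\<forall>z. \<bar>Im z\<bar> \<le> \<eta> * Re z \<longrightarrow> b u (z *s (N *v u)) \<le> - \<gamma> * Re z * b u u))"
  using assms
proof (induction rs)
  case Nil
  \<comment> \<open>The empty product is the identity, so the subspace is 0 and the zero form meets
    all bounds.\<close>
  have "bounded_bilinear (\<lambda>(_::complex^'v) (_::complex^'v). 0::real)"
    by unfold_locales (auto intro: exI[of _ 0])
  then show ?case
    by (intro exI[of _ "\<lambda>_ _. 0"] exI[of _ 1]) simp
next
  case (Cons r rs)
  then obtain b c \<eta> \<gamma> where b: "bounded_bilinear b" and sym: "\<And>u v. b u v = b v u"
    and nn: "\<And>u. 0 \<le> b u u" and pos: "0 < c" "0 < \<eta>" "\<eta> \<le> 1" "0 < \<gamma>"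
    and lb: "\<And>u. lin_prod N rs u = 0 \<Longrightarrow> c * (norm u)\<^sup>2 \<le> b u u"
    and dec: "\<And>u z. lin_prod N rs u = 0 \<Longrightarrow> \<bar>Im z\<bar> \<le> \<eta> * Re z
        \<Longrightarrow> b u (z *s (N *v u)) \<le> - \<gamma> * Re z * b u u"
    by auto
  \<comment> \<open>Half of the decay rate -Re r. The other half pays for the tilt of z in Re (z r)
    <= - a Re z, whence the bound a / (|Im r| + 1) on the slope \<eta>'.\<close>
  define a where "a = - Re r / 2"
  have a: "a > 0" using Cons.prems by (simp add: a_def)
  define L where "L u = N *v u - r *s u" for u
  have L: "bounded_linear L"
    using bounded_linear_matrix_vector[of "N - cscale r (mat 1)"]
    by (simp add: L_def[abs_def] matrix_vector_mult_diff_rdistrib)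
  \<comment> \<open>K satisfies 2/a |L u|^2 = K \<gamma>/2 c |L u|^2, so half of the decay of the
    weighted form covers the cross term; \<gamma>' keeps the other halves.\<close>
  define K where "K = 4 / (a * \<gamma> * c)"
  have K: "K > 0" using a pos by (simp add: K_def)
  define b' where "b' u v = inner u v + K * b (L u) (L v)" for u v
  define \<eta>' where "\<eta>' = min \<eta> (a / (\<bar>Im r\<bar> + 1))"
  define \<gamma>' where "\<gamma>' = min (a / 2) (\<gamma> / 2)"
  have "bounded_bilinear b'"
    unfolding b'_def by (rule bounded_bilinear_form_add[OF bounded_linear_ident b L])
  moreover have "b' u v = b' v u" for u v by (simp add: b'_def inner_commute sym)
  moreover have "0 \<le> b' u u" for u using nn K by (simp add: b'_def)
  moreover have "0 < \<eta>'" "\<eta>' \<le> 1" "0 < \<gamma>'" using pos a by (auto simp: \<eta>'_def \<gamma>'_def)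
  moreover have "1 * (norm u)\<^sup>2 \<le> b' u u" for u
    using nn K by (simp add: b'_def power2_norm_eq_inner)
  moreover have "b' u (z *s (N *v u)) \<le> - \<gamma>' * Re z * b' u u"
    if u: "lin_prod N (r # rs) u = 0" and z: "\<bar>Im z\<bar> \<le> \<eta>' * Re z" for u z
  proof -
    have u1: "lin_prod N rs (L u) = 0" using u by (simp add: L_def)
    have z0: "0 \<le> Re z" using z \<open>0 < \<eta>'\<close> abs_ge_zero[of "Im z"]
      by (metis mult_pos_neg not_le order.strict_trans1)
    have z1: "\<bar>Im z\<bar> \<le> \<eta> * Re z"
      using z z0 mult_right_mono[of \<eta>' \<eta> "Re z"] by (auto simp: \<eta>'_def)
    have "\<bar>Im z\<bar> \<le> 1 * Re z"
      using z z0 \<open>\<eta>' \<le> 1\<close> mult_right_mono[of \<eta>' 1 "Re z"] by linarith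
    then have nz: "cmod z \<le> 2 * Re z" using z0 cmod_le[of z] by linarith
    have "\<eta>' \<le> a / (\<bar>Im r\<bar> + 1)" by (simp add: \<eta>'_def)
    then have "\<eta>' * (\<bar>Im r\<bar> + 1) \<le> a" by (simp add: pos_le_divide_eq)
    then have "\<eta>' * \<bar>Im r\<bar> \<le> a" using \<open>0 < \<eta>'\<close> by (simp add: algebra_simps)
    have "- Im z * Im r \<le> \<bar>Im z\<bar> * \<bar>Im r\<bar>"
      by (metis abs_ge_self abs_minus_cancel abs_mult mult_minus_left)
    also have "\<dots> \<le> (\<eta>' * Re z) * \<bar>Im r\<bar>" by (rule mult_right_mono[OF z]) simp
    also have "\<dots> \<le> a * Re z"
      using mult_right_mono[OF \<open>\<eta>' * \<bar>Im r\<bar> \<le> a\<close> z0] by (simp add: mult_ac)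
    finally have Rzr: "Re (z * r) \<le> - a * Re z" by (simp add: a_def algebra_simps)
    have comm: "L (z *s (N *v u)) = z *s (N *v L u)"
      by (simp add: L_def matrix_vector_mult_diff_distrib vec_eq_iff algebra_simps)
    have NL: "z *s (N *v u) = (z * r) *s u + z *s L u"
      by (simp add: L_def vec_eq_iff algebra_simps)
    \<comment> \<open>The cross term: Cauchy-Schwarz, then |u| |L u| <= a/4 |u|^2 + 1/a |L
      u|^2.\<close>
    have "inner u (z *s L u) \<le> norm u * norm (z *s L u)" by (rule norm_cauchy_schwarz)
    also have "\<dots> \<le> 2 * Re z * (norm u * norm (L u))"
      using nz mult_right_mono[OF nz, of "norm u * norm (L u)"] by (simp add: mult_ac)
    also have "\<dots> \<le> 2 * Re z * (a / 4 * (norm u)\<^sup>2 + 1 / a * (norm (L u))\<^sup>2)"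
    proof -
      have "0 \<le> (sqrt a / 2 * norm u - 1 / sqrt a * norm (L u))\<^sup>2" by simp
      also have "\<dots> = a / 4 * (norm u)\<^sup>2 + 1 / a * (norm (L u))\<^sup>2 - norm u * norm (L u)"
        using a by (simp add: power2_diff power_mult_distrib power_divide field_simps)
      finally show ?thesis using z0 by (intro mult_left_mono) auto
    qed
    also have "\<dots> \<le> Re z * (a / 2 * (norm u)\<^sup>2) + Re z * (K * \<gamma> / 2 * b (L u) (L u))"
    proof -
      have "2 / a * (norm (L u))\<^sup>2 = K * \<gamma> / 2 * (c * (norm (L u))\<^sup>2)"
        using a pos by (simp add: K_def field_simps)
      also have "\<dots> \<le> K * \<gamma> / 2 * b (L u) (L u)"
        using lb[OF u1] K pos by (intro mult_left_mono) auto
      finally have "Re z * (2 / a * (norm (L u))\<^sup>2) \<le> Re z * (K * \<gamma> / 2 * b (L u) (L u))"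
        using z0 by (rule mult_left_mono)
      then show ?thesis by (simp add: algebra_simps)
    qed
    finally have 1: "inner u (z *s L u)
      \<le> Re z * (a / 2 * (norm u)\<^sup>2) + Re z * (K * \<gamma> / 2 * b (L u) (L u))" .
    have 2: "inner u ((z * r) *s u) \<le> - a * Re z * (norm u)\<^sup>2"
      unfolding inner_smult_vec using Rzr by (rule mult_right_mono) simp
    have 3: "K * b (L u) (z *s (N *v L u)) \<le> K * (- \<gamma> * Re z * b (L u) (L u))"
      using dec[OF u1 z1] K by (intro mult_left_mono) auto
    have "b' u (z *s (N *v u)) = inner u ((z * r) *s u) + inner u (z *s L u)
        + K * b (L u) (z *s (N *v L u))"
      unfolding b'_def comm unfolding NL by (simp add: inner_add_right)
    also have "\<dots> \<le> - (a / 2) * (Re z * (norm u)\<^sup>2) - \<gamma> / 2 * (Re z * (K * b (L u) (L u)))"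
      using 1 2 3 by (simp add: algebra_simps)
    also have "\<dots> \<le> - \<gamma>' * (Re z * (norm u)\<^sup>2) - \<gamma>' * (Re z * (K * b (L u) (L u)))"
    proof -
      have "\<gamma>' * (Re z * (norm u)\<^sup>2) \<le> a / 2 * (Re z * (norm u)\<^sup>2)"
        using z0 by (intro mult_right_mono) (auto simp: \<gamma>'_def)
      moreover have "\<gamma>' * (Re z * (K * b (L u) (L u))) \<le> \<gamma> / 2 * (Re z * (K * b (L u) (L u)))"
        using z0 K nn by (intro mult_right_mono mult_nonneg_nonneg) (auto simp: \<gamma>'_def)
      ultimately show ?thesis by simp
    qed
    also have "\<dots> = - \<gamma>' * Re z * b' u u"
      by (simp add: b'_def power2_norm_eq_inner algebra_simps)
    finally show ?thesis .
  qed
  ultimately show ?case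
    by (intro exI[of _ b'] exI[of _ 1] exI[of _ \<eta>'] exI[of _ \<gamma>']) auto
qed

text \<open>N kills the range of P, so there the plain inner product is constant along the flow. On
  the range of Q = 1 - P the eigenvalues of N have negative real part, and the form for products of
  linear factors applies. The sum of both is positive definite because P + Q = 1.\<close>

lemma lyapunov_form_max_eig:
  fixes A :: "complex^'v^'v"
  assumes "is_max_eig A lam"
  shows "\<exists>b c \<eta>. bounded_bilinear b \<and> (\<forall>u v. b u v = b v u) \<and> (0::real) < c \<and> (0::real) < \<eta> \<and>
    (\<forall>u. c * (norm u)\<^sup>2 \<le> b u u) \<and>
    (\<forall>u z. \<bar>Im z\<bar> \<le> \<eta> * Re z \<longrightarrow> b u (z *s ((A - cscale lam (mat 1)) *v u)) \<le> 0)"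
proof -
  let ?p = "charpoly A"
  define N where "N = A - cscale lam (mat 1)"
  have root: "poly ?p lam = 0" and ord: "order lam ?p = 1"
    and others: "\<And>\<mu>. poly ?p \<mu> = 0 \<Longrightarrow> \<mu> \<noteq> lam \<Longrightarrow> Re \<mu> < Re lam"
    using assms by (auto simp: is_max_eig_def)
  \<comment> \<open>The zero polynomial would also have the root lam + 1, which lies to the right of
    lam.\<close>
  have "?p \<noteq> 0" using others[of "lam + 1"] by auto
  then have "order lam (pderiv ?p) = 0" using order_pderiv[OF _ root] ord by simp
  moreover have "pderiv ?p \<noteq> 0"
    using \<open>?p \<noteq> 0\<close> root by (metis pderiv_iszero poly_pCons poly_0 add.right_neutral mult_zero_right pCons_0_0)
  ultimately have "poly (pderiv ?p) lam \<noteq> 0" by (simp add: order_root)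
  then obtain P R where P: "P + R ** N = mat 1" "N ** P = 0" "P ** N = 0"
    using spectral_projection[OF root] unfolding N_def by blast
  define Q where "Q = mat 1 - P"
  have PP: "P ** P = P"
  proof -
    have "P = (P + R ** N) ** P" using P by simp
    also have "\<dots> = P ** P" using P(2) by (simp add: matrix_distribs(2) matrix_mul_assoc[symmetric])
    finally show ?thesis by simp
  qed
  have PQ: "P *v (Q *v u) = 0" for u
    by (simp add: Q_def matrix_vector_mul_assoc matrix_distribs PP)
  have NQ: "N ** Q = N" "Q ** N = N" using P by (simp_all add: Q_def matrix_distribs)
  \<comment> \<open>For r = 0 the decomposition P + R N = 1 gives v = 0. For any other r a nonzero v
    would be an eigenvector of A for lam + r, whose real part is not below that of lam.\<close>
  have inj: "v = 0" if "r \<notin> {r. Re r < 0}" "P *v v = 0" "N *v v = r *s v" for r v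
  proof (cases "r = 0")
    case True
    have "v = (P + R ** N) *v v" using P(1) by simp
    also have "\<dots> = 0" using that True
      by (simp add: matrix_vector_mult_add_rdistrib matrix_vector_mul_assoc[symmetric])
    finally show ?thesis .
  next
    case False
    show ?thesis
    proof (rule ccontr)
      assume "v \<noteq> 0"
      have "A *v v = (lam + r) *s v"
        using that(3) by (simp add: N_def matrix_vector_mult_diff_rdistrib vec.scale_left_distrib diff_eq_eq add.commute)
      then have "poly ?p (lam + r) = 0" using charpoly_eigenvector \<open>v \<noteq> 0\<close> by blast
      from others[OF this] show False using False that(1) by simp
    qed
  qed
  have "\<exists>rs. set rs \<subseteq> {r. Re r < 0} \<and> lin_prod N rs (Q *v axis i 1) = 0" for i
  proof -
    obtain rs where rs: "lin_prod N rs (Q *v axis i 1) = 0" using lin_prod_annihilates by blast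
    show ?thesis
      by (rule lin_prod_drop_injective_factors[OF inj _ PQ rs]) (use P in auto)
  qed
  then obtain rs where rs: "set rs \<subseteq> {r. Re r < 0}" "\<And>i. lin_prod N rs (Q *v axis i 1) = 0"
    using lin_prod_annihilates_uniform[of UNIV "{r. Re r < 0}" N "\<lambda>i. Q *v axis i 1"] by auto
  have rsQ: "lin_prod N rs (Q *v u) = 0" for u
  proof -
    have "Q *v u = (\<Sum>i\<in>UNIV. u $ i *s (Q *v axis i 1))"
      by (subst basis_expansion[symmetric, of u]) (simp add: vec.linear_sum[OF matrix_vector_mul_linear_gen])
    then show ?thesis using rs(2) by (simp add: lin_prod_sum lin_prod_smult)
  qed
  obtain b c \<eta> \<gamma> where b: "bounded_bilinear b" "\<And>u v. b u v = b v u"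
    and nn: "\<And>u. 0 \<le> b u u" and pos: "0 < c" "0 < \<eta>" "0 < \<gamma>"
    and lb: "\<And>u. lin_prod N rs u = 0 \<Longrightarrow> c * (norm u)\<^sup>2 \<le> b u u"
    and dec: "\<And>u z. lin_prod N rs u = 0 \<Longrightarrow> \<bar>Im z\<bar> \<le> \<eta> * Re z
        \<Longrightarrow> b u (z *s (N *v u)) \<le> - \<gamma> * Re z * b u u"
    using lyapunov_form_lin_prod[of rs N] rs(1) by (auto simp: subset_iff)
  define b' where "b' u v = inner (P *v u) (P *v v) + b (Q *v u) (Q *v v)" for u v
  have "bounded_bilinear b'"
    unfolding b'_def
    using bounded_bilinear_form_add[OF bounded_linear_matrix_vector b(1) bounded_linear_matrix_vector, of P 1 Q]
    by simp
  moreover have "b' u v = b' v u" for u v by (simp add: b'_def inner_commute b(2))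
  moreover have "min 1 c / 2 > 0" using pos by simp
  \<comment> \<open>The halved constant comes from |u|^2 <= 2 |P u|^2 + 2 |Q u|^2.\<close>
  moreover have "min 1 c / 2 * (norm u)\<^sup>2 \<le> b' u u" for u
  proof -
    have "u = P *v u + Q *v u" by (simp add: Q_def matrix_vector_mult_diff_rdistrib)
    then have "norm u \<le> norm (P *v u) + norm (Q *v u)" by (metis norm_triangle_ineq)
    then have "(norm u)\<^sup>2 \<le> (norm (P *v u) + norm (Q *v u))\<^sup>2" by (rule power_mono) simp
    also have "\<dots> \<le> 2 * (norm (P *v u))\<^sup>2 + 2 * (norm (Q *v u))\<^sup>2"
      using sum_squares_bound[of "norm (P *v u)" "norm (Q *v u)"] by (simp add: power2_sum)
    finally have "min 1 c / 2 * (norm u)\<^sup>2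
        \<le> min 1 c / 2 * (2 * (norm (P *v u))\<^sup>2 + 2 * (norm (Q *v u))\<^sup>2)"
      using pos by (intro mult_left_mono) auto
    also have "\<dots> = min 1 c * (norm (P *v u))\<^sup>2 + min 1 c * (norm (Q *v u))\<^sup>2"
      by (simp add: algebra_simps)
    also have "\<dots> \<le> 1 * (norm (P *v u))\<^sup>2 + c * (norm (Q *v u))\<^sup>2"
      by (intro add_mono mult_right_mono) auto
    also have "\<dots> \<le> b' u u" using lb[OF rsQ] by (simp add: b'_def power2_norm_eq_inner)
    finally show ?thesis .
  qed
  moreover have "b' u (z *s (N *v u)) \<le> 0" if z: "\<bar>Im z\<bar> \<le> \<eta> * Re z" for u z
  proof -
    have z0: "0 \<le> Re z" using z \<open>0 < \<eta>\<close> abs_ge_zero[of "Im z"]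
      by (metis mult_pos_neg not_le order.strict_trans1)
    have "P *v (N *v u) = 0" "Q *v (N *v u) = N *v (Q *v u)"
      using P NQ by (simp_all add: matrix_vector_mul_assoc)
    then have "b' u (z *s (N *v u)) = b (Q *v u) (z *s (N *v (Q *v u)))"
      by (simp add: b'_def)
    also have "\<dots> \<le> - \<gamma> * Re z * b (Q *v u) (Q *v u)" by (rule dec[OF rsQ z])
    also have "\<dots> \<le> 0" using pos z0 nn by (simp add: mult_nonneg_nonneg)
    finally show ?thesis .
  qed
  ultimately show ?thesis using \<open>0 < \<eta>\<close> unfolding N_def by blast
qed

section \<open>Linear differential equations with entire coefficients\<close>

text \<open>The norm of a matrix is here the Frobenius norm; Cauchy-Schwarz is applied to each
  row.\<close>

lemma norm_matrix_vector_le: "norm (A *v v) \<le> norm A * norm v" for A :: "complex^'m^'k"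
proof -
  have "norm ((A *v v) $ i) \<le> norm (A $ i) * norm v" for i
  proof -
    have "norm ((A *v v) $ i) \<le> (\<Sum>j\<in>UNIV. \<bar>cmod (A $ i $ j)\<bar> * \<bar>cmod (v $ j)\<bar>)"
      unfolding matrix_vector_mult_def vec_lambda_beta
      by (rule order.trans[OF norm_sum]) (simp add: norm_mult)
    also have "\<dots> \<le> norm (A $ i) * norm v" unfolding norm_vec_def by (rule L2_set_mult_ineq)
    finally show ?thesis .
  qed
  then have "norm (A *v v) \<le> L2_set (\<lambda>i. norm (A $ i) * norm v) UNIV"
    unfolding norm_vec_def[of "A *v v"] by (intro L2_set_mono) auto
  also have "\<dots> = norm A * norm v"
    by (simp add: norm_vec_def[of A] L2_set_left_distrib)
  finally show ?thesis .
qed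

lemma norm_cscale [simp]: "norm (cscale c A) = cmod c * norm A"
proof -
  have "cscale c A $ i = c *s (A $ i)" for i by (simp add: vec_eq_iff)
  then show ?thesis by (simp add: norm_vec_def[of "cscale c A"] norm_vec_def[of A] L2_set_right_distrib)
qed

lemma continuous_on_matrix:
  assumes "\<And>i j. continuous_on S (\<lambda>t. B t $ i $ j)"
  shows "continuous_on S B"
proof -
  have "continuous_on S (\<lambda>t. \<chi> i j. B t $ i $ j)" by (intro continuous_intros assms)
  then show ?thesis by simp
qed

text \<open>Restriction to a real line b + s d, on which complex equations become real differential
  inequalities.\<close>

lemma has_vector_derivative_of_vec_deriv:
  assumes "has_vec_deriv F D (b + of_real s * d)"
  shows "((\<lambda>s. F (b + of_real s * d)) has_vector_derivative d *s D) (at s)"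
proof -
  have bl: "bounded_linear (axis i :: complex \<Rightarrow> complex^'a)" for i :: 'a
    by (rule linear_conv_bounded_linear[THEN iffD1], rule linearI) (auto simp: vec_eq_iff axis_def)
  have comp: "((\<lambda>s. F (b + of_real s * d) $ i) has_vector_derivative (d *s D) $ i) (at s)" for i
  proof -
    have "((\<lambda>z. F z $ i) has_field_derivative D $ i) (at (b + of_real s * d))"
      using assms by (simp add: has_vec_deriv_def)
    moreover have "((\<lambda>s. b + of_real s * d) has_vector_derivative d) (at s)"
      by (auto intro!: derivative_eq_intros)
    ultimately show ?thesis using field_vector_diff_chain_at by (fastforce simp: o_def)
  qed
  have "((\<lambda>s. \<Sum>i\<in>UNIV. axis i (F (b + of_real s * d) $ i)) has_vector_derivative
      (\<Sum>i\<in>UNIV. axis i ((d *s D) $ i))) (at s)"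
    by (intro has_vector_derivative_sum bounded_linear.has_vector_derivative[OF bl comp])
  moreover have "(\<Sum>i\<in>UNIV. axis i (v $ i)) = v" for v :: "complex^'a"
    by (simp add: vec_eq_iff axis_def)
  ultimately show ?thesis by (simp only:)
qed

text \<open>exp \<Phi> is an integrating factor. V is bounded at the start of the segment by its
  value at the end; in the energy estimate the end s = 1 is the point nearer to infinity.\<close>

lemma gronwall_backward:
  fixes V \<Phi> :: "real \<Rightarrow> real"
  assumes V: "\<And>s. 0 \<le> s \<Longrightarrow> s \<le> 1 \<Longrightarrow> (V has_real_derivative V' s) (at s)"
    and \<Phi>: "\<And>s. 0 \<le> s \<Longrightarrow> s \<le> 1 \<Longrightarrow> (\<Phi> has_real_derivative \<Phi>' s) (at s)"
    and le: "\<And>s. 0 \<le> s \<Longrightarrow> s \<le> 1 \<Longrightarrow> - (\<Phi>' s * V s) \<le> V' s"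
  shows "V 0 * exp (\<Phi> 0) \<le> V 1 * exp (\<Phi> 1)"
proof (rule DERIV_nonneg_imp_nondecreasing[where f = "\<lambda>s. V s * exp (\<Phi> s)"])
  fix s :: real assume s: "0 \<le> s" "s \<le> 1"
  have "((\<lambda>s. V s * exp (\<Phi> s)) has_real_derivative (V' s + \<Phi>' s * V s) * exp (\<Phi> s)) (at s)"
    using V[OF s] \<Phi>[OF s] by (auto intro!: derivative_eq_intros simp: algebra_simps)
  moreover have "0 \<le> (V' s + \<Phi>' s * V s) * exp (\<Phi> s)"
    using le[OF s] by (intro mult_nonneg_nonneg) auto
  ultimately show "\<exists>y. ((\<lambda>s. V s * exp (\<Phi> s)) has_real_derivative y) (at s) \<and> 0 \<le> y" by blast
qed simp

lemma bilinear_has_real_derivative: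
  fixes b :: "'a::real_normed_vector \<Rightarrow> 'a \<Rightarrow> real"
  assumes b: "bounded_bilinear b" and sym: "\<And>u v. b u v = b v u"
    and u: "(u has_vector_derivative u') (at s)"
  shows "((\<lambda>s. b (u s) (u s)) has_real_derivative 2 * b (u s) u') (at s)"
  using bounded_bilinear.has_vector_derivative[OF b u u] sym[of u' "u s"]
  by (simp add: has_real_derivative_iff_has_vector_derivative)

lemma linear_ode_unique:
  fixes y :: "complex \<Rightarrow> complex^'v"
  assumes y: "\<And>t. has_vec_deriv y (B t *v y t) t"
    and B: "continuous_on UNIV B" and y0: "y b = 0"
  shows "y t = 0"
proof -
  define d where "d = b - t"
  have "compact (B ` closed_segment t b)"
    using B by (intro compact_continuous_image compact_segment) (rule continuous_on_subset, auto)
  then obtain K where K: "\<And>s. s \<in> closed_segment t b \<Longrightarrow> norm (B s) \<le> K"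
    by (meson bounded_iff compact_imp_bounded image_eqI)
  define u where "u s = y (t + of_real s * d)" for s
  define u' where "u' s = d *s (B (t + of_real s * d) *v u s)" for s
  have u: "(u has_vector_derivative u' s) (at s)" for s
    unfolding u_def u'_def by (rule has_vector_derivative_of_vec_deriv[OF y])
  have "inner (u 0) (u 0) * exp (2 * (cmod d * K) * 0) \<le> inner (u 1) (u 1) * exp (2 * (cmod d * K) * 1)"
  proof (rule gronwall_backward)
    show "((\<lambda>s. inner (u s) (u s)) has_real_derivative 2 * inner (u s) (u' s)) (at s)" for s
      by (rule bilinear_has_real_derivative[OF bounded_bilinear_inner inner_commute u])
    show "((\<lambda>s. 2 * (cmod d * K) * s) has_real_derivative 2 * (cmod d * K)) (at s)" for s
      by (auto intro!: derivative_eq_intros)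
    show "- (2 * (cmod d * K) * inner (u s) (u s)) \<le> 2 * inner (u s) (u' s)" if "0 \<le> s" "s \<le> 1" for s
    proof -
      have "t + of_real s * d \<in> closed_segment t b"
        using that unfolding closed_segment_def d_def
        by (auto intro!: exI[of _ s] simp: scaleR_conv_of_real algebra_simps)
      then have "norm (B (t + of_real s * d)) \<le> K" by (rule K)
      then have "norm (B (t + of_real s * d)) * norm (u s) \<le> K * norm (u s)" by (rule mult_right_mono) simp
      then have "norm (u' s) \<le> cmod d * (K * norm (u s))"
        unfolding u'_def norm_smult_vec using norm_matrix_vector_le order.trans
        by (intro mult_left_mono) (blast, simp)
      then have "norm (u s) * norm (u' s) \<le> norm (u s) * (cmod d * (K * norm (u s)))"
        by (rule mult_left_mono) simp
      also have "\<dots> = cmod d * K * inner (u s) (u s)"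
        by (simp add: power2_norm_eq_inner[symmetric] power2_eq_square)
      finally have "norm (u s) * norm (u' s) \<le> cmod d * K * inner (u s) (u s)" .
      moreover have "- inner (u s) (u' s) \<le> norm (u s) * norm (u' s)"
        using norm_cauchy_schwarz[of "- u s" "u' s"] by simp
      ultimately show ?thesis by linarith
    qed
  qed
  moreover have "u 1 = 0" using y0 by (simp add: u_def d_def)
  ultimately have "inner (u 0) (u 0) \<le> 0" by simp
  then have "u 0 = 0" using inner_gt_zero_iff[of "u 0"] by linarith
  then show ?thesis by (simp add: u_def)
qed

text \<open>The class in which the Picard iteration runs: polynomials in E with coefficients entire
  in t. It is closed under multiplication by A0 + E A1 and under primitives in t, and each member is
  plainly holomorphic in E, so joint holomorphy never has to be discussed.\<close>

definition entire_poly_in :: "(complex \<Rightarrow> complex \<Rightarrow> complex^'v) \<Rightarrow> bool" where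
  "entire_poly_in g \<longleftrightarrow> (\<exists>m G. (\<forall>j i. (\<lambda>t. G j t $ i) holomorphic_on UNIV) \<and>
     (\<forall>t E. g t E = (\<Sum>j<m. E ^ j *s G j t)))"

lemma entire_poly_in_const: "entire_poly_in (\<lambda>_ _. v)"
  unfolding entire_poly_in_def
  by (intro exI[of _ 1] exI[of _ "\<lambda>_ _. v"]) auto

lemma entire_poly_in_add:
  assumes "entire_poly_in f" "entire_poly_in g"
  shows "entire_poly_in (\<lambda>t E. f t E + g t E)"
proof -
  obtain m F where F: "\<And>j i. (\<lambda>t. F j t $ i) holomorphic_on UNIV"
    "\<And>t E. f t E = (\<Sum>j<m. E ^ j *s F j t)" using assms by (auto simp: entire_poly_in_def)
  obtain n G where G: "\<And>j i. (\<lambda>t. G j t $ i) holomorphic_on UNIV"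
    "\<And>t E. g t E = (\<Sum>j<n. E ^ j *s G j t)" using assms by (auto simp: entire_poly_in_def)
  define H where "H j t = (if j < m then F j t else 0) + (if j < n then G j t else 0)" for j t
  have "(\<lambda>t. H j t $ i) holomorphic_on UNIV" for i j
    unfolding H_def using F(1) G(1)
    by (cases "j < m"; cases "j < n") (auto intro!: holomorphic_intros)
  moreover have "f t E + g t E = (\<Sum>j<max m n. E ^ j *s H j t)" for t E
  proof -
    have "(\<Sum>j<max m n. E ^ j *s H j t)
        = (\<Sum>j<max m n. if j < m then E ^ j *s F j t else 0) + (\<Sum>j<max m n. if j < n then E ^ j *s G j t else 0)"
      unfolding sum.distrib[symmetric]
      by (rule sum.cong) (auto simp: H_def vector_add_ldistrib)
    also have "(\<Sum>j<max m n. if j < m then E ^ j *s F j t else 0) = f t E"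
      unfolding F by (rule sum.mono_neutral_cong_right) auto
    also have "(\<Sum>j<max m n. if j < n then E ^ j *s G j t else 0) = g t E"
      unfolding G by (rule sum.mono_neutral_cong_right) auto
    finally show ?thesis ..
  qed
  ultimately show ?thesis unfolding entire_poly_in_def by blast
qed

lemma entire_poly_in_mult:
  assumes A: "\<And>i j. (\<lambda>t. A t $ i $ j) holomorphic_on UNIV" and "entire_poly_in g"
  shows "entire_poly_in (\<lambda>t E. A t *v g t E)"
proof -
  obtain m G where G: "\<And>j i. (\<lambda>t. G j t $ i) holomorphic_on UNIV"
    "\<And>t E. g t E = (\<Sum>j<m. E ^ j *s G j t)" using assms by (auto simp: entire_poly_in_def)
  have "(\<lambda>t. (A t *v G j t) $ i) holomorphic_on UNIV" for i j
    unfolding matrix_vector_mult_def by (auto intro!: holomorphic_intros A G)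
  moreover have "A t *v g t E = (\<Sum>j<m. E ^ j *s (A t *v G j t))" for t E
    by (simp add: G(2) vec.linear_sum[OF matrix_vector_mul_linear_gen])
  ultimately show ?thesis unfolding entire_poly_in_def
    by (intro exI[of _ m] exI[of _ "\<lambda>j t. A t *v G j t"]) simp
qed

lemma entire_poly_in_smult:
  assumes "entire_poly_in g"
  shows "entire_poly_in (\<lambda>t E. E *s g t E)"
proof -
  obtain m G where G: "\<And>j i. (\<lambda>t. G j t $ i) holomorphic_on UNIV"
    "\<And>t E. g t E = (\<Sum>j<m. E ^ j *s G j t)" using assms by (auto simp: entire_poly_in_def)
  define H where "H j t = (case j of 0 \<Rightarrow> 0 | Suc k \<Rightarrow> G k t)" for j t
  have "(\<lambda>t. H j t $ i) holomorphic_on UNIV" for i j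
    unfolding H_def using G(1) by (cases j) auto
  moreover have "E *s g t E = (\<Sum>j<Suc m. E ^ j *s H j t)" for t E
    unfolding sum.lessThan_Suc_shift G(2) H_def
    by (simp add: vec.scale_sum_right vector_smult_assoc)
  ultimately show ?thesis unfolding entire_poly_in_def
    by (intro exI[of _ "Suc m"] exI[of _ H]) simp
qed

lemma entire_poly_in_holomorphic:
  assumes "entire_poly_in g"
  shows "(\<lambda>E. g t E $ i) holomorphic_on S"
  using assms by (auto simp: entire_poly_in_def intro!: holomorphic_intros)

lemma entire_poly_in_primitive:
  assumes "entire_poly_in g"
  obtains F where "entire_poly_in F" "\<And>E. F b E = 0"
    "\<And>t E. has_vec_deriv (\<lambda>t. F t E) (g t E) t"
proof -
  obtain m G where G: "\<And>j i. (\<lambda>t. G j t $ i) holomorphic_on UNIV"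
    "\<And>t E. g t E = (\<Sum>j<m. E ^ j *s G j t)" using assms by (auto simp: entire_poly_in_def)
  have "\<exists>P. \<forall>t. (P has_field_derivative G j t $ i) (at t)" for i j
    by (rule holomorphic_convex_primitive'[of UNIV "\<lambda>t. G j t $ i"]) (auto intro: G)
  then have ex: "\<forall>i j. \<exists>P. \<forall>t. (P has_field_derivative G j t $ i) (at t)" by blast
  obtain P where P: "\<And>i j t. (P i j has_field_derivative G j t $ i) (at t)"
    using ex[unfolded choice_iff] by blast
  define H where "H j t = (\<chi> i. P i j t - P i j b)" for j t
  define F where "F t E = (\<Sum>j<m. E ^ j *s H j t)" for t E
  have dH: "((\<lambda>t. H j t $ i) has_field_derivative G j t $ i) (at t)" for i j t
    unfolding H_def by (auto intro!: derivative_eq_intros P)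
  then have "(\<lambda>t. H j t $ i) holomorphic_on UNIV" for i j
    by (auto simp: holomorphic_on_open)
  then have "entire_poly_in F" unfolding entire_poly_in_def F_def by blast
  moreover have "F b E = 0" for E by (simp add: F_def H_def vec_eq_iff)
  moreover have "has_vec_deriv (\<lambda>t. F t E) (g t E) t" for t E
    unfolding has_vec_deriv_def F_def G(2) sum_component vector_smult_component
    by (intro allI DERIV_sum DERIV_cmult dH)
  ultimately show ?thesis using that by blast
qed

text \<open>Induction step for the Picard bound C (K |t - b|)^k / k!: integration along the ray from
  b to t raises k by one.\<close>

lemma vec_deriv_power_bound:
  fixes F :: "complex \<Rightarrow> complex^'v"
  assumes F: "\<And>t. has_vec_deriv F (g t) t" and F0: "F b = 0"
    and g: "\<And>s. s \<in> cball b (cmod (t - b)) \<Longrightarrow> norm (g s) \<le> C * (K * cmod (s - b)) ^ k / fact k * K"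
  shows "norm (F t) \<le> C * (K * cmod (t - b)) ^ Suc k / fact (Suc k)"
proof -
  let ?d = "t - b"
  let ?\<phi> = "\<lambda>s. C * (K * (s * cmod ?d)) ^ Suc k / fact (Suc k)"
  let ?\<phi>' = "\<lambda>s. cmod ?d * (C * (K * (s * cmod ?d)) ^ k / fact k * K)"
  have d\<phi>: "(?\<phi> has_vector_derivative ?\<phi>' s) (at s)" for s
  proof -
    have "(?\<phi> has_real_derivative
        C * (real (Suc k) * (K * (s * cmod ?d)) ^ k * (K * cmod ?d)) / fact (Suc k)) (at s)"
      by (auto intro!: derivative_eq_intros simp del: fact_Suc of_nat_Suc power_Suc)
    also have "C * (real (Suc k) * (K * (s * cmod ?d)) ^ k * (K * cmod ?d)) / fact (Suc k) = ?\<phi>' s"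
      by (simp add: fact_Suc divide_simps del: of_nat_Suc)
    finally show ?thesis by (simp add: has_real_derivative_iff_has_vector_derivative)
  qed
  have dF: "((\<lambda>s. F (b + of_real s * ?d)) has_vector_derivative ?d *s g (b + of_real s * ?d)) (at s)" for s
    by (rule has_vector_derivative_of_vec_deriv[OF F])
  have "norm (F (b + of_real 1 * ?d) - F (b + of_real 0 * ?d)) \<le> ?\<phi> 1 - ?\<phi> 0"
  proof (rule differentiable_bound_general[where f' = "\<lambda>s. ?d *s g (b + of_real s * ?d)" and \<phi>' = ?\<phi>'])
    show "continuous_on {0..1} (\<lambda>s. F (b + of_real s * ?d))"
      using dF by (intro continuous_at_imp_continuous_on ballI) (meson has_vector_derivative_continuous)
    show "continuous_on {0..1} ?\<phi>"
      using d\<phi> by (intro continuous_at_imp_continuous_on ballI) (meson has_vector_derivative_continuous)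
    show "norm (?d *s g (b + of_real s * ?d)) \<le> ?\<phi>' s" if "0 < s" "s < 1" for s
    proof -
      have c: "cmod (b + of_real s * ?d - b) = s * cmod ?d" using that by (simp add: norm_mult)
      moreover have "s * cmod ?d \<le> cmod ?d" using that by (simp add: mult_left_le_one_le)
      ultimately have "b + of_real s * ?d \<in> cball b (cmod ?d)"
        unfolding mem_cball dist_commute[of b] dist_norm by simp
      from g[OF this] show ?thesis unfolding norm_smult_vec c by (rule mult_left_mono) simp
    qed
  qed (use d\<phi> dF in auto)
  then show ?thesis using F0 by simp
qed

context
  fixes A0 A1 :: "complex \<Rightarrow> complex^'v^'v"
  assumes A0: "\<And>i j. (\<lambda>t. A0 t $ i $ j) holomorphic_on UNIV"
    and A1: "\<And>i j. (\<lambda>t. A1 t $ i $ j) holomorphic_on UNIV"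
begin

text \<open>The solution is the sum of the Picard increments \<open>d k\<close>. Their factorial
  bounds are uniform for t and E in discs, so the series can be differentiated termwise in t, and
  its sum is a locally uniform limit of functions holomorphic in E.\<close>

lemma linear_ode_solution:
  obtains y where "\<And>E. y b E = v0"
    "\<And>t E. has_vec_deriv (\<lambda>t. y t E) ((A0 t + cscale E (A1 t)) *v y t E) t"
    "\<And>t i. (\<lambda>E. y t E $ i) holomorphic_on UNIV"
proof -
  define A where "A t E = A0 t + cscale E (A1 t)" for t E
  have step: "\<exists>F. entire_poly_in F \<and> (\<forall>E. F b E = 0) \<and>
      (\<forall>t E. has_vec_deriv (\<lambda>t. F t E) (A t E *v g t E) t)" if "entire_poly_in g" for g
  proof -
    have "entire_poly_in (\<lambda>t E. A0 t *v g t E + E *s (A1 t *v g t E))"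
      by (intro entire_poly_in_add entire_poly_in_smult entire_poly_in_mult A0 A1 that)
    also have "(\<lambda>t E. A0 t *v g t E + E *s (A1 t *v g t E)) = (\<lambda>t E. A t E *v g t E)"
      by (simp add: A_def matrix_vector_mult_add_rdistrib)
    finally show ?thesis using entire_poly_in_primitive[of "\<lambda>t E. A t E *v g t E" b] by metis
  qed
  obtain d where d0: "d 0 = (\<lambda>_ _. v0)" and nice: "\<And>k. entire_poly_in (d k)"
    and db: "\<And>k E. d (Suc k) b E = 0"
    and dd: "\<And>k t E. has_vec_deriv (\<lambda>t. d (Suc k) t E) (A t E *v d k t E) t"
  proof -
    define nxt where "nxt g = (SOME F. entire_poly_in F \<and> (\<forall>E. F b E = 0) \<and>
      (\<forall>t E. has_vec_deriv (\<lambda>t. F t E) (A t E *v g t E) t))" for g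
    have nxt: "entire_poly_in (nxt g)" "nxt g b E = 0"
        "has_vec_deriv (\<lambda>t. nxt g t E) (A t E *v g t E) t" if "entire_poly_in g" for g t E
      using someI_ex[OF step[OF that]] unfolding nxt_def by blast+
    define d where "d k = (nxt ^^ k) (\<lambda>_ _. v0)" for k
    have "entire_poly_in (d k)" for k
      by (induction k) (simp_all add: d_def nxt entire_poly_in_const)
    then show ?thesis using that[of d] nxt by (simp add: d_def)
  qed
  have bound: "\<exists>K. K \<ge> 0 \<and> (\<forall>t E. t \<in> cball b r \<longrightarrow> E \<in> cball 0 R \<longrightarrow> norm (A t E) \<le> K)" for r R
  proof -
    have c: "continuous_on UNIV A0" "continuous_on UNIV A1"
      using A0 A1 by (auto intro!: continuous_on_matrix holomorphic_on_imp_continuous_on)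
    obtain K0 where K0: "\<And>t. t \<in> cball b r \<Longrightarrow> norm (A0 t) \<le> K0"
      using compact_continuous_image[of "cball b r" A0] c(1) continuous_on_subset
      by (metis bounded_iff compact_cball compact_imp_bounded imageI subset_UNIV)
    obtain K1 where K1: "\<And>t. t \<in> cball b r \<Longrightarrow> norm (A1 t) \<le> K1"
      using compact_continuous_image[of "cball b r" A1] c(2) continuous_on_subset
      by (metis bounded_iff compact_cball compact_imp_bounded imageI subset_UNIV)
    show ?thesis
    proof (intro exI[of _ "\<bar>K0\<bar> + \<bar>R\<bar> * \<bar>K1\<bar>"] conjI allI impI)
      fix t E assume t: "t \<in> cball b r" and E: "E \<in> cball (0::complex) R"
      have "norm (A t E) \<le> norm (A0 t) + cmod E * norm (A1 t)"
        unfolding A_def using norm_triangle_ineq[of "A0 t" "cscale E (A1 t)"] by simp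
      also have "\<dots> \<le> \<bar>K0\<bar> + \<bar>R\<bar> * \<bar>K1\<bar>"
        using K0[OF t] K1[OF t] E by (intro add_mono mult_mono) auto
      finally show "norm (A t E) \<le> \<bar>K0\<bar> + \<bar>R\<bar> * \<bar>K1\<bar>" .
    qed simp
  qed
  have dbound: "norm (d k t E) \<le> norm v0 * (K * cmod (t - b)) ^ k / fact k"
    if K: "K \<ge> 0" "\<And>t E. t \<in> cball b r \<Longrightarrow> E \<in> cball 0 R \<Longrightarrow> norm (A t E) \<le> K"
      and t: "t \<in> cball b r" and E: "E \<in> cball 0 R" for K r R k t E
    using t
  proof (induction k arbitrary: t)
    case 0
    then show ?case by (simp add: d0)
  next
    case (Suc k)
    show ?case
    proof (rule vec_deriv_power_bound[OF dd db])
      fix s assume s: "s \<in> cball b (cmod (t - b))"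
      then have sr: "s \<in> cball b r" using Suc.prems by (auto simp: dist_norm norm_minus_commute)
      have "norm (A s E *v d k s E) \<le> norm (A s E) * norm (d k s E)" by (rule norm_matrix_vector_le)
      also have "\<dots> \<le> K * (norm v0 * (K * cmod (s - b)) ^ k / fact k)"
        using K(1) by (intro mult_mono K(2) sr E Suc.IH) auto
      finally show "norm (A s E *v d k s E) \<le> norm v0 * (K * cmod (s - b)) ^ k / fact k * K"
        by (simp add: mult_ac)
    qed
  qed
  have dbound': "norm (d k t E) \<le> norm v0 * (K * r) ^ k / fact k"
    if K: "K \<ge> 0" "\<And>t E. t \<in> cball b r \<Longrightarrow> E \<in> cball 0 R \<Longrightarrow> norm (A t E) \<le> K"
      and t: "t \<in> cball b r" and E: "E \<in> cball 0 R" for K r R k t E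
  proof -
    have "norm (d k t E) \<le> norm v0 * (K * cmod (t - b)) ^ k / fact k" by (rule dbound[OF K t E])
    also have "\<dots> \<le> norm v0 * (K * r) ^ k / fact k"
      using t K(1) by (intro divide_right_mono mult_left_mono power_mono)
        (auto simp: dist_norm norm_minus_commute)
    finally show ?thesis .
  qed
  have sumM: "summable (\<lambda>k. C * (X ^ k / fact k))" for C X :: real
    using summable_exp_generic[of X] by (intro summable_mult) (simp add: field_simps)
  have sumM': "summable (\<lambda>k. norm v0 * X ^ k / fact k)" for X :: real
    using sumM[of "norm v0" X] by simp
  have summ: "summable (\<lambda>k. d k t E $ i)" for t E i
  proof -
    obtain K where K: "K \<ge> 0" "\<And>s F. s \<in> cball b (cmod (t - b)) \<Longrightarrow> F \<in> cball 0 (cmod E) \<Longrightarrow> norm (A s F) \<le> K"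
      using bound by metis
    show ?thesis
    proof (rule summable_comparison_test'[OF sumM'])
      fix k
      have "norm (d k t E $ i) \<le> norm (d k t E)" by (rule Finite_Cartesian_Product.norm_nth_le)
      also have "\<dots> \<le> norm v0 * (K * cmod (t - b)) ^ k / fact k"
        by (rule dbound'[OF K]) (auto simp: dist_norm norm_minus_commute)
      finally show "norm (d k t E $ i) \<le> norm v0 * (K * cmod (t - b)) ^ k / fact k" .
    qed
  qed
  define y where "y t E = (\<chi> i. \<Sum>k. d k t E $ i)" for t E
  have "y b E = v0" for E
  proof -
    have "(\<Sum>k. d k b E $ i) = v0 $ i" for i
      using suminf_split_head[OF summ, of b E i] by (simp add: db d0)
    then show ?thesis by (simp add: y_def vec_eq_iff)
  qed
  moreover have "has_vec_deriv (\<lambda>t. y t E) (A t E *v y t E) t" for t E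
    unfolding has_vec_deriv_def
  proof
    fix i
    define r where "r = cmod (t - b) + 1"
    obtain K where K: "K \<ge> 0" "\<And>s F. s \<in> cball b r \<Longrightarrow> F \<in> cball 0 (cmod E) \<Longrightarrow> norm (A s F) \<le> K"
      using bound by metis
    \<comment> \<open>Increment 0 is constant and has derivative 0, and increment k + 1 has
      derivative A times increment k; with this shift the derived series is A times the original
      one.\<close>
    define f' where "f' k s = (case k of 0 \<Rightarrow> 0 | Suc k \<Rightarrow> (A s E *v d k s E) $ i)" for k s
    have "((\<lambda>s. \<Sum>k. d k s E $ i) has_field_derivative (\<Sum>k. f' k t)) (at t)"
    proof (rule has_field_derivative_series'[where S = "cball b r" and ?x0.0 = b])
      show "((\<lambda>s. d k s E $ i) has_field_derivative f' k x) (at x within cball b r)" for k x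
        using dd[of "k - 1" E x] by (cases k)
          (auto simp: d0 f'_def has_vec_deriv_def intro: has_field_derivative_at_within)
      show "uniformly_convergent_on (cball b r) (\<lambda>n x. \<Sum>k<n. f' k x)"
      proof (rule Weierstrass_m_test')
        fix k x assume x: "x \<in> cball b r"
        show "norm (f' k x) \<le> (case k of 0 \<Rightarrow> 0 | Suc k \<Rightarrow> K * (norm v0 * (K * r) ^ k / fact k))"
        proof (cases k)
          case (Suc l)
          have "norm ((A x E *v d l x E) $ i) \<le> norm (A x E *v d l x E)"
            by (rule Finite_Cartesian_Product.norm_nth_le)
          also have "\<dots> \<le> norm (A x E) * norm (d l x E)" by (rule norm_matrix_vector_le)
          also have "\<dots> \<le> K * (norm v0 * (K * r) ^ l / fact l)"
            using K(1) by (intro mult_mono K(2) x dbound'[OF K]) auto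
          finally show ?thesis using Suc by (simp add: f'_def)
        qed (simp add: f'_def)
      next
        show "summable (\<lambda>k. case k of 0 \<Rightarrow> 0 | Suc k \<Rightarrow> K * (norm v0 * (K * r) ^ k / fact k))"
          by (subst summable_Suc_iff[symmetric]) (use sumM[of "K * norm v0" "K * r"] in \<open>simp add: mult_ac\<close>)
      qed
      show "t \<in> interior (cball b r)" by (simp add: r_def dist_norm norm_minus_commute)
    qed (auto simp: r_def summ)
    also have "(\<Sum>k. f' k t) = (A t E *v y t E) $ i"
    proof -
      have "(A t E *v y t E) $ i = (\<Sum>j\<in>UNIV. \<Sum>k. A t E $ i $ j * d k t E $ j)"
        unfolding matrix_vector_mult_def y_def vec_lambda_beta
        by (intro sum.cong refl suminf_mult[symmetric] summ)
      also have "\<dots> = (\<Sum>k. (A t E *v d k t E) $ i)"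
        unfolding matrix_vector_mult_def vec_lambda_beta
        by (intro suminf_sum[symmetric] summable_mult summ)
      finally have eq: "(A t E *v y t E) $ i = (\<Sum>k. (A t E *v d k t E) $ i)" .
      have "summable (\<lambda>k. (A t E *v d k t E) $ i)"
        unfolding matrix_vector_mult_def vec_lambda_beta by (intro summable_sum summable_mult summ)
      then have "summable (\<lambda>k. f' (Suc k) t)" by (simp add: f'_def)
      then have "summable (\<lambda>k. f' k t)" by (rule summable_Suc_iff[of "\<lambda>k. f' k t", THEN iffD1])
      from suminf_split_head[OF this] show ?thesis unfolding eq by (simp add: f'_def)
    qed
    finally show "((\<lambda>s. y s E $ i) has_field_derivative (A t E *v y t E) $ i) (at t)"
      by (simp add: y_def)
  qed
  moreover have "(\<lambda>E. y t E $ i) holomorphic_on UNIV" for t i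
  proof (rule holomorphic_uniform_sequence[where f = "\<lambda>n E. \<Sum>k<n. d k t E $ i"])
    show "(\<lambda>E. \<Sum>k<n. d k t E $ i) holomorphic_on UNIV" for n
      by (intro holomorphic_on_sum entire_poly_in_holomorphic nice)
    fix E0 :: complex
    define R where "R = cmod E0 + 1"
    define r where "r = cmod (t - b)"
    obtain K where K: "K \<ge> 0" "\<And>s F. s \<in> cball b r \<Longrightarrow> F \<in> cball 0 R \<Longrightarrow> norm (A s F) \<le> K"
      using bound by metis
    have "uniform_limit (cball E0 1) (\<lambda>n E. \<Sum>k<n. d k t E $ i) (\<lambda>E. y t E $ i) sequentially"
      unfolding y_def vec_lambda_beta
    proof (rule Weierstrass_m_test)
      fix k E assume E: "E \<in> cball E0 1"
      have "norm (d k t E $ i) \<le> norm (d k t E)" by (rule Finite_Cartesian_Product.norm_nth_le)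
      also have "\<dots> \<le> norm v0 * (K * r) ^ k / fact k"
      proof (rule dbound'[OF K])
        have "cmod E \<le> cmod E0 + cmod (E - E0)" by (metis add.commute norm_triangle_sub)
        then show "E \<in> cball 0 R" using E by (simp add: R_def dist_norm norm_minus_commute)
      qed (auto simp: r_def dist_norm norm_minus_commute)
      finally show "norm (d k t E $ i) \<le> norm v0 * (K * r) ^ k / fact k" .
    qed (rule sumM')
    then show "\<exists>e>0. cball E0 e \<subseteq> UNIV \<and>
        uniform_limit (cball E0 e) (\<lambda>n E. \<Sum>k<n. d k t E $ i) (\<lambda>E. y t E $ i) sequentially"
      by (intro exI[of _ 1]) auto
  qed simp
  ultimately show ?thesis using that[of y] unfolding A_def by blast
qed

text \<open>With a matrix of solutions the initial vector may itself depend on E without loss of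
  holomorphy.\<close>

lemma linear_ode_fundamental:
  obtains U where "\<And>E. U b E = mat 1"
    "\<And>t E v. has_vec_deriv (\<lambda>t. U t E *v v) ((A0 t + cscale E (A1 t)) *v (U t E *v v)) t"
    "\<And>t i j. (\<lambda>E. U t E $ i $ j) holomorphic_on UNIV"
proof -
  have "\<exists>y. (\<forall>E. y b E = axis j 1) \<and>
    (\<forall>t E. has_vec_deriv (\<lambda>t. y t E) ((A0 t + cscale E (A1 t)) *v y t E) t) \<and>
    (\<forall>t i. (\<lambda>E. y t E $ i) holomorphic_on UNIV)" for j :: 'v
    by (rule linear_ode_solution[of b "axis j 1"]) blast
  then have ex: "\<forall>j. \<exists>y. (\<forall>E. y b E = axis j 1) \<and>
    (\<forall>t E. has_vec_deriv (\<lambda>t. y t E) ((A0 t + cscale E (A1 t)) *v y t E) t) \<and>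
    (\<forall>t i. (\<lambda>E. y t E $ i) holomorphic_on UNIV)" by blast
  obtain y where y: "\<And>j E. y j b E = axis j 1"
    "\<And>j t E. has_vec_deriv (\<lambda>t. y j t E) ((A0 t + cscale E (A1 t)) *v y j t E) t"
    "\<And>j t i. (\<lambda>E. y j t E $ i) holomorphic_on UNIV"
    using ex[unfolded choice_iff] by blast
  define U where "U t E = (\<chi> i j. y j t E $ i)" for t E
  have Uv: "U t E *v v = (\<Sum>j\<in>UNIV. v $ j *s y j t E)" for t E v
    by (simp add: U_def matrix_vector_mult_def vec_eq_iff mult.commute)
  have "U b E = mat 1" for E
    by (simp add: U_def y(1) vec_eq_iff axis_def mat_def)
  moreover have "has_vec_deriv (\<lambda>t. U t E *v v) ((A0 t + cscale E (A1 t)) *v (U t E *v v)) t" for t E v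
    unfolding has_vec_deriv_def Uv vec.linear_sum[OF matrix_vector_mul_linear_gen] mult_vec_smult
      sum_component vector_smult_component
    using y(2) by (intro allI DERIV_sum DERIV_cmult) (simp add: has_vec_deriv_def)
  moreover have "(\<lambda>E. U t E $ i $ j) holomorphic_on UNIV" for t i j
    using y(3) by (simp add: U_def)
  ultimately show ?thesis using that by blast
qed

end

section \<open>The action and the truncated root\<close>

text \<open>The exponent a > -1 makes the singularity at 0 integrable. For t > 0 one has Ln (t x) =
  ln t + Ln x, so one branch serves the whole segment.\<close>

lemma has_contour_integral_powr_linepath:
  assumes a: "a > -1" and x: "x \<noteq> 0"
  shows "((\<lambda>y. c * y powr of_real a) has_contour_integral c * (exp (of_real (a + 1) * Ln x) / of_real (a + 1)))
    (linepath 0 x)"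
proof -
  have "((\<lambda>t. t powr a) has_integral 1 powr (a + 1) / (a + 1)) {0..1}"
    using has_integral_powr_from_0[OF a, of 1] by simp
  from has_integral_linear[OF this bounded_linear_of_real[where 'a = complex]]
  have "((\<lambda>t. complex_of_real (t powr a)) has_integral of_real (1 / (a + 1))) {0..1}"
    by (simp add: o_def)
  from has_integral_mult_right[OF this, of "c * exp (of_real (a + 1) * Ln x)"]
  have "((\<lambda>t. c * exp (of_real (a + 1) * Ln x) * complex_of_real (t powr a)) has_integral
      c * (exp (of_real (a + 1) * Ln x) / of_real (a + 1))) {0..1}"
    by simp
  moreover have "c * exp (of_real (a + 1) * Ln x) * complex_of_real (t powr a)
      = c * linepath 0 x t powr of_real a * (x - 0)" if "t \<in> {0..1}" for t
  proof (cases "t = 0")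
    case False
    then have t: "t > 0" using that by simp
    have l: "linepath 0 x t = of_real t * x" by (simp add: linepath_def scaleR_conv_of_real)
    have "Ln (of_real t * x) = of_real (ln t) + Ln x" using t x by (simp add: Ln_times_of_real Ln_of_real)
    then have "linepath 0 x t powr of_real a = exp (of_real a * of_real (ln t)) * exp (of_real a * Ln x)"
      using t x by (simp only: l powr_def distrib_left exp_add mult_eq_0_iff of_real_eq_0_iff
        less_numeral_extra(3) if_False simp_thms split: if_split) auto
    also have "exp (complex_of_real a * of_real (ln t)) = of_real (t powr a)"
      using t by (simp add: powr_def exp_of_real[symmetric])
    finally have "linepath 0 x t powr of_real a = of_real (t powr a) * exp (of_real a * Ln x)" .
    moreover have "exp (of_real (a + 1) * Ln x) = exp (of_real a * Ln x) * x"
      using x by (simp add: ring_distribs exp_add)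
    ultimately show ?thesis by simp
  qed (simp add: linepath_def)
  ultimately show ?thesis
    unfolding has_contour_integral_linepath by (subst has_integral_cong[symmetric]) (auto simp: mult_ac)
qed

lemma fps_power_nth_cong:
  fixes f g :: "'a::comm_ring_1 fps"
  assumes "\<And>i. i \<le> n \<Longrightarrow> fps_nth f i = fps_nth g i" "i \<le> n"
  shows "fps_nth (f ^ m) i = fps_nth (g ^ m) i"
  using assms(2)
proof (induction m arbitrary: i)
  case (Suc m)
  then show ?case using assms(1) by (auto simp: fps_mult_nth intro!: sum.cong)
qed simp

text \<open>The m-th power of the truncated series of (1 + u)^(1/m) agrees with 1 + u up to order s.
  The difference is a polynomial divisible by u^(s+1), with a cofactor that is bounded on the
  disc.\<close>

lemma truncated_root_power:
  fixes m s :: nat and r :: real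
  assumes m: "m > 0"
  obtains C where "C \<ge> 0" "\<And>u::complex. cmod u \<le> r \<Longrightarrow>
    cmod (1 + u - (\<Sum>j\<le>s. (of_real (1 / real m) gchoose j) * u ^ j) ^ m) \<le> C * cmod u ^ Suc s"
proof -
  define c :: complex where "c = of_real (1 / real m)"
  define Q where "Q = (\<Sum>j\<le>s. monom (c gchoose j) j)"
  define D where "D = [:1, 1:] - Q ^ m"
  have cQ: "coeff Q i = (if i \<le> s then c gchoose i else 0)" for i by (simp add: Q_def coeff_sum)
  have "coeff D k = 0" if "k < Suc s" for k
  proof -
    have "coeff (Q ^ m) k = fps_nth (fps_of_poly Q ^ m) k"
      by (simp add: fps_of_poly_power[symmetric])
    also have "\<dots> = fps_nth (fps_binomial c ^ m) k"
      using that by (intro fps_power_nth_cong[of s]) (auto simp: cQ)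
    also have "fps_binomial c ^ m = 1 + fps_X"
      using m by (simp add: fps_binomial_power c_def fps_binomial_1)
    also have "fps_nth (1 + fps_X :: complex fps) k = coeff [:1, 1:] k"
      by (cases k rule: nat.exhaust; cases "k - 1") (auto simp: fps_X_def coeff_pCons split: nat.split)
    finally show ?thesis by (simp add: D_def)
  qed
  then have "monom 1 (Suc s) dvd D" by (simp add: monom_1_dvd_iff')
  then obtain D' where D': "D = monom 1 (Suc s) * D'" by (elim dvdE)
  have "continuous_on (cball 0 r) (poly D')" by (intro continuous_at_imp_continuous_on) simp
  then have "bounded (poly D' ` cball 0 r)"
    by (intro compact_imp_bounded compact_continuous_image compact_cball)
  then obtain C where C: "\<And>u. u \<in> cball 0 r \<Longrightarrow> norm (poly D' u) \<le> C"
    unfolding bounded_iff by blast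
  show ?thesis
  proof (rule that[of "\<bar>C\<bar>"])
    fix u :: complex assume u: "cmod u \<le> r"
    have "1 + u - (\<Sum>j\<le>s. (of_real (1 / real m) gchoose j) * u ^ j) ^ m = poly D u"
      by (simp add: D_def Q_def poly_sum poly_monom c_def)
    also have "\<dots> = u ^ Suc s * poly D' u" by (simp add: D' poly_monom)
    also have "cmod \<dots> \<le> \<bar>C\<bar> * cmod u ^ Suc s"
    proof -
      have "cmod (poly D' u) \<le> \<bar>C\<bar>" using C[of u] u by auto
      then have "cmod u ^ Suc s * cmod (poly D' u) \<le> cmod u ^ Suc s * \<bar>C\<bar>"
        by (rule mult_left_mono) simp
      then show ?thesis by (simp only: norm_mult norm_power mult.commute)
    qed
    finally show "cmod (1 + u - (\<Sum>j\<le>s. (of_real (1 / real m) gchoose j) * u ^ j) ^ m)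
        \<le> \<bar>C\<bar> * cmod u ^ Suc s" .
  qed simp
qed

section \<open>The exponents in the variable w, and the decay of the correction factor\<close>

locale action =
  fixes N :: nat and M :: real
  assumes N: "0 < N" and M: "0 < M"
begin

text \<open>With w = x^(M+1) one has x = w^g.\<close>

definition g :: real where "g = 1 / (M + 1)"
text \<open>As x^(-M N) = w^(-\<beta>), the energy enters the transformed equation through E
  w^(-\<beta>).\<close>

definition \<beta> :: real where "\<beta> = g * M * real N"
abbreviation cf :: "complex \<Rightarrow> nat \<Rightarrow> complex" where "cf \<equiv> cco (real N)"
abbreviation qe :: "nat \<Rightarrow> real" where "qe \<equiv> qexp (real N) M"
abbreviation pw :: "complex \<Rightarrow> nat \<Rightarrow> complex" where
  "pw w j \<equiv> exp (- of_real (\<beta> * real j) * Ln w)"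
definition s :: nat where "s = sidx (real N) M"
abbreviation sector :: "real \<Rightarrow> complex set" where
  "sector \<delta> \<equiv> {x. \<bar>Arg x\<bar> < pi / (2 * (M + 1)) - \<delta>}"
abbreviation sector_infinity :: "real \<Rightarrow> complex filter" where
  "sector_infinity \<delta> \<equiv> inf at_infinity (principal (sector \<delta>))"
text \<open>The common margin of integrability: \<beta> is the rate of \<kappa> - 1, the entry 1
  accounts for the terms in 1/w^2, and the last entry for the first omitted power of the binomial
  series.\<close>

definition \<epsilon> :: real where "\<epsilon> = min (min \<beta> 1) (\<beta> * real (Suc s) - 1)"

text \<open>The action as a function of t = Ln x, in which it is entire; an exponent -1 integrates
  to t, the logarithm of x.\<close>

definition St :: "complex \<Rightarrow> complex \<Rightarrow> complex" where
  "St E t = (\<Sum>j\<le>s. cf E j *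
     (if qe j = -1 then t
      else exp (of_real (qe j + 1) * t) / of_real (qe j + 1)))"

text \<open>In the variable \<open>w = x\<^bsup>M+1\<^esup>\<close> one has \<open>q = x\<^sup>M \<kappa>\<close>.\<close>
definition kap :: "complex \<Rightarrow> complex \<Rightarrow> complex" where
  "kap E w = (\<Sum>j\<le>s. cf E j * pw w j)"

definition dkap :: "complex \<Rightarrow> complex \<Rightarrow> complex" where
  "dkap E w = (\<Sum>j\<le>s. cf E j * (pw w j * (- of_real (\<beta> * real j) / w)))"

definition zw :: "complex \<Rightarrow> complex" where
  "zw w = exp (- of_real \<beta> * Ln w)"

lemma g_pos: "0 < g" and g_lt_1: "g < 1" and gM: "g * (M + 1) = 1"
  using M by (auto simp: g_def)

lemma \<beta>_pos: "0 < \<beta>" using g_pos M N by (simp add: \<beta>_def)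

text \<open>The floor in s gives s + 1 > (M + 1)/(N M) = 1/\<beta>, which makes w^(-\<beta>(s+1))
  integrable at infinity.\<close>

lemma \<beta>_s: "1 < \<beta> * real (Suc s)"
proof -
  have "(M + 1) / (real N * M) < real (Suc s)"
    unfolding s_def sidx_def by linarith
  then have "M + 1 < real (Suc s) * (real N * M)" using M N by (simp add: pos_divide_less_eq)
  then have "g * (M + 1) < g * (real (Suc s) * (real N * M))" using g_pos by (rule mult_strict_left_mono)
  then show ?thesis by (simp add: gM \<beta>_def mult_ac)
qed

lemma \<epsilon>_pos: "0 < \<epsilon>" using \<beta>_pos \<beta>_s by (simp add: \<epsilon>_def)
lemma \<epsilon>_le: "\<epsilon> \<le> \<beta>" "\<epsilon> \<le> 1" "1 + \<epsilon> \<le> \<beta> * real (Suc s)" by (auto simp: \<epsilon>_def)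

lemma le_s_iff: "j \<le> s \<longleftrightarrow> real j * (real N * M) \<le> M + 1"
proof -
  have "j \<le> s \<longleftrightarrow> real j \<le> (M + 1) / (real N * M)"
    unfolding s_def sidx_def using M by (auto simp: le_nat_iff le_floor_iff)
  then show ?thesis using M N by (simp add: pos_le_divide_eq)
qed

lemma qexp_ge: "j \<le> s \<Longrightarrow> -1 \<le> qe j"
  by (simp add: le_s_iff qexp_def algebra_simps)

lemma qexp_eq_iff: "qe j = -1 \<longleftrightarrow> (M + 1) / (real N * M) = real j"
proof -
  have "qe j = -1 \<longleftrightarrow> M + 1 = real j * (real N * M)"
    by (auto simp: qexp_def algebra_simps)
  then show ?thesis using M N by (simp add: divide_eq_eq mult.commute)
qed

text \<open>All exponents with j <= s are at least -1, and -1 is attained only in the logarithmic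
  case, at j = s. Every other term is integrable at 0.\<close>

lemma Sfun_eq:
  assumes x: "x \<noteq> 0"
  shows "Sfun (real N) M E x = St E (Ln x)"
proof -
  let ?f = "\<lambda>j. \<lambda>y. cf E j * y powr of_real (qe j)"
  let ?F = "\<lambda>j. cf E j *
     (exp (of_real (qe j + 1) * Ln x) / of_real (qe j + 1))"
  have ci: "(?f j has_contour_integral ?F j) (linepath 0 x)" if "j \<le> s" "qe j \<noteq> -1" for j
    using qexp_ge[OF that(1)] that(2) x by (intro has_contour_integral_powr_linepath) auto
  show ?thesis
  proof (cases "log_case (real N) M")
    case True
    then obtain m :: nat where m: "(M + 1) / (real N * M) = real m" by (auto simp: log_case_def)
    then have ms: "m = s" by (simp add: s_def sidx_def)
    have ne: "qe j \<noteq> -1" if "j < s" for j using that m ms by (simp add: qexp_eq_iff)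
    have "qe s = -1" using m ms by (simp add: qexp_eq_iff)
    then have "St E (Ln x) = (\<Sum>j<s. ?F j) + cf E s * Ln x"
      unfolding St_def lessThan_Suc_atMost[symmetric] sum.lessThan_Suc
      using ne by (auto intro!: sum.cong)
    also have "(\<Sum>j<s. ?F j) = (\<Sum>j<s. contour_integral (linepath 0 x) (?f j))"
      using ne by (intro sum.cong refl contour_integral_unique[symmetric] ci) auto
    finally show ?thesis using True by (simp add: Sfun_def s_def[symmetric])
  next
    case False
    have ne: "qe j \<noteq> -1" if "j \<le> s" for j
    proof
      assume "qe j = -1"
      then have eq: "(M + 1) / (real N * M) = real j" by (simp add: qexp_eq_iff)
      moreover have "0 < (M + 1) / (real N * M)" using M N by simp
      ultimately show False using False by (auto simp: log_case_def)
    qed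
    have "((\<lambda>y. \<Sum>j\<le>s. ?f j y) has_contour_integral (\<Sum>j\<le>s. ?F j)) (linepath 0 x)"
      using ne by (intro has_contour_integral_sum ci) auto
    then have "contour_integral (linepath 0 x) (qfun (real N) M E) = (\<Sum>j\<le>s. ?F j)"
      unfolding qfun_def[abs_def] s_def[symmetric] by (rule contour_integral_unique)
    also have "\<dots> = St E (Ln x)" unfolding St_def using ne by (intro sum.cong) auto
    finally show ?thesis using False by (simp add: Sfun_def)
  qed
qed

lemma St_deriv:
  "(St E has_field_derivative (\<Sum>j\<le>s. cf E j * exp (of_real (qe j + 1) * t))) (at t)"
  unfolding St_def[abs_def]
proof (intro DERIV_sum DERIV_cmult)
  fix j
  show "((\<lambda>t. if qe j = -1 then t
      else exp (of_real (qe j + 1) * t) / of_real (qe j + 1)) has_field_derivative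
      exp (of_real (qe j + 1) * t)) (at t)"
  proof (cases "qe j = -1")
    case False
    then have "complex_of_real (qe j + 1) \<noteq> 0"
      by (simp only: of_real_eq_0_iff)
    then show ?thesis using False
      by (auto intro!: derivative_eq_intros simp del: of_real_add)
  qed (auto intro!: derivative_eq_intros)
qed

lemma qexp_g: "of_real (qe j) * (of_real g * L) = of_real (g * M) * L + - of_real (\<beta> * real j) * (L::complex)"
  by (simp add: qexp_def \<beta>_def algebra_simps)

lemma qfun_eq:
  assumes "x \<noteq> 0" "Ln x = of_real g * Ln w"
  shows "qfun (real N) M E x = exp (of_real (g * M) * Ln w) * kap E w"
proof -
  have "qfun (real N) M E x = (\<Sum>j\<le>s. cf E j * exp (of_real (qe j) * (of_real g * Ln w)))"
    using assms by (simp add: qfun_def powr_def s_def)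
  then show ?thesis
    unfolding qexp_g exp_add kap_def sum_distrib_left by (simp add: mult_ac)
qed

text \<open>dS/dw = q dx/dw, and the powers of w cancel because g M + g = 1.\<close>

lemma St_deriv_w:
  assumes "w \<noteq> 0" "w \<notin> \<real>\<^sub>\<le>\<^sub>0"
  shows "((\<lambda>w. St E (of_real g * Ln w)) has_field_derivative of_real g * kap E w) (at w)"
proof -
  let ?L = "Ln w"
  have "((\<lambda>w. of_real g * Ln w) has_field_derivative of_real g / w) (at w)"
    using assms by (auto intro!: derivative_eq_intros simp: field_simps)
  from DERIV_chain2[OF St_deriv this, of E]
  have "((\<lambda>w. St E (of_real g * Ln w)) has_field_derivative
    (\<Sum>j\<le>s. cf E j * exp (of_real (qe j + 1) * (of_real g * ?L))) * (of_real g / w)) (at w)" .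
  also have "(\<Sum>j\<le>s. cf E j * exp (of_real (qe j + 1) * (of_real g * ?L)))
      = (\<Sum>j\<le>s. w * (cf E j * exp (- of_real (\<beta> * real j) * ?L)))"
  proof (rule sum.cong[OF refl])
    fix j
    have "g * M + g = 1" using gM by (simp add: algebra_simps)
    have "of_real (qe j + 1) * (of_real g * ?L)
        = of_real (g * M + g) * ?L + - of_real (\<beta> * real j) * ?L"
      using qexp_g[of j ?L] by (simp add: algebra_simps)
    then have "exp (of_real (qe j + 1) * (of_real g * ?L))
        = exp (of_real (g * M + g) * ?L) * exp (- of_real (\<beta> * real j) * ?L)"
      by (simp only: exp_add)
    also have "exp (of_real (g * M + g) * ?L) = w"
      unfolding \<open>g * M + g = 1\<close> using assms(1) by simp
    finally have "exp (of_real (qe j + 1) * (of_real g * ?L)) = w * exp (- of_real (\<beta> * real j) * ?L)" .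
    then show "cf E j * exp (of_real (qe j + 1) * (of_real g * ?L))
        = w * (cf E j * exp (- of_real (\<beta> * real j) * ?L))" by simp
  qed
  also have "\<dots> * (of_real g / w) = of_real g * kap E w"
    using assms(1) by (simp add: kap_def sum_distrib_left[symmetric])
  finally show ?thesis .
qed

lemma kap_deriv:
  assumes "w \<notin> \<real>\<^sub>\<le>\<^sub>0"
  shows "(kap E has_field_derivative dkap E w) (at w)"
  unfolding kap_def[abs_def] dkap_def using assms
  by (intro DERIV_sum DERIV_cmult) (auto intro!: derivative_eq_intros simp: field_simps)

lemma cco_bound:
  assumes "cmod E \<le> R"
  shows "cmod (cf E j) \<le> cmod (of_real (1 / real N) gchoose j) * R ^ j"
  using assms by (auto simp: cco_def norm_mult norm_power intro!: mult_left_mono power_mono)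

lemma norm_exp_Ln: "w \<noteq> 0 \<Longrightarrow> cmod (exp (- of_real c * Ln w)) = cmod w powr (- c)"
  by (simp add: powr_def)

lemma exp_decay_bound:
  assumes "cmod w \<ge> 1" "j \<ge> 1"
  shows "cmod (pw w j) \<le> cmod w powr (- \<epsilon>)"
proof -
  have "w \<noteq> 0" using assms by auto
  have "\<beta> * 1 \<le> \<beta> * real j" using \<beta>_pos assms by (intro mult_left_mono) auto
  then have "cmod w powr (- (\<beta> * real j)) \<le> cmod w powr (- \<epsilon>)"
    using assms \<epsilon>_le by (intro powr_mono) auto
  then show ?thesis using norm_exp_Ln[OF \<open>w \<noteq> 0\<close>, of "\<beta> * real j"] by simp
qed

text \<open>The constant depends on E only through R, which makes everything that follows uniform on
  discs in E.\<close>

lemma kap_bounds: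
  obtains C where "C \<ge> 0"
    "\<And>E w. cmod E \<le> R \<Longrightarrow> cmod w \<ge> 1 \<Longrightarrow> cmod (kap E w - 1) \<le> C * cmod w powr (- \<epsilon>)"
    "\<And>E w. cmod E \<le> R \<Longrightarrow> cmod w \<ge> 1 \<Longrightarrow> cmod (dkap E w) \<le> C * cmod w powr (- 1 - \<epsilon>)"
    "\<And>E w. cmod E \<le> R \<Longrightarrow> cmod w \<ge> 1 \<Longrightarrow> cmod (1 - E * zw w - kap E w ^ N) \<le> C * cmod w powr (- 1 - \<epsilon>)"
proof -
  let ?R = "\<bar>R\<bar>"
  let ?c = "\<lambda>j. cmod (of_real (1 / real N) gchoose j) * ?R ^ j"
  define C1 where "C1 = (\<Sum>j\<le>s. ?c j)"
  define C2 where "C2 = (\<Sum>j\<le>s. ?c j * (\<beta> * real j))"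
  obtain C3 where C3: "C3 \<ge> 0" "\<And>u::complex. cmod u \<le> ?R \<Longrightarrow>
    cmod (1 + u - (\<Sum>j\<le>s. (of_real (1 / real N) gchoose j) * u ^ j) ^ N) \<le> C3 * cmod u ^ Suc s"
    using truncated_root_power[OF N, of ?R s] by blast
  have nn: "C1 \<ge> 0" "C2 \<ge> 0" using \<beta>_pos by (auto simp: C1_def C2_def intro!: sum_nonneg)
  define C where "C = C1 + C2 + C3 * ?R ^ Suc s"
  have Cge: "C1 \<le> C" "C2 \<le> C" "C3 * ?R ^ Suc s \<le> C" using nn C3(1) by (auto simp: C_def)
  have cb: "cmod (cf E j) \<le> ?c j" if "cmod E \<le> R" for E j
    using that by (intro cco_bound) auto
  have b1: "cmod (kap E w - 1) \<le> C * cmod w powr (- \<epsilon>)" if E: "cmod E \<le> R" and w: "cmod w \<ge> 1" for E w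
  proof -
    have "kap E w = cf E 0 + (\<Sum>j\<in>{..s} - {0}. cf E j * pw w j)"
      unfolding kap_def by (subst sum.remove[of _ 0]) auto
    then have "cmod (kap E w - 1) = cmod (\<Sum>j\<in>{..s} - {0}. cf E j * pw w j)"
      by (simp add: cco_def)
    also have "\<dots> \<le> (\<Sum>j\<in>{..s} - {0}. ?c j * cmod w powr (- \<epsilon>))"
      by (rule sum_norm_le) (auto simp only: norm_mult intro!: mult_mono cb E exp_decay_bound w, auto)
    also have "\<dots> \<le> (\<Sum>j\<le>s. ?c j * cmod w powr (- \<epsilon>))" by (rule sum_mono2) auto
    also have "\<dots> = C1 * cmod w powr (- \<epsilon>)" by (simp add: C1_def sum_distrib_right)
    also have "\<dots> \<le> C * cmod w powr (- \<epsilon>)" using Cge by (intro mult_right_mono) auto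
    finally show ?thesis .
  qed
  have b2: "cmod (dkap E w) \<le> C * cmod w powr (- 1 - \<epsilon>)" if E: "cmod E \<le> R" and w: "cmod w \<ge> 1" for E w
  proof -
    have "cmod (dkap E w) \<le> (\<Sum>j\<le>s. ?c j * (\<beta> * real j) * cmod w powr (- 1 - \<epsilon>))"
      unfolding dkap_def
    proof (rule sum_norm_le)
      fix j
      have "cmod (pw w j * (- of_real (\<beta> * real j) / w))
          \<le> \<beta> * real j * cmod w powr (- 1 - \<epsilon>)"
      proof (cases "j = 0")
        case False
        have "cmod (pw w j) * ((\<beta> * real j) / cmod w)
            \<le> cmod w powr (- \<epsilon>) * ((\<beta> * real j) / cmod w)"
          using False w \<beta>_pos by (intro mult_right_mono exp_decay_bound) auto
        also have "cmod w powr (- \<epsilon>) * ((\<beta> * real j) / cmod w) = \<beta> * real j * cmod w powr (- 1 - \<epsilon>)"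
        proof -
          have "- 1 - \<epsilon> = - \<epsilon> - 1" by simp
          then have "cmod w powr (- 1 - \<epsilon>) = cmod w powr (- \<epsilon>) / cmod w"
            using w by (simp only: powr_diff) simp
          then show ?thesis by simp
        qed
        finally show ?thesis using \<beta>_pos by (simp add: norm_mult norm_divide)
      qed simp
      then have "cmod (cf E j) * cmod (pw w j * (- of_real (\<beta> * real j) / w))
          \<le> ?c j * (\<beta> * real j * cmod w powr (- 1 - \<epsilon>))"
        by (intro mult_mono cb E) auto
      then show "cmod (cf E j * (pw w j * (- of_real (\<beta> * real j) / w)))
          \<le> ?c j * (\<beta> * real j) * cmod w powr (- 1 - \<epsilon>)"
        by (simp only: norm_mult[of "cf E j"] mult.assoc)
    qed
    also have "\<dots> = C2 * cmod w powr (- 1 - \<epsilon>)" by (simp add: C2_def sum_distrib_right)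
    also have "\<dots> \<le> C * cmod w powr (- 1 - \<epsilon>)" using Cge by (intro mult_right_mono) auto
    finally show ?thesis .
  qed
  have b3: "cmod (1 - E * zw w - kap E w ^ N) \<le> C * cmod w powr (- 1 - \<epsilon>)"
    if E: "cmod E \<le> R" and w: "cmod w \<ge> 1" for E w
  proof -
    have w0: "w \<noteq> 0" using w by auto
    define u where "u = - E * zw w"
    have nz: "cmod (zw w) = cmod w powr (- \<beta>)" unfolding zw_def by (rule norm_exp_Ln[OF w0])
    have "cmod w powr (- \<beta>) \<le> cmod w powr 0" using w \<beta>_pos by (intro powr_mono) auto
    then have z1: "cmod (zw w) \<le> 1" using nz w0 by simp
    have uR: "cmod u \<le> ?R"
      using mult_mono[of "cmod E" ?R "cmod (zw w)" 1] E z1 by (simp add: u_def norm_mult)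
    \<comment> \<open>\<kappa> is the truncated binomial series of (1 + u)^(1/N) at u = - E
      w^(-\<beta>).\<close>
    have "kap E w = (\<Sum>j\<le>s. (of_real (1 / real N) gchoose j) * u ^ j)"
      unfolding kap_def
    proof (rule sum.cong[OF refl])
      fix j
      have "pw w j = zw w ^ j"
        unfolding zw_def exp_of_nat_mult[symmetric] by (simp add: mult_ac)
      then show "cf E j * pw w j = (of_real (1 / real N) gchoose j) * u ^ j"
        unfolding cco_def u_def power_mult_distrib by simp
    qed
    then have "cmod (1 - E * zw w - kap E w ^ N) \<le> C3 * cmod u ^ Suc s"
      using C3(2)[OF uR] by (simp add: u_def)
    also have "\<dots> \<le> C3 * (?R ^ Suc s * cmod w powr (- 1 - \<epsilon>))"
    proof (rule mult_left_mono[OF _ C3(1)])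
      have "cmod u ^ Suc s = cmod E ^ Suc s * cmod (zw w) ^ Suc s"
        by (simp only: u_def norm_mult norm_minus_cancel power_mult_distrib)
      also have "cmod (zw w) ^ Suc s = cmod w powr (- \<beta> * real (Suc s))"
        unfolding nz using w0 by (simp add: powr_power mult.commute del: power_Suc of_nat_Suc)
      also have "cmod E ^ Suc s * cmod w powr (- \<beta> * real (Suc s)) \<le> ?R ^ Suc s * cmod w powr (- 1 - \<epsilon>)"
        using E w \<epsilon>_le(3) by (intro mult_mono power_mono powr_mono) auto
      finally show "cmod u ^ Suc s \<le> ?R ^ Suc s * cmod w powr (- 1 - \<epsilon>)" .
    qed
    also have "\<dots> \<le> C * cmod w powr (- 1 - \<epsilon>)"
      using Cge(3) by (simp only: mult.assoc[symmetric]) (intro mult_right_mono, auto)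
    finally show ?thesis .
  qed
  show ?thesis using that[of C] b1 b2 b3 nn C3(1) by (simp add: C_def)
qed

end

section \<open>The gauge transformed equation\<close>

lemma minus_mult_vec: "(- A) *v v = - (A *v v)"
  and mult_vec_minus: "A *v (- v) = - (A *v v)" for A :: "complex^'m^'k"
  by (simp_all add: vec_eq_iff matrix_vector_mult_def sum_negf)

text \<open>The analysis sees the Lie algebra only through these four brackets. Here a stands for
  the image of \<zeta> a0 and N for the dual Coxeter number.\<close>

locale wkb = action N M for N :: nat and M :: real +
  fixes H e a l X :: "complex^'v^'v" and lam :: complex
  assumes He: "lbr H e = e"
    and Ha: "lbr H a = cscale (- of_nat (N - 1)) a"
    and Hl: "lbr H l = 0"
    and X: "lbr (e + a) X = l - cscale (of_real M) H"
begin

text \<open>With t = Ln x the equation reads y' = - x L y, whose matrix is entire in t and affine in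
  E; this is the part free of E.\<close>

definition A0 :: "complex \<Rightarrow> complex^'v^'v" where
  "A0 t = - (l + cscale (exp t) e + cscale (exp (of_real (1 + M * real N) * t)) a)"

definition A1 :: "complex \<Rightarrow> complex^'v^'v" where
  "A1 t = cscale (exp t) a"

definition sol :: "complex \<Rightarrow> (complex \<Rightarrow> complex^'v) \<Rightarrow> complex \<Rightarrow> bool" where
  "sol E y t \<longleftrightarrow> has_vec_deriv y ((A0 t + cscale E (A1 t)) *v y t) t"

definition Nm :: "complex^'v^'v" where "Nm = (e + a) - cscale lam (mat 1)"
text \<open>The coefficient of g/w after the gauge: l stems from the equation, and - M H from
  differentiating the factor x^(M h) of q^h.\<close>

definition Dm :: "complex^'v^'v" where "Dm = l - cscale (of_real M) H"

text \<open>A logarithm of q put together from principal logarithms; it is holomorphic while w and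
  \<kappa> stay in the right half plane.\<close>

definition cq :: "complex \<Rightarrow> complex \<Rightarrow> complex" where
  "cq E w = of_real (g * M) * Ln w + Ln (kap E w)"

definition Y0 :: "complex \<Rightarrow> (complex \<Rightarrow> complex^'v) \<Rightarrow> complex \<Rightarrow> complex^'v" where
  "Y0 E y w = exp (lam * St E (of_real g * Ln w)) *s
     (mexp (cscale (cq E w) H) *v y (of_real g * Ln w))"

definition Y :: "complex \<Rightarrow> (complex \<Rightarrow> complex^'v) \<Rightarrow> complex \<Rightarrow> complex^'v" where
  "Y E y w = (mat 1 + cscale (1 / w) X) *v Y0 E y w"

text \<open>Up to the factor g, the difference of the coefficients of a and e after the gauge; it
  would vanish if \<kappa>^N were exactly 1 - E w^(-\<beta>).\<close>

definition res :: "complex \<Rightarrow> complex \<Rightarrow> complex" where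
  "res E w = (1 - E * zw w - kap E w ^ N) / kap E w ^ (N - 1)"

definition F1 :: "complex \<Rightarrow> complex \<Rightarrow> complex^'v^'v" where
  "F1 E w = cscale (of_real g * res E w) a - cscale (dkap E w / kap E w) H"

text \<open>The integrable remainder in the equation for Y. The first summand is the part of the 1/w
  term that X leaves over because \<kappa> differs from 1; the second comes from X/w acting on that
  term, and the last from differentiating X/w.\<close>

definition F2 :: "complex \<Rightarrow> complex \<Rightarrow> complex^'v \<Rightarrow> complex^'v" where
  "F2 E w u = (of_real g * (1 - kap E w) / w) *s (Dm *v u) + (of_real g / w\<^sup>2) *s (X *v (Dm *v u))
     + (mat 1 + cscale (1 / w) X) *v (F1 E w *v u) + (1 / w\<^sup>2) *s (X *v u)"

lemma exp_cq:
  assumes "kap E w \<noteq> 0"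
  shows "exp (cq E w) = exp (of_real (g * M) * Ln w) * kap E w"
  using assms by (simp add: cq_def exp_add)

text \<open>Conjugation by q^h multiplies e by q, and q dx/dw = g \<kappa>.\<close>

lemma Y0_scalar_e:
  assumes w: "w \<noteq> 0" and k: "kap E w \<noteq> 0"
  shows "of_real g / w * (exp (of_real g * Ln w) * exp (cq E w)) = of_real g * kap E w"
proof -
  have "g + g * M = 1" using gM by (simp add: algebra_simps)
  have "exp (of_real g * Ln w) * exp (of_real (g * M) * Ln w) = exp (of_real (g + g * M) * Ln w)"
    by (simp only: exp_add[symmetric] of_real_add distrib_right)
  also have "\<dots> = w" unfolding \<open>g + g * M = 1\<close> using w by simp
  finally have "exp (of_real g * Ln w) * exp (cq E w) = w * kap E w"
    unfolding exp_cq[OF k] by (simp only: mult.assoc[symmetric])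
  then show ?thesis using w by simp
qed

text \<open>Conjugation by q^h multiplies a by q^(1-N), so its coefficient is p q^(1-N) dx/dw = g (1
  - E w^(-\<beta>)) \<kappa>^(1-N). This nearly equals the coefficient of e, and the two terms
  combine to \<open>\<Lambda>\<close>.\<close>

lemma Y0_scalar_a:
  assumes w: "w \<noteq> 0" and k: "kap E w \<noteq> 0"
  shows "of_real g / w * ((exp (of_real (1 + M * real N) * (of_real g * Ln w)) - E * exp (of_real g * Ln w))
      * exp (- of_nat (N - 1) * cq E w)) = of_real g * kap E w + of_real g * res E w"
proof -
  obtain n where n: "N = Suc n" using N by (cases N) auto
  let ?L = "Ln w"
  have bn: "\<beta> = g * M * real (Suc n)" using \<beta>_def unfolding n[symmetric] .
  have "g + g * M = 1" using gM by (simp add: algebra_simps)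
  have "exp (- of_nat n * cq E w) = inverse (exp (cq E w) ^ n)"
    by (simp add: exp_minus exp_of_nat_mult)
  also have "\<dots> = inverse (exp (of_real (g * M) * ?L) ^ n) * inverse (kap E w ^ n)"
    unfolding exp_cq[OF k] power_mult_distrib by simp
  also have "inverse (exp (of_real (g * M) * ?L) ^ n) = exp (- (of_real (g * M * real n) * ?L))"
    by (simp add: exp_minus exp_of_nat_mult[symmetric] mult_ac)
  finally have 1: "exp (- of_nat n * cq E w) = exp (- (of_real (g * M * real n) * ?L)) * inverse (kap E w ^ n)" .
  have 2: "exp (of_real (1 + M * real N) * (of_real g * ?L)) * exp (- (of_real (g * M * real n) * ?L)) = w"
  proof -
    have "of_real (1 + M * real N) * (of_real g * ?L) + - (of_real (g * M * real n) * ?L) = of_real (g + g * M) * ?L"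
      unfolding n by (simp add: algebra_simps)
    then show ?thesis unfolding exp_add[symmetric] \<open>g + g * M = 1\<close> using w by simp
  qed
  have 3: "exp (of_real g * ?L) * exp (- (of_real (g * M * real n) * ?L)) = w * zw w"
  proof -
    have "of_real g * ?L + - (of_real (g * M * real n) * ?L) = of_real (g + g * M) * ?L + - of_real \<beta> * ?L"
      unfolding bn by (simp add: algebra_simps)
    then show ?thesis unfolding zw_def exp_add[symmetric] \<open>g + g * M = 1\<close> using w
      by (simp add: exp_add[symmetric]) (simp add: exp_add exp_diff exp_minus divide_inverse)
  qed
  have "(exp (of_real (1 + M * real N) * (of_real g * ?L)) - E * exp (of_real g * ?L)) * exp (- of_nat n * cq E w)
     = (exp (of_real (1 + M * real N) * (of_real g * ?L)) * exp (- (of_real (g * M * real n) * ?L))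
       - E * (exp (of_real g * ?L) * exp (- (of_real (g * M * real n) * ?L)))) * inverse (kap E w ^ n)"
    unfolding 1 by (simp only: left_diff_distrib mult.assoc)
  also have "\<dots> = w * ((1 - E * zw w) * inverse (kap E w ^ n))"
    unfolding 2 3 by (simp add: algebra_simps)
  finally have "of_real g / w * ((exp (of_real (1 + M * real N) * (of_real g * ?L)) - E * exp (of_real g * ?L))
      * exp (- of_nat n * cq E w)) = of_real g * ((1 - E * zw w) * inverse (kap E w ^ n))"
    using w by simp
  also have "(1 - E * zw w) * inverse (kap E w ^ n) = kap E w + res E w"
  proof -
    have "r = (1 - z - k ^ N) / k ^ (N - 1) \<Longrightarrow> k \<noteq> 0 \<Longrightarrow> (1 - z) * inverse (k ^ n) = k + r"
      for k z r :: complex by (simp add: n field_simps)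
    then show ?thesis using k res_def by blast
  qed
  finally show ?thesis by (simp add: n distrib_left)
qed

text \<open>The action contributes lam g \<kappa>, the factor q^h contributes H times the
  logarithmic derivative of q, and the intertwining relations move q^h past l, e and a.\<close>

lemma Y0_deriv:
  assumes w: "0 < Re w" and k: "0 < Re (kap E w)" and y: "sol E y (of_real g * Ln w)"
  shows "has_vec_deriv (Y0 E y)
    (- ((of_real g * kap E w) *s (Nm *v Y0 E y w) + (of_real g / w) *s (Dm *v Y0 E y w) + F1 E w *v Y0 E y w)) w"
proof -
  let ?L = "Ln w" and ?k = "kap E w"
  let ?m = "mexp (cscale (cq E w) H)" and ?t = "of_real g * Ln w"
  let ?S = "exp (lam * St E ?t)"
  have w0: "w \<noteq> 0" "w \<notin> \<real>\<^sub>\<le>\<^sub>0" and k0: "?k \<noteq> 0" "?k \<notin> \<real>\<^sub>\<le>\<^sub>0"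
    using w k by (auto simp: complex_nonpos_Reals_iff)
  define c' where "c' = of_real (g * M) / w + dkap E w / ?k"
  have dt: "((\<lambda>w. of_real g * Ln w) has_field_derivative of_real g / w) (at w)"
    using w0 by (auto intro!: derivative_eq_intros simp: field_simps)
  have dc: "(cq E has_field_derivative c') (at w)"
    unfolding cq_def[abs_def] c'_def using w0 k0
    by (auto intro!: derivative_eq_intros kap_deriv simp: field_simps)
  have dS: "((\<lambda>w. exp (lam * St E (of_real g * Ln w))) has_field_derivative ?S * (lam * (of_real g * ?k))) (at w)"
    using w0 by (auto intro!: derivative_eq_intros St_deriv_w)
  define v where "v = ?m *v y ?t"
  have dv: "has_vec_deriv (\<lambda>w. mexp (cscale (cq E w) H) *v y (of_real g * Ln w))
      (cscale c' (H ** ?m) *v y ?t + ?m *v ((of_real g / w) *s ((A0 ?t + cscale E (A1 ?t)) *v y ?t))) w"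
    by (rule has_vec_deriv_mult[OF has_mat_deriv_mexp_compose[OF dc]
          has_vec_deriv_compose[OF dt y[unfolded sol_def]]])
  define P where "P = cscale (exp (of_real (1 + M * real N) * ?t) - E * exp ?t) a"
  have A: "A0 ?t + cscale E (A1 ?t) = - (l + cscale (exp ?t) e + P)"
    unfolding P_def by (simp add: A0_def A1_def cscale_diff_left mult_ac)
  have il: "?m ** l = l ** ?m" using mexp_intertwine[of H l 0 "cq E w"] Hl by simp
  have ie: "?m ** e = cscale (exp (cq E w)) (e ** ?m)" using mexp_intertwine[of H e 1 "cq E w"] He by simp
  have ia: "?m ** a = cscale (exp (- of_nat (N - 1) * cq E w)) (a ** ?m)"
    by (rule mexp_intertwine[OF Ha])
  have mA: "?m *v ((of_real g / w) *s ((A0 ?t + cscale E (A1 ?t)) *v y ?t))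
      = - ((of_real g / w) *s (l *v v) + (of_real g * ?k) *s (e *v v) + (of_real g * ?k + of_real g * res E w) *s (a *v v))"
  proof -
    have "?m ** (l + cscale (exp ?t) e + P) = l ** ?m + cscale (exp ?t * exp (cq E w)) (e ** ?m)
        + cscale ((exp (of_real (1 + M * real N) * ?t) - E * exp ?t) * exp (- of_nat (N - 1) * cq E w)) (a ** ?m)"
      unfolding P_def by (simp add: matrix_add_ldistrib il ie ia)
    then have "?m *v ((A0 ?t + cscale E (A1 ?t)) *v y ?t) = - (l *v v + (exp ?t * exp (cq E w)) *s (e *v v)
        + ((exp (of_real (1 + M * real N) * ?t) - E * exp ?t) * exp (- of_nat (N - 1) * cq E w)) *s (a *v v))"
      unfolding matrix_vector_mul_assoc A matrix_minus_right v_def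
      by (simp add: matrix_vector_mult_add_rdistrib matrix_vector_mult_diff_rdistrib matrix_vector_mul_assoc minus_mult_vec)
    then have "?m *v ((of_real g / w) *s ((A0 ?t + cscale E (A1 ?t)) *v y ?t))
      = - ((of_real g / w) *s (l *v v) + (of_real g / w * (exp ?t * exp (cq E w))) *s (e *v v)
        + (of_real g / w * ((exp (of_real (1 + M * real N) * ?t) - E * exp ?t) * exp (- of_nat (N - 1) * cq E w))) *s (a *v v))"
      by (simp add: vec.scale_right_distrib vec.scale_minus_right vector_smult_assoc)
    then show ?thesis unfolding Y0_scalar_e[OF w0(1) k0(1)] Y0_scalar_a[OF w0(1) k0(1)] .
  qed
  have Y0v: "Y0 E y w = ?S *s v" by (simp add: Y0_def v_def)
  have "has_vec_deriv (Y0 E y) ((?S * (lam * (of_real g * ?k))) *s v + ?S *s (c' *s (H *v v) +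
      - ((of_real g / w) *s (l *v v) + (of_real g * ?k) *s (e *v v) + (of_real g * ?k + of_real g * res E w) *s (a *v v)))) w"
    using has_vec_deriv_smult[OF dS dv] unfolding mA
    by (simp add: Y0_def[abs_def] v_def matrix_vector_mul_assoc)
  moreover have "(?S * (lam * (of_real g * ?k))) *s v + ?S *s (c' *s (H *v v) +
      - ((of_real g / w) *s (l *v v) + (of_real g * ?k) *s (e *v v) + (of_real g * ?k + of_real g * res E w) *s (a *v v)))
    = - ((of_real g * kap E w) *s (Nm *v Y0 E y w) + (of_real g / w) *s (Dm *v Y0 E y w) + F1 E w *v Y0 E y w)"
    unfolding Y0v Nm_def Dm_def F1_def c'_def
    by (simp add: matrix_vector_mult_diff_rdistrib matrix_vector_mult_add_rdistrib vec_eq_iff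
        algebra_simps add_divide_distrib)
  ultimately show ?thesis by simp
qed

lemma Nm_X: "X ** Nm = Nm ** X - Dm"
  using X by (simp add: Nm_def Dm_def lbr_def matrix_distribs algebra_simps)

text \<open>Moving X past \<open>Nm\<close> costs \<open>Dm\<close>; the resulting (g \<kappa>/w) Dm
  cancels the (g/w) Dm of the previous equation up to the factor 1 - \<kappa>.\<close>

lemma Y_deriv:
  assumes w: "0 < Re w" and k: "0 < Re (kap E w)" and y: "sol E y (of_real g * Ln w)"
  shows "has_vec_deriv (Y E y)
    (- ((of_real g * kap E w) *s (Nm *v Y E y w)) - F2 E w (Y0 E y w)) w"
proof -
  have w0: "w \<noteq> 0" using w by auto
  let ?u = "Y0 E y w" and ?k = "of_real g * kap E w"
  have "has_mat_deriv (\<lambda>w. mat 1 + cscale (1 / w) X) (0 + (cscale (- 1 / w\<^sup>2) X + cscale (1 / w) 0)) w"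
    using w0 by (intro has_mat_deriv_add has_mat_deriv_const has_mat_deriv_cscale)
      (auto intro!: derivative_eq_intros simp: power2_eq_square field_simps)
  from has_vec_deriv_mult[OF this Y0_deriv[OF w k y]]
  have "has_vec_deriv (Y E y) (cscale (- 1 / w\<^sup>2) X *v ?u + (mat 1 + cscale (1 / w) X) *v
      (- (?k *s (Nm *v ?u) + (of_real g / w) *s (Dm *v ?u) + F1 E w *v ?u))) w"
    by (simp add: Y_def[abs_def])
  moreover have "cscale (- 1 / w\<^sup>2) X *v ?u + (mat 1 + cscale (1 / w) X) *v
      (- (?k *s (Nm *v ?u) + (of_real g / w) *s (Dm *v ?u) + F1 E w *v ?u))
    = - (?k *s (Nm *v Y E y w)) - F2 E w ?u"
  proof -
    have XN: "X *v (Nm *v ?u) = Nm *v (X *v ?u) - Dm *v ?u"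
      by (simp add: matrix_vector_mul_assoc Nm_X matrix_vector_mult_diff_rdistrib)
    define T where "T = mat 1 + cscale (1 / w) X"
    have T: "T *v v = v + (1 / w) *s (X *v v)" for v
      by (simp add: T_def matrix_vector_mult_add_rdistrib)
    have "T *v (- (?k *s (Nm *v ?u) + (of_real g / w) *s (Dm *v ?u) + F1 E w *v ?u))
        = - (?k *s (Nm *v ?u) + (?k / w) *s (Nm *v (X *v ?u)) - (?k / w) *s (Dm *v ?u)
            + (of_real g / w) *s (Dm *v ?u) + (of_real g / w\<^sup>2) *s (X *v (Dm *v ?u)) + T *v (F1 E w *v ?u))"
      unfolding T[of "- _"]
      by (simp add: T XN vec.scale_right_distrib vec.scale_right_diff_distrib vec.scale_minus_right
          matrix_vector_right_distrib matrix_vector_mult_diff_distrib mult_vec_minus vector_smult_assoc power2_eq_square)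
    then show ?thesis
      unfolding Y_def F2_def T_def[symmetric]
      by (simp add: T[of ?u] matrix_vector_right_distrib vec_eq_iff algebra_simps diff_divide_distrib)
  qed
  ultimately show ?thesis by simp
qed

end

section \<open>Bounds for the remainder and the energy estimate\<close>

context wkb begin

lemma F2_bound:
  assumes \<theta>: "0 < \<theta>" "\<theta> \<le> 1 / 2"
  obtains W K where "W \<ge> 1" "K \<ge> 0"
    "\<And>E w. cmod E \<le> R \<Longrightarrow> cmod w \<ge> W \<Longrightarrow> cmod (kap E w - 1) \<le> \<theta>"
    "\<And>E w u. cmod E \<le> R \<Longrightarrow> cmod w \<ge> W \<Longrightarrow> norm (F2 E w u) \<le> K * cmod w powr (- 1 - \<epsilon>) * norm u"
proof -
  obtain C where C: "C \<ge> 0"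
    "\<And>E w. cmod E \<le> R \<Longrightarrow> cmod w \<ge> 1 \<Longrightarrow> cmod (kap E w - 1) \<le> C * cmod w powr (- \<epsilon>)"
    "\<And>E w. cmod E \<le> R \<Longrightarrow> cmod w \<ge> 1 \<Longrightarrow> cmod (dkap E w) \<le> C * cmod w powr (- 1 - \<epsilon>)"
    "\<And>E w. cmod E \<le> R \<Longrightarrow> cmod w \<ge> 1 \<Longrightarrow> cmod (1 - E * zw w - kap E w ^ N) \<le> C * cmod w powr (- 1 - \<epsilon>)"
    using kap_bounds by metis
  \<comment> \<open>Beyond this W one has C |w|^(-\<epsilon>) <= \<theta>, so \<kappa> is within
    \<theta> of 1. As \<theta> <= 1/2, also |\<kappa>| >= 1/2, and division by \<kappa> is
    harmless.\<close>
  define W where "W = max 1 ((C / \<theta>) powr (1 / \<epsilon>))"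
  have W1: "W \<ge> 1" by (simp add: W_def)
  have kap1: "cmod (kap E w - 1) \<le> \<theta>" if E: "cmod E \<le> R" and w: "cmod w \<ge> W" for E w
  proof -
    have w1: "cmod w \<ge> 1" using w W1 by simp
    have "C / \<theta> = ((C / \<theta>) powr (1 / \<epsilon>)) powr \<epsilon>"
      using C(1) \<theta> \<epsilon>_pos by (simp add: powr_powr)
    also have "\<dots> \<le> cmod w powr \<epsilon>" using w \<epsilon>_pos by (intro powr_mono2) (auto simp: W_def)
    finally have "C \<le> \<theta> * cmod w powr \<epsilon>" using \<theta> by (simp add: field_simps)
    moreover have "0 < cmod w" using w1 by linarith
    then have "0 < cmod w powr \<epsilon>" by simp
    ultimately have "C * cmod w powr (- \<epsilon>) \<le> \<theta>"
      by (simp add: powr_minus_divide pos_divide_le_eq)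
    then show ?thesis using C(2)[OF E w1] by linarith
  qed
  define K1 where "K1 = g * (C * 2 ^ (N - 1)) * norm a + 2 * C * norm H"
  define K where "K = g * C * norm Dm + g * (norm X * norm Dm) + (1 + norm X) * K1 + norm X"
  have K1: "K1 \<ge> 0" using C(1) g_pos by (simp add: K1_def)
  have "K \<ge> 0" using C(1) g_pos K1 by (simp add: K_def)
  moreover have "norm (F2 E w u) \<le> K * cmod w powr (- 1 - \<epsilon>) * norm u"
    if E: "cmod E \<le> R" and w: "cmod w \<ge> W" for E w u
  proof -
    define p where "p = cmod w powr (- 1 - \<epsilon>)"
    have w1: "cmod w \<ge> 1" using w W1 by simp
    have iw: "1 / cmod w \<le> 1" using w1 by (subst divide_le_eq_1_pos) linarith+
    have p0: "p \<ge> 0" by (simp add: p_def)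
    have "1 \<le> cmod (kap E w) + cmod (1 - kap E w)"
      using norm_triangle_ineq[of "kap E w" "1 - kap E w"] by simp
    then have kh: "1 / 2 \<le> cmod (kap E w)"
      using kap1[OF E w] \<theta> by (simp add: norm_minus_commute)
    then have k0: "kap E w \<noteq> 0" by auto
    have p2: "1 / (cmod w)\<^sup>2 \<le> p"
    proof -
      have "1 / (cmod w)\<^sup>2 = cmod w powr (- 2)"
        using w1 by (simp add: powr_minus_divide flip: powr_numeral)
      also have "\<dots> \<le> p" unfolding p_def using w1 \<epsilon>_le by (intro powr_mono) auto
      finally show ?thesis .
    qed
    have p1: "cmod (1 - kap E w) / cmod w \<le> C * p"
    proof -
      have "cmod (1 - kap E w) / cmod w \<le> C * cmod w powr (- \<epsilon>) / cmod w"
        using C(2)[OF E w1] w1 by (intro divide_right_mono) (auto simp: norm_minus_commute)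
      also have "- 1 - \<epsilon> = - \<epsilon> - 1" by simp
      then have "C * cmod w powr (- \<epsilon>) / cmod w = C * p"
        unfolding p_def using w1 by (simp only: powr_diff) simp
      finally show ?thesis .
    qed
    have r: "cmod (res E w) \<le> C * 2 ^ (N - 1) * p"
    proof -
      have "cmod (res E w) = cmod (1 - E * zw w - kap E w ^ N) / cmod (kap E w) ^ (N - 1)"
        by (simp add: res_def norm_divide norm_power)
      also have "\<dots> \<le> (C * p) / (1 / 2) ^ (N - 1)"
        using C(1) C(4)[OF E w1] kh p0 by (intro frac_le power_mono) (auto simp: p_def)
      finally show ?thesis by (simp add: field_simps)
    qed
    have dk: "cmod (dkap E w / kap E w) \<le> 2 * C * p"
    proof -
      have "cmod (dkap E w / kap E w) \<le> (C * p) / (1 / 2)"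
        unfolding norm_divide using C(1) C(3)[OF E w1] kh p0 by (intro frac_le) (auto simp: p_def)
      then show ?thesis by simp
    qed
    have F1: "norm (F1 E w *v u) \<le> K1 * p * norm u"
    proof -
      have "norm (F1 E w) \<le> norm (cscale (of_real g * res E w) a) + norm (cscale (dkap E w / kap E w) H)"
        unfolding F1_def by (rule norm_triangle_ineq4)
      also have "\<dots> = g * cmod (res E w) * norm a + cmod (dkap E w / kap E w) * norm H"
        using g_pos by (simp add: norm_mult)
      also have "\<dots> \<le> g * (C * 2 ^ (N - 1) * p) * norm a + 2 * C * p * norm H"
        using g_pos by (intro add_mono mult_right_mono mult_left_mono r dk) auto
      also have "\<dots> = K1 * p" by (simp add: K1_def algebra_simps)
      finally have "norm (F1 E w) \<le> K1 * p" .
      then show ?thesis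
        using norm_matrix_vector_le[of "F1 E w" u] mult_right_mono[of "norm (F1 E w)" "K1 * p" "norm u"]
        by simp
    qed
    have T: "norm ((mat 1 + cscale (1 / w) X) *v v) \<le> (1 + norm X) * norm v" for v
    proof -
      have "norm ((mat 1 + cscale (1 / w) X) *v v) \<le> norm v + norm ((1 / w) *s (X *v v))"
        by (simp add: matrix_vector_mult_add_rdistrib norm_triangle_ineq del: norm_smult_vec)
      also have "norm ((1 / w) *s (X *v v)) \<le> 1 * (norm X * norm v)"
        unfolding norm_smult_vec
        using iw by (intro mult_mono norm_matrix_vector_le) (auto simp: norm_divide)
      finally show ?thesis by (simp add: algebra_simps)
    qed
    have t1: "norm ((of_real g * (1 - kap E w) / w) *s (Dm *v u)) \<le> g * C * norm Dm * p * norm u"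
    proof -
      have "norm ((of_real g * (1 - kap E w) / w) *s (Dm *v u)) = g * (cmod (1 - kap E w) / cmod w) * norm (Dm *v u)"
        using g_pos by (simp add: norm_mult norm_divide)
      also have "\<dots> \<le> g * (C * p) * (norm Dm * norm u)"
        using g_pos p0 C(1) by (intro mult_mono mult_left_mono p1 norm_matrix_vector_le) auto
      finally show ?thesis by (simp add: mult_ac)
    qed
    have XD: "norm (X *v (Dm *v u)) \<le> norm X * norm Dm * norm u"
      using norm_matrix_vector_le[of X "Dm *v u"]
        mult_left_mono[OF norm_matrix_vector_le[of Dm u], of "norm X"] by (simp add: mult.assoc)
    have t2: "norm ((of_real g / w\<^sup>2) *s (X *v (Dm *v u))) \<le> g * (norm X * norm Dm) * p * norm u"
    proof -
      have "norm ((of_real g / w\<^sup>2) *s (X *v (Dm *v u))) = g * (1 / (cmod w)\<^sup>2) * norm (X *v (Dm *v u))"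
        using g_pos by (simp add: norm_divide norm_power)
      also have "\<dots> \<le> g * p * (norm X * norm Dm * norm u)"
        using g_pos p0 by (intro mult_mono mult_left_mono p2 XD) auto
      finally show ?thesis by (simp add: mult_ac)
    qed
    have t3: "norm ((mat 1 + cscale (1 / w) X) *v (F1 E w *v u)) \<le> (1 + norm X) * K1 * p * norm u"
    proof -
      have "norm ((mat 1 + cscale (1 / w) X) *v (F1 E w *v u)) \<le> (1 + norm X) * (K1 * p * norm u)"
        by (rule order.trans[OF T]) (intro mult_left_mono F1, simp)
      then show ?thesis by (simp add: mult_ac)
    qed
    have t4: "norm ((1 / w\<^sup>2) *s (X *v u)) \<le> norm X * p * norm u"
    proof -
      have "norm ((1 / w\<^sup>2) *s (X *v u)) = (1 / (cmod w)\<^sup>2) * norm (X *v u)"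
        by (simp add: norm_divide norm_power)
      also have "\<dots> \<le> p * (norm X * norm u)"
        using p0 by (intro mult_mono p2 norm_matrix_vector_le) auto
      finally show ?thesis by (simp add: mult_ac)
    qed
    have "norm (F2 E w u) \<le> g * C * norm Dm * p * norm u + g * (norm X * norm Dm) * p * norm u
        + (1 + norm X) * K1 * p * norm u + norm X * p * norm u"
      unfolding F2_def
      by (intro order.trans[OF norm_triangle_ineq] add_mono t1 t2 t3 t4)
    also have "\<dots> = K * p * norm u" by (simp add: K_def algebra_simps)
    finally show ?thesis by (simp add: p_def)
  qed
  ultimately show ?thesis using that[of W K] W1 kap1 by blast
qed

end

text \<open>k d differs from Re d by at most 3 \<theta> Re d. Hence |Im (k d)| <= 3 \<theta> Re d
  while Re (k d) >= Re d / 2, and 6 \<theta> <= \<eta> closes the estimate.\<close>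

lemma cone_perturbation:
  assumes k: "cmod (k - 1) \<le> \<theta>" and d: "\<bar>Im d\<bar> \<le> \<theta> * Re d" "0 \<le> Re d"
    and \<theta>: "0 \<le> \<theta>" "\<theta> \<le> 1 / 6" "6 * \<theta> \<le> \<eta>"
  shows "\<bar>Im (k * d)\<bar> \<le> \<eta> * Re (k * d)"
proof -
  have "k * d - of_real (Re d) = (k - 1) * d + \<i> * of_real (Im d)"
    by (simp add: complex_eq_iff algebra_simps)
  then have "cmod (k * d - of_real (Re d)) \<le> cmod (k - 1) * cmod d + \<bar>Im d\<bar>"
    using norm_triangle_ineq[of "(k - 1) * d" "\<i> * of_real (Im d)"] by (simp add: norm_mult)
  also have "\<dots> \<le> \<theta> * (2 * Re d) + \<theta> * Re d"
  proof (intro add_mono mult_mono k d)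
    have "\<theta> * Re d \<le> 1 * Re d" using \<theta> d by (intro mult_right_mono) auto
    then show "cmod d \<le> 2 * Re d" using cmod_le[of d] d by linarith
  qed (use \<theta> in auto)
  finally have le: "cmod (k * d - of_real (Re d)) \<le> 3 * \<theta> * Re d" by simp
  have "\<bar>Im (k * d)\<bar> \<le> 3 * \<theta> * Re d"
    using abs_Im_le_cmod[of "k * d - of_real (Re d)"] le by simp
  also have "\<dots> \<le> \<eta> * (Re d / 2)" using mult_right_mono[OF \<theta>(3) d(2)] by simp
  also have "\<dots> \<le> \<eta> * Re (k * d)"
  proof (rule mult_left_mono)
    have "\<bar>Re (k * d) - Re d\<bar> \<le> 3 * \<theta> * Re d"
      using abs_Re_le_cmod[of "k * d - of_real (Re d)"] le by simp
    moreover have "3 * \<theta> * Re d \<le> 1 / 2 * Re d" using \<theta> d by (intro mult_right_mono) auto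
    ultimately show "Re d / 2 \<le> Re (k * d)" by linarith
  qed (use \<theta> in simp)
  finally show ?thesis .
qed

locale wkb_form = wkb N M H e a l X lam
  for N :: nat and M :: real and H e a l X :: "complex^'v^'v" and lam :: complex +
  fixes b :: "complex^'v \<Rightarrow> complex^'v \<Rightarrow> real" and cb \<eta> :: real
  assumes b: "bounded_bilinear b" and bsym: "\<And>u v. b u v = b v u"
    and cb: "0 < cb" and \<eta>: "0 < \<eta>" and b_lower: "\<And>u. cb * (norm u)\<^sup>2 \<le> b u u"
    and b_dec: "\<And>u z. \<bar>Im z\<bar> \<le> \<eta> * Re z \<Longrightarrow> b u (z *s (Nm *v u)) \<le> 0"
begin

lemma b_nonneg: "0 \<le> b u u"
  using b_lower[of u] cb by (meson mult_nonneg_nonneg less_imp_le order.trans zero_le_power2)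

text \<open>The matrix X/w has norm at most 1/2, so the correction 1 + X/w is undone at the cost of
  a factor 2.\<close>

lemma Y0_le_Y:
  assumes "2 * norm X \<le> cmod w" "1 \<le> cmod w"
  shows "norm (Y0 E y w) \<le> 2 * norm (Y E y w)"
proof -
  let ?u = "Y0 E y w"
  have "norm ((1 / w) *s (X *v ?u)) \<le> 1 / cmod w * (norm X * norm ?u)"
    unfolding norm_smult_vec norm_divide norm_one
    by (intro mult_left_mono norm_matrix_vector_le) auto
  also have "\<dots> \<le> 1 / 2 * norm ?u"
  proof -
    have "norm X / cmod w \<le> 1 / 2" using assms by (subst pos_divide_le_eq) auto
    from mult_right_mono[OF this, of "norm ?u"] show ?thesis by simp
  qed
  finally have "norm ((1 / w) *s (X *v ?u)) \<le> 1 / 2 * norm ?u" .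
  moreover have "?u = Y E y w - (1 / w) *s (X *v ?u)"
    by (simp add: Y_def matrix_vector_mult_add_rdistrib)
  then have "norm ?u \<le> norm (Y E y w) + norm ((1 / w) *s (X *v ?u))"
    using norm_triangle_ineq4 by metis
  ultimately show ?thesis by linarith
qed

text \<open>The perturbation acts on Y0 and does not vanish at psi, so |psi|^2 is added to obtain an
  energy that controls its own derivative; psi = 0 covers differences of solutions. The equation is
  asked for only at points g Ln w, since a competitor in the uniqueness proof is known only on the
  slit plane.\<close>

definition line_bound :: "real \<Rightarrow> real \<Rightarrow> real \<Rightarrow> real \<Rightarrow> bool" where
  "line_bound R W K \<theta> \<longleftrightarrow> (\<forall>E y w d \<psi>. cmod E \<le> R \<longrightarrow> W \<le> Re w \<longrightarrow> 0 \<le> Re d \<longrightarrow> \<bar>Im d\<bar> \<le> \<theta> * Re d \<longrightarrow>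
     (\<forall>w. 0 < Re w \<longrightarrow> sol E y (of_real g * Ln w)) \<longrightarrow> Nm *v \<psi> = 0 \<longrightarrow>
     (b (Y E y w - \<psi>) (Y E y w - \<psi>) + (norm \<psi>)\<^sup>2) * exp (- K * Re w powr (- \<epsilon>))
       \<le> b (Y E y (w + d) - \<psi>) (Y E y (w + d) - \<psi>) + (norm \<psi>)\<^sup>2)"

text \<open>Along a nearly horizontal line in the \<open>w\<close>-plane the Lyapunov form of a solution is
  nondecreasing up to an integrable perturbation, since all eigenvalues of \<open>Nm\<close> have
  nonpositive real part.\<close>
lemma line_estimate:
  "\<exists>W K \<theta>. W \<ge> 1 \<and> K \<ge> 0 \<and> \<theta> > 0 \<and> 2 * norm X \<le> W \<and>
    (\<forall>E w. cmod E \<le> R \<longrightarrow> W \<le> Re w \<longrightarrow> 0 < Re (kap E w)) \<and> line_bound R W K \<theta>"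
proof -
  \<comment> \<open>The margin 6 \<theta> <= \<eta> absorbs the widening of the cone under
    multiplication by \<kappa>.\<close>
  define \<theta> where "\<theta> = min (1 / 6) (\<eta> / 6)"
  have \<theta>: "0 < \<theta>" "\<theta> \<le> 1 / 6" "6 * \<theta> \<le> \<eta>" using \<eta> by (auto simp: \<theta>_def)
  obtain W1 K1 where W1: "W1 \<ge> 1" and K1: "K1 \<ge> 0"
    and kap1: "\<And>E w. cmod E \<le> R \<Longrightarrow> cmod w \<ge> W1 \<Longrightarrow> cmod (kap E w - 1) \<le> \<theta>"
    and F2: "\<And>E w u. cmod E \<le> R \<Longrightarrow> cmod w \<ge> W1 \<Longrightarrow> norm (F2 E w u) \<le> K1 * cmod w powr (- 1 - \<epsilon>) * norm u"
  proof -
    have "\<theta> \<le> 1 / 2" using \<theta> by simp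
    then show ?thesis using F2_bound[OF \<theta>(1), of R] that by blast
  qed
  obtain B where B: "B > 0" "\<And>u v. norm (b u v) \<le> norm u * norm v * B"
    using bounded_bilinear.pos_bounded[OF b] by blast
  define W where "W = max W1 (2 * norm X)"
  define m where "m = max 1 (1 / cb)"
  \<comment> \<open>m turns |u|^2 + |psi|^2 into the energy. The 16 is four factors 2: from |d| <= 2
    Re d, from |Y0| <= 2 |Y|, from |u| (|u| + |psi|) <= 2 (|u|^2 + |psi|^2), and from
    differentiating a quadratic form.\<close>
  define K2 where "K2 = 16 * B * K1 * m"
  have m: "m \<ge> 1" "1 / cb \<le> m" by (auto simp: m_def)
  have K2: "K2 \<ge> 0" using B K1 m by (simp add: K2_def)
  have Wge: "W1 \<le> cmod w" "2 * norm X \<le> cmod w" "1 \<le> cmod w" "0 < Re w" if "W \<le> Re w" for w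
    using that W1 complex_Re_le_cmod[of w] by (auto simp: W_def)
  have Rekap: "0 < Re (kap E w)" if "cmod E \<le> R" "W \<le> Re w" for E w
    using kap1[OF that(1) Wge(1)[OF that(2)]] abs_Re_le_cmod[of "kap E w - 1"] \<theta> by simp
  have main: "(b (Y E y w - \<psi>) (Y E y w - \<psi>) + (norm \<psi>)\<^sup>2) * exp (- (K2 / \<epsilon>) * Re w powr (- \<epsilon>))
        \<le> b (Y E y (w + d) - \<psi>) (Y E y (w + d) - \<psi>) + (norm \<psi>)\<^sup>2"
    if E: "cmod E \<le> R" and w: "W \<le> Re w" and d: "0 \<le> Re d" "\<bar>Im d\<bar> \<le> \<theta> * Re d"
      and y: "\<And>w. 0 < Re w \<Longrightarrow> sol E y (of_real g * Ln w)" and \<psi>: "Nm *v \<psi> = 0" for E y w d \<psi>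
  proof -
    define p where "p s = w + of_real s * d" for s :: real
    define u where "u s = Y E y (p s) - \<psi>" for s
    define Z where "Z s = d *s (- ((of_real g * kap E (p s)) *s (Nm *v Y E y (p s))) - F2 E (p s) (Y0 E y (p s)))" for s
    define V where "V s = b (u s) (u s) + (norm \<psi>)\<^sup>2" for s
    define \<Phi> where "\<Phi> s = - (K2 / \<epsilon>) * Re (p s) powr (- \<epsilon>)" for s
    have Rep: "Re (p s) = Re w + s * Re d" for s by (simp add: p_def)
    have pW: "W \<le> Re (p s)" if "0 \<le> s" for s
      using w d that by (simp add: Rep add_increasing2)
    have du: "(u has_vector_derivative Z s) (at s)" if "0 \<le> s" for s
    proof -
      have "has_vec_deriv (Y E y) (- ((of_real g * kap E (p s)) *s (Nm *v Y E y (p s))) - F2 E (p s) (Y0 E y (p s))) (p s)"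
        by (rule Y_deriv[OF Wge(4)[OF pW[OF that]] Rekap[OF E pW[OF that]] y[OF Wge(4)[OF pW[OF that]]]])
      from has_vector_derivative_of_vec_deriv[OF this[unfolded p_def]]
      show ?thesis
        unfolding u_def Z_def p_def by (auto intro!: derivative_eq_intros)
    qed
    have "V 0 * exp (\<Phi> 0) \<le> V 1 * exp (\<Phi> 1)"
    proof (rule gronwall_backward)
      fix s :: real assume s: "0 \<le> s" "s \<le> 1"
      show "(V has_real_derivative 2 * b (u s) (Z s)) (at s)"
        unfolding V_def using bilinear_has_real_derivative[OF b bsym du[OF s(1)]]
        by (auto intro!: derivative_eq_intros)
      have pos: "0 < Re (p s)" by (rule Wge(4)[OF pW[OF s(1)]])
      show "(\<Phi> has_real_derivative K2 * Re d * Re (p s) powr (- 1 - \<epsilon>)) (at s)"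
      proof -
        have "((\<lambda>s. Re (p s)) has_real_derivative Re d) (at s)"
          unfolding Rep by (auto intro!: derivative_eq_intros)
        then have "((\<lambda>s. Re (p s) powr (- \<epsilon>)) has_real_derivative - \<epsilon> * Re (p s) powr (- \<epsilon> - 1) * Re d) (at s)"
          using pos by (rule DERIV_fun_powr[THEN DERIV_cong]) auto
        from DERIV_cmult[OF this, of "- (K2 / \<epsilon>)"] show ?thesis
          unfolding \<Phi>_def by (rule DERIV_cong) (use \<epsilon>_pos in \<open>simp add: mult_ac minus_diff_commute[of 1]\<close>)
      qed
      define r where "r = Re (p s) powr (- 1 - \<epsilon>)"
      let ?G = "F2 E (p s) (Y0 E y (p s))"
      let ?z = "d * (of_real g * kap E (p s))"
      have r0: "r \<ge> 0" by (simp add: r_def)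
      have Y: "Y E y (p s) = u s + \<psi>" by (simp add: u_def)
      have Zs: "Z s = - (?z *s (Nm *v u s)) - d *s ?G"
        unfolding Z_def Y using \<psi>
        by (simp add: matrix_vector_right_distrib vec.scale_right_diff_distrib vec.scale_minus_right vector_smult_assoc)
      have bZ: "b (u s) (Z s) = - b (u s) (?z *s (Nm *v u s)) - b (u s) (d *s ?G)"
        unfolding Zs by (simp add: bounded_bilinear.diff_right[OF b] bounded_bilinear.minus_right[OF b])
      have "\<bar>Im (kap E (p s) * d)\<bar> \<le> \<eta> * Re (kap E (p s) * d)"
        by (rule cone_perturbation[OF kap1[OF E Wge(1)[OF pW[OF s(1)]]] d(2,1)]) (use \<theta> in auto)
      from mult_left_mono[OF this, of g]
      have "\<bar>g * Im (kap E (p s) * d)\<bar> \<le> \<eta> * (g * Re (kap E (p s) * d))"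
        using g_pos by (simp only: abs_mult abs_of_pos less_imp_le mult.left_commute)
      moreover have "Re ?z = g * Re (kap E (p s) * d)" "Im ?z = g * Im (kap E (p s) * d)"
        by (simp_all add: algebra_simps)
      ultimately have "\<bar>Im ?z\<bar> \<le> \<eta> * Re ?z" by (simp only:)
      then have b1: "b (u s) (?z *s (Nm *v u s)) \<le> 0" by (rule b_dec)
      have "b (u s) (d *s ?G) \<le> norm (u s) * norm (d *s ?G) * B"
        using B(2)[of "u s" "d *s ?G"] by simp
      also have "norm (d *s ?G) \<le> (2 * Re d) * (K1 * r * (2 * (norm (u s) + norm \<psi>)))"
        unfolding norm_smult_vec
      proof (rule mult_mono)
        have "\<theta> * Re d \<le> 1 * Re d" using \<theta> d by (intro mult_right_mono) auto
        then show "cmod d \<le> 2 * Re d" using cmod_le[of d] d by linarith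
        have "cmod (p s) powr (- 1 - \<epsilon>) \<le> r"
          unfolding r_def using complex_Re_le_cmod[of "p s"] pos \<epsilon>_pos by (intro powr_mono2') auto
        moreover have "norm (Y0 E y (p s)) \<le> 2 * (norm (u s) + norm \<psi>)"
          by (rule order.trans[OF Y0_le_Y[OF Wge(2,3)[OF pW[OF s(1)]]]])
            (unfold Y, intro mult_left_mono norm_triangle_ineq, simp)
        ultimately have "K1 * cmod (p s) powr (- 1 - \<epsilon>) * norm (Y0 E y (p s)) \<le> K1 * r * (2 * (norm (u s) + norm \<psi>))"
          using K1 r0 by (intro mult_mono mult_left_mono) auto
        then show "norm ?G \<le> K1 * r * (2 * (norm (u s) + norm \<psi>))"
          using F2[OF E Wge(1)[OF pW[OF s(1)]]] order.trans by blast
      qed (use d in auto)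
      finally have "b (u s) (d *s ?G)
          \<le> norm (u s) * ((2 * Re d) * (K1 * r * (2 * (norm (u s) + norm \<psi>)))) * B"
        using B(1) by (simp add: mult_left_mono mult_right_mono)
      also have "\<dots> = 4 * B * K1 * Re d * r * (norm (u s) * (norm (u s) + norm \<psi>))"
        by (simp add: mult_ac)
      also have "\<dots> \<le> 4 * B * K1 * Re d * r * (2 * m * V s)"
      proof (rule mult_left_mono)
        have "norm (u s) * (norm (u s) + norm \<psi>) \<le> 2 * ((norm (u s))\<^sup>2 + (norm \<psi>)\<^sup>2)"
        proof -
          have "x * (x + y) \<le> 2 * (x\<^sup>2 + y\<^sup>2)" for x y :: real
          proof -
            have "x * (x + y) = x\<^sup>2 + x * y" by (simp add: power2_eq_square algebra_simps)
            then show ?thesis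
              using sum_squares_bound[of x y] zero_le_power2[of x] zero_le_power2[of y]
              unfolding distrib_left by linarith
          qed
          then show ?thesis .
        qed
        also have "(norm (u s))\<^sup>2 + (norm \<psi>)\<^sup>2 \<le> m * b (u s) (u s) + m * (norm \<psi>)\<^sup>2"
        proof (rule add_mono)
          have "(norm (u s))\<^sup>2 \<le> 1 / cb * b (u s) (u s)"
            using b_lower[of "u s"] cb by (simp add: field_simps)
          also have "\<dots> \<le> m * b (u s) (u s)" by (intro mult_right_mono m b_nonneg)
          finally show "(norm (u s))\<^sup>2 \<le> m * b (u s) (u s)" .
          show "(norm \<psi>)\<^sup>2 \<le> m * (norm \<psi>)\<^sup>2"
            using mult_right_mono[OF m(1), of "(norm \<psi>)\<^sup>2"] by simp
        qed
        finally show "norm (u s) * (norm (u s) + norm \<psi>) \<le> 2 * m * V s"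
          by (simp add: V_def algebra_simps)
      qed (use B K1 d r0 in simp)
      finally have b2: "b (u s) (d *s ?G) \<le> K2 * Re d * r * V s / 2"
        by (simp add: K2_def mult_ac)
      show "- (K2 * Re d * Re (p s) powr (- 1 - \<epsilon>) * V s) \<le> 2 * b (u s) (Z s)"
        using b1 b2 unfolding bZ r_def right_diff_distrib by linarith
    qed
    also have "\<dots> \<le> V 1 * 1"
    proof (rule mult_left_mono)
      show "exp (\<Phi> 1) \<le> 1" using K2 \<epsilon>_pos by (simp add: \<Phi>_def)
      show "0 \<le> V 1" by (simp add: V_def b_nonneg)
    qed
    finally show ?thesis by (simp add: V_def u_def p_def \<Phi>_def)
  qed
  have "W \<ge> 1" "2 * norm X \<le> W" "0 \<le> K2 / \<epsilon>" using W1 K2 \<epsilon>_pos by (auto simp: W_def)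
  moreover have "line_bound R W (K2 / \<epsilon>) \<theta>"
    unfolding line_bound_def using main by blast
  ultimately show ?thesis using \<theta>(1) Rekap by blast
qed

end

section \<open>The subdominant solution\<close>

context wkb begin

lemma A0_holomorphic: "(\<lambda>t. A0 t $ i $ j) holomorphic_on UNIV"
  unfolding A0_def by (simp, intro holomorphic_intros)

lemma A1_holomorphic: "(\<lambda>t. A1 t $ i $ j) holomorphic_on UNIV"
  unfolding A1_def by (simp, intro holomorphic_intros)

lemma sol_diff: "sol E y1 t \<Longrightarrow> sol E y2 t \<Longrightarrow> sol E (\<lambda>t. y1 t - y2 t) t"
  unfolding sol_def has_vec_deriv_def
  by (auto simp: matrix_vector_mult_diff_distrib intro!: derivative_eq_intros)

lemma sol_unique:
  assumes "\<And>t. sol E y1 t" "\<And>t. sol E y2 t" "y1 t0 = y2 t0"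
  shows "y1 t = y2 t"
proof -
  have "y1 t - y2 t = 0"
  proof (rule linear_ode_unique[where b = t0 and B = "\<lambda>t. A0 t + cscale E (A1 t)" and y = "\<lambda>t. y1 t - y2 t"])
    show "has_vec_deriv (\<lambda>t. y1 t - y2 t) ((A0 t + cscale E (A1 t)) *v (y1 t - y2 t)) t" for t
      using sol_diff[OF assms(1,2)] by (simp add: sol_def)
    show "continuous_on UNIV (\<lambda>t. A0 t + cscale E (A1 t))"
      by (rule continuous_on_matrix, rule holomorphic_on_imp_continuous_on)
        (simp, intro holomorphic_intros A0_holomorphic A1_holomorphic)
  qed (use assms in simp)
  then show ?thesis by simp
qed

lemma Y0_diff: "Y0 E (\<lambda>t. y1 t - y2 t) w = Y0 E y1 w - Y0 E y2 w"
  by (simp add: Y0_def matrix_vector_mult_diff_distrib vec.scale_right_diff_distrib)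

lemma Y_diff: "Y E (\<lambda>t. y1 t - y2 t) w = Y E y1 w - Y E y2 w"
  by (simp add: Y_def Y0_diff matrix_vector_mult_diff_distrib)

lemma Y_expand: "Y E y w = Y0 E y w + (1 / w) *s (X *v Y0 E y w)"
  by (simp add: Y_def matrix_vector_mult_add_rdistrib)

text \<open>The inverse gauge: a solution with this value at g Ln w has Y0 = v at w.\<close>

definition ini :: "complex \<Rightarrow> complex \<Rightarrow> complex^'v \<Rightarrow> complex^'v" where
  "ini E w v = exp (- lam * St E (of_real g * Ln w)) *s (mexp (cscale (- cq E w) H) *v v)"

lemma Y0_ini: "y (of_real g * Ln w) = ini E w v \<Longrightarrow> Y0 E y w = v"
  by (simp add: Y0_def ini_def vector_smult_assoc exp_add[symmetric] matrix_vector_mul_assoc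
      mexp_right_inverse)

lemma ini_Y0: "ini E w (Y0 E y w) = y (of_real g * Ln w)"
  by (simp add: Y0_def ini_def vector_smult_assoc exp_add[symmetric] matrix_vector_mul_assoc
      mexp_left_inverse)

lemma holomorphic_on_St: "(\<lambda>E. St E t) holomorphic_on S"
  unfolding St_def cco_def by (intro holomorphic_intros)

lemma holomorphic_on_kap: "(\<lambda>E. kap E w) holomorphic_on S"
  unfolding kap_def cco_def by (intro holomorphic_intros)

lemma holomorphic_on_mexp:
  assumes "f holomorphic_on S"
  shows "(\<lambda>E. mexp (cscale (f E) H) $ i $ j) holomorphic_on S"
proof -
  have "(\<lambda>c. mexp (cscale c H) $ i $ j) holomorphic_on UNIV"
    using has_mat_deriv_mexp[of H] by (auto simp: holomorphic_on_open has_mat_deriv_def)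
  from holomorphic_on_compose_gen[OF assms this] show ?thesis by (simp add: o_def)
qed

lemma holomorphic_on_cq:
  assumes "\<And>E. E \<in> S \<Longrightarrow> 0 < Re (kap E w)"
  shows "(\<lambda>E. cq E w) holomorphic_on S"
  unfolding cq_def using assms
  by (intro holomorphic_intros holomorphic_on_kap) (auto simp: complex_nonpos_Reals_iff not_le)

lemma holomorphic_on_mult_vec:
  assumes "\<And>i j. (\<lambda>E. B E $ i $ j) holomorphic_on S" "\<And>i. (\<lambda>E. v E $ i) holomorphic_on S"
  shows "(\<lambda>E. (B E *v v E) $ i) holomorphic_on S"
  unfolding matrix_vector_mult_def vec_lambda_beta by (intro holomorphic_intros assms)

lemma holomorphic_on_ini:
  assumes "\<And>E. E \<in> S \<Longrightarrow> 0 < Re (kap E w)" "\<And>i. (\<lambda>E. v E $ i) holomorphic_on S"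
  shows "(\<lambda>E. ini E w (v E) $ i) holomorphic_on S"
  unfolding ini_def vector_smult_component
  by (intro holomorphic_intros holomorphic_on_St holomorphic_on_mult_vec holomorphic_on_mexp
      holomorphic_on_cq assms)

lemma holomorphic_on_Y0:
  assumes "\<And>E. E \<in> S \<Longrightarrow> 0 < Re (kap E w)" "\<And>t i. (\<lambda>E. y t E $ i) holomorphic_on S"
  shows "(\<lambda>E. Y0 E (\<lambda>t. y t E) w $ i) holomorphic_on S"
  unfolding Y0_def vector_smult_component
  by (intro holomorphic_intros holomorphic_on_St holomorphic_on_mult_vec holomorphic_on_mexp
      holomorphic_on_cq assms)

lemma tendsto_mult_vec:
  fixes B :: "complex^'v^'v"
  assumes "(f \<longlongrightarrow> v) F"
  shows "((\<lambda>x. B *v f x) \<longlongrightarrow> B *v v) F"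
  by (rule bounded_linear.tendsto[OF bounded_linear_matrix_vector assms])

lemma tendsto_smult_vec:
  fixes v :: "complex^'v"
  assumes "(f \<longlongrightarrow> v) F"
  shows "((\<lambda>x. c *s f x) \<longlongrightarrow> c *s v) F"
  using tendsto_mult_vec[OF assms, of "cscale c (mat 1)"] by simp

end

section \<open>Vanishing of decaying solutions, and construction of the solution from remote initial
  values\<close>

context wkb_form begin

lemma b_diff_le: "b (u - v) (u - v) \<le> 2 * b u u + 2 * b v v"
proof -
  interpret bounded_bilinear b by (rule b)
  have "0 \<le> b (u + v) (u + v)" by (rule b_nonneg)
  then show ?thesis using bsym[of u v]
    by (simp add: add_left add_right diff_left diff_right)
qed

lemma b_smult_real: "b (complex_of_real r *s u) (complex_of_real r *s u) = r\<^sup>2 * b u u"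
proof -
  interpret bounded_bilinear b by (rule b)
  have "complex_of_real r *s u = r *\<^sub>R u" by (simp add: vec_eq_iff scaleR_conv_of_real[where 'a = complex])
  then show ?thesis by (simp add: scaleR_left scaleR_right power2_eq_square)
qed

text \<open>With psi = 0 the energy at r is at most a constant times the energy at any m >= r, and
  the latter tends to 0.\<close>

lemma decaying_solution_zero:
  assumes y: "\<And>w. 0 < Re w \<Longrightarrow> sol E y (of_real g * Ln w)"
    and lim: "((\<lambda>r. Y0 E y (of_real r)) \<longlongrightarrow> 0) at_top"
  shows "\<exists>W>0. \<forall>r\<ge>W. y (of_real (g * ln r)) = 0"
proof -
  define R where "R = cmod E"
  obtain W K \<theta> where W: "W \<ge> 1" "K \<ge> 0" "\<theta> > 0" "2 * norm X \<le> W"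
    and lb: "line_bound R W K \<theta>"
    using line_estimate[of R] by blast
  have limY: "((\<lambda>r. Y E y (of_real r)) \<longlongrightarrow> 0) at_top"
  proof -
    have i: "((\<lambda>r. 1 / complex_of_real r) \<longlongrightarrow> 0) at_top"
    proof (rule tendsto_norm_zero_cancel)
      show "((\<lambda>r. norm (1 / complex_of_real r)) \<longlongrightarrow> 0) at_top"
        unfolding norm_divide norm_of_real norm_one by real_asymp
    qed
    have "((\<lambda>r. norm ((1 / complex_of_real r) *s (X *v Y0 E y (of_real r)))) \<longlongrightarrow> 0 * norm (X *v 0)) at_top"
      unfolding norm_smult_vec using tendsto_norm[OF i] tendsto_norm[OF tendsto_mult_vec[OF lim]]
      by (intro tendsto_mult) auto
    then have "((\<lambda>r. (1 / complex_of_real r) *s (X *v Y0 E y (of_real r))) \<longlongrightarrow> 0) at_top"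
      unfolding mult_zero_left by (rule tendsto_norm_zero_cancel)
    from tendsto_add[OF lim this] show ?thesis unfolding Y_expand by simp
  qed
  have "y (of_real (g * ln r)) = 0" if r: "r \<ge> W" for r
  proof -
    have "((\<lambda>m. b (Y E y (of_real m)) (Y E y (of_real m))) \<longlongrightarrow> b 0 0) at_top"
      by (rule bounded_bilinear.tendsto[OF b limY limY])
    then have l0: "((\<lambda>m. b (Y E y (of_real m)) (Y E y (of_real m))) \<longlongrightarrow> 0) at_top"
      by (simp add: bounded_bilinear.zero_left[OF b])
    have "\<forall>\<^sub>F m in at_top. b (Y E y (of_real r)) (Y E y (of_real r)) * exp (- K * r powr (- \<epsilon>))
        \<le> b (Y E y (of_real m)) (Y E y (of_real m))"
      using eventually_ge_at_top[of r]
    proof eventually_elim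
      case (elim m)
      then show ?case
        using lb[unfolded line_bound_def, rule_format, of E "of_real r" "of_real (m - r)" y 0] y r W
        by (simp add: R_def)
    qed
    from tendsto_lowerbound[OF l0 this]
    have "b (Y E y (of_real r)) (Y E y (of_real r)) * exp (- K * r powr (- \<epsilon>)) \<le> 0" by simp
    then have "b (Y E y (of_real r)) (Y E y (of_real r)) \<le> 0"
      by (simp add: mult_le_0_iff)
    from order.trans[OF b_lower this] have "cb * (norm (Y E y (of_real r)))\<^sup>2 \<le> 0" .
    then have "Y E y (of_real r) = 0" using cb by (simp add: mult_le_0_iff)
    then have "Y0 E y (of_real r) = 0"
      using Y0_le_Y[of "of_real r" E y] r W by simp
    then have "y (of_real g * Ln (of_real r)) = 0"
      using ini_Y0[of E "of_real r" y] by (simp add: ini_def)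
    moreover have "Ln (complex_of_real r) = of_real (ln r)" using r W by (intro Ln_of_real) simp
    ultimately show ?thesis by simp
  qed
  then show ?thesis using W(1) by (intro exI[of _ W]) auto
qed

text \<open>The solution \<open>yk k\<close> starts from psi at the real point \<open>q k\<close>,
  and the line estimate controls it in the backward cone of that point. Comparing the solutions at
  the fixed point \<open>q 0\<close> reduces their convergence to that of one vector, uniformly for
  |E| < R.\<close>

lemma existence_bounded_energy:
  assumes \<psi>: "Nm *v \<psi> = 0" and R: "R > 0"
  shows "\<exists>y f W. (\<forall>E t. sol E (\<lambda>t. y t E) t) \<and> (f \<longlongrightarrow> 0) at_top \<and>
    (\<forall>E w. cmod E < R \<longrightarrow> W \<le> Re w \<longrightarrow> 0 < Re (kap E w) \<and> norm (Y0 E (\<lambda>t. y t E) w - \<psi>) \<le> f (Re w)) \<and>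
    (\<forall>t i. (\<lambda>E. y t E $ i) holomorphic_on ball 0 R)"
proof -
  obtain W K \<theta> where W: "W \<ge> 1" and K: "K \<ge> 0" and \<theta>: "\<theta> > 0" and WX: "2 * norm X \<le> W"
    and Rekap: "\<And>E w. cmod E \<le> R \<Longrightarrow> W \<le> Re w \<Longrightarrow> 0 < Re (kap E w)"
    and lb: "line_bound R W K \<theta>"
    using line_estimate[of R] by blast
  define q where "q k = complex_of_real (W + real k)" for k :: nat
  have Req: "Re (q k) = W + real k" "Im (q k) = 0" for k by (simp_all add: q_def)
  have "\<forall>k. \<exists>U. (\<forall>E. U (of_real g * Ln (q k)) E = mat 1) \<and>
      (\<forall>t E v. sol E (\<lambda>t. U t E *v v) t) \<and> (\<forall>t i j. (\<lambda>E. U t E $ i $ j) holomorphic_on UNIV)"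
  proof
    fix k
    show "\<exists>U. (\<forall>E. U (of_real g * Ln (q k)) E = mat 1) \<and>
      (\<forall>t E v. sol E (\<lambda>t. U t E *v v) t) \<and> (\<forall>t i j. (\<lambda>E. U t E $ i $ j) holomorphic_on UNIV)"
      unfolding sol_def
      by (rule linear_ode_fundamental[OF A0_holomorphic A1_holomorphic, of "of_real g * Ln (q k)"]) blast
  qed
  from this[unfolded choice_iff] obtain U where U: "\<And>k E. U k (of_real g * Ln (q k)) E = mat 1"
      "\<And>k t E v. sol E (\<lambda>t. U k t E *v v) t" "\<And>k t i j. (\<lambda>E. U k t E $ i $ j) holomorphic_on UNIV"
    by blast
  define yk where "yk k E t = U k t E *v ini E (q k) \<psi>" for k t E
  have yk_sol: "sol E (yk k E) t" for k t E unfolding yk_def by (rule U(2))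
  have Y0q: "Y0 E (yk k E) (q k) = \<psi>" for k E
    by (rule Y0_ini) (simp add: yk_def U(1))
  define \<xi> where "\<xi> k = (1 / q k) *s (X *v \<psi>)" for k
  have Yq: "Y E (yk k E) (q k) - \<psi> = \<xi> k" for k E
    by (simp add: Y_expand Y0q \<xi>_def)
  define n\<psi> where "n\<psi> = (norm \<psi>)\<^sup>2"
  define dl where "dl k = b (\<xi> k) (\<xi> k)" for k
  have dl_eq: "dl k = (1 / (W + real k))\<^sup>2 * b (X *v \<psi>) (X *v \<psi>)" for k
    unfolding dl_def \<xi>_def q_def using b_smult_real[of "1 / (W + real k)" "X *v \<psi>"] by simp
  have dl_mono: "dl k \<le> dl j" if "j \<le> k" for j k
    unfolding dl_eq using that W by (intro mult_right_mono power_mono b_nonneg divide_left_mono) auto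
  have dl0: "dl \<longlonglongrightarrow> 0"
  proof -
    have "(\<lambda>k. (1 / (W + real k))\<^sup>2) \<longlonglongrightarrow> 0" by real_asymp
    from tendsto_mult_right[OF this, of "b (X *v \<psi>) (X *v \<psi>)"] show ?thesis
      unfolding dl_eq[abs_def] by simp
  qed
  \<comment> \<open>The line estimate solved for b. The terms |psi|^2 cancel up to exp (K
    r^(-\<epsilon>)) - 1, so \<Gamma> tends to 0 as d tends to 0 and r to infinity.\<close>
  define \<Gamma> where "\<Gamma> d r = (d + n\<psi>) * exp (K * r powr (- \<epsilon>)) - n\<psi>" for d r
  have estA: "b (Y E (yk k E) w - \<psi>) (Y E (yk k E) w - \<psi>) \<le> \<Gamma> (dl k) (Re w)"
    if E: "cmod E \<le> R" and w: "W \<le> Re w" "Re w \<le> W + real k" "\<bar>Im w\<bar> \<le> \<theta> * (W + real k - Re w)" for E k w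
  proof -
    let ?v = "Y E (yk k E) w - \<psi>"
    have "(b ?v ?v + n\<psi>) * exp (- K * Re w powr (- \<epsilon>)) \<le> dl k + n\<psi>"
      using lb[unfolded line_bound_def, rule_format, of E w "q k - w" "yk k E" \<psi>] E w \<psi> yk_sol
      by (simp add: Req Yq dl_def n\<psi>_def)
    then have "(b ?v ?v + n\<psi>) * exp (- K * Re w powr (- \<epsilon>)) * exp (K * Re w powr (- \<epsilon>))
        \<le> (dl k + n\<psi>) * exp (K * Re w powr (- \<epsilon>))"
      by (rule mult_right_mono) simp
    then show ?thesis
      unfolding \<Gamma>_def by (simp add: mult.assoc exp_add[symmetric])
  qed
  have \<Gamma>_mono: "\<Gamma> d r \<le> \<Gamma> d' r" if "d \<le> d'" for d d' r
    unfolding \<Gamma>_def using that by (intro diff_right_mono mult_right_mono) auto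
  define \<mu> where "\<mu> j = exp (K * W powr (- \<epsilon>)) * (2 * \<Gamma> (dl j) (W + real j) + 2 * dl j)" for j :: nat
  \<comment> \<open>At \<open>q j\<close> the solution \<open>yk j\<close> is psi in the
    normalization Y0, and \<open>yk k\<close> is near psi by \<open>estA\<close>. Their difference
    is a solution with psi = 0, and the line estimate carries its smallness back to
    \<open>q 0\<close>.\<close>
  have estB: "norm (Y0 E (yk k E) (q 0) - Y0 E (yk j E) (q 0)) \<le> 2 * sqrt (\<mu> j / cb)"
    if E: "cmod E \<le> R" and jk: "j \<le> k" for E j k
  proof -
    let ?y = "\<lambda>t. yk k E t - yk j E t"
    let ?v = "Y E ?y (q 0)"
    have ysol: "sol E ?y t" for t by (rule sol_diff[OF yk_sol yk_sol])
    have "(b ?v ?v) * exp (- K * W powr (- \<epsilon>)) \<le> b (Y E ?y (q j)) (Y E ?y (q j))"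
      using lb[unfolded line_bound_def, rule_format, of E "q 0" "q j - q 0" ?y 0] E ysol \<theta>
      by (simp add: Req)
    also have "Y E ?y (q j) = (Y E (yk k E) (q j) - \<psi>) - \<xi> j"
      unfolding Y_diff Yq[symmetric, of j E] by simp
    also have "b ((Y E (yk k E) (q j) - \<psi>) - \<xi> j) ((Y E (yk k E) (q j) - \<psi>) - \<xi> j)
        \<le> 2 * \<Gamma> (dl j) (W + real j) + 2 * dl j"
    proof (rule order.trans[OF b_diff_le])
      have "b (Y E (yk k E) (q j) - \<psi>) (Y E (yk k E) (q j) - \<psi>) \<le> \<Gamma> (dl k) (W + real j)"
        using estA[OF E, of "q j" k] jk \<theta> by (simp add: Req)
      also have "\<dots> \<le> \<Gamma> (dl j) (W + real j)" by (rule \<Gamma>_mono[OF dl_mono[OF jk]])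
      finally show "2 * b (Y E (yk k E) (q j) - \<psi>) (Y E (yk k E) (q j) - \<psi>) + 2 * b (\<xi> j) (\<xi> j)
          \<le> 2 * \<Gamma> (dl j) (W + real j) + 2 * dl j"
        by (simp add: dl_def)
    qed
    finally have "(b ?v ?v) * exp (- K * W powr (- \<epsilon>)) * exp (K * W powr (- \<epsilon>))
        \<le> (2 * \<Gamma> (dl j) (W + real j) + 2 * dl j) * exp (K * W powr (- \<epsilon>))"
      by (rule mult_right_mono) simp
    moreover have "exp (- K * W powr (- \<epsilon>)) * exp (K * W powr (- \<epsilon>)) = 1"
      by (simp add: exp_add[symmetric])
    ultimately have "b ?v ?v \<le> (2 * \<Gamma> (dl j) (W + real j) + 2 * dl j) * exp (K * W powr (- \<epsilon>))"
      by (simp only: mult.assoc[of "b ?v ?v"] mult_1_right)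
    then have "b ?v ?v \<le> \<mu> j" unfolding \<mu>_def by (simp only: mult.commute)
    from order.trans[OF b_lower this] have "cb * (norm ?v)\<^sup>2 \<le> \<mu> j" .
    then have "(norm ?v)\<^sup>2 \<le> \<mu> j / cb" using cb by (simp add: pos_le_divide_eq mult.commute)
    then have "norm ?v \<le> sqrt (\<mu> j / cb)" by (rule real_le_rsqrt)
    moreover have "norm (Y0 E ?y (q 0)) \<le> 2 * norm ?v"
      using W WX by (intro Y0_le_Y) (simp_all add: q_def)
    ultimately show ?thesis unfolding Y0_diff by simp
  qed
  have \<Gamma>lim: "((\<lambda>k. \<Gamma> (dl k) (W + real k)) \<longlongrightarrow> 0) sequentially"
  proof -
    have "(\<lambda>k. (W + real k) powr (- \<epsilon>)) \<longlonglongrightarrow> 0"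
      using \<epsilon>_pos by (intro tendsto_neg_powr filterlim_tendsto_add_at_top[OF tendsto_const]
        filterlim_real_sequentially) simp
    then have "(\<lambda>k. \<Gamma> (dl k) (W + real k)) \<longlonglongrightarrow> (0 + n\<psi>) * exp (K * 0) - n\<psi>"
      unfolding \<Gamma>_def by (intro tendsto_intros dl0)
    then show ?thesis by simp
  qed
  have \<nu>lim: "(\<lambda>j. 2 * sqrt (\<mu> j / cb)) \<longlonglongrightarrow> 0"
  proof -
    have "(\<lambda>j. 2 * sqrt (\<mu> j / cb)) \<longlonglongrightarrow> 2 * sqrt (exp (K * W powr (- \<epsilon>)) * (2 * 0 + 2 * 0) / cb)"
      unfolding \<mu>_def using cb by (intro tendsto_intros \<Gamma>lim dl0) auto
    then show ?thesis by simp
  qed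
  let ?F = "\<lambda>k E. Y0 E (yk k E) (q 0)"
  have "uniformly_Cauchy_on (ball 0 R) ?F"
  proof (rule uniformly_Cauchy_onI')
    fix e :: real assume "e > 0"
    then obtain J where J: "\<And>j. j \<ge> J \<Longrightarrow> \<bar>2 * sqrt (\<mu> j / cb)\<bar> < e"
      using \<nu>lim[unfolded LIMSEQ_iff] by (metis diff_zero real_norm_def)
    show "\<exists>J. \<forall>E\<in>ball 0 R. \<forall>j\<ge>J. \<forall>k>j. dist (?F j E) (?F k E) < e"
    proof (intro exI[of _ J] ballI allI impI)
      fix E j k assume "E \<in> ball (0::complex) R" "J \<le> j" "j < k"
      then show "dist (?F j E) (?F k E) < e"
        using estB[of E j k] J[of j] by (simp add: dist_norm norm_minus_commute)
    qed
  qed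
  then have "uniformly_convergent_on (ball 0 R) ?F" by (rule Cauchy_uniformly_convergent)
  then obtain \<Theta> where \<Theta>: "uniform_limit (ball 0 R) ?F \<Theta> sequentially"
    by (auto simp: uniformly_convergent_on_def)
  have Rk0: "0 < Re (kap E (q k))" if "E \<in> ball 0 R" for E k
    using that by (intro Rekap) (auto simp: Req)
  have hol_ini: "(\<lambda>E. ini E (q k) \<psi> $ i) holomorphic_on ball 0 R" for k i
    by (rule holomorphic_on_ini[OF Rk0]) auto
  have hol_yk: "(\<lambda>E. yk k E t $ i) holomorphic_on ball 0 R" for k t i
    unfolding yk_def
    by (rule holomorphic_on_mult_vec) (rule holomorphic_on_subset[OF U(3)], simp, rule hol_ini)
  have hol_\<Theta>: "(\<lambda>E. \<Theta> E $ i) holomorphic_on ball 0 R" for i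
  proof (rule holomorphic_uniform_sequence[where f = "\<lambda>k E. ?F k E $ i"])
    show "(\<lambda>E. ?F k E $ i) holomorphic_on ball 0 R" for k
      by (rule holomorphic_on_Y0[OF Rk0 hol_yk])
    fix E :: complex assume "E \<in> ball 0 R"
    then obtain d where d: "d > 0" "cball E d \<subseteq> ball 0 R"
      by (meson open_ball open_contains_cball)
    have "uniform_limit (ball 0 R) (\<lambda>k E. ?F k E $ i) (\<lambda>E. \<Theta> E $ i) sequentially"
      using bounded_linear.uniform_limit[OF bounded_linear_vec_nth \<Theta>] .
    then show "\<exists>d>0. cball E d \<subseteq> ball 0 R \<and> uniform_limit (cball E d) (\<lambda>k E. ?F k E $ i) (\<lambda>E. \<Theta> E $ i) sequentially"
      using d uniform_limit_on_subset by blast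
  qed simp
  \<comment> \<open>The limit is fixed by its value at \<open>q 0\<close> alone; the fundamental
    matrix extends it to all t and keeps it holomorphic in E.\<close>
  define y where "y t E = U 0 t E *v ini E (q 0) (\<Theta> E)" for t E
  have hol_y: "(\<lambda>E. y t E $ i) holomorphic_on ball 0 R" for t i
    unfolding y_def
    by (rule holomorphic_on_mult_vec, rule holomorphic_on_subset[OF U(3)], simp,
        rule holomorphic_on_ini[OF Rk0 hol_\<Theta>])
  have y_sol: "sol E (\<lambda>t. y t E) t" for t E unfolding y_def by (rule U(2))
  have conv: "(\<lambda>k. yk k E t) \<longlonglongrightarrow> y t E" if "E \<in> ball 0 R" for t E
  proof -
    have "(\<lambda>k. ?F k E) \<longlonglongrightarrow> \<Theta> E" by (rule tendsto_uniform_limitI[OF \<Theta> that])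
    then have "(\<lambda>k. U 0 t E *v ini E (q 0) (?F k E)) \<longlonglongrightarrow> y t E"
      unfolding y_def ini_def by (intro tendsto_mult_vec tendsto_smult_vec)
    \<comment> \<open>Uniqueness recovers \<open>yk k\<close> from its value at \<open>q 0\<close>,
      so convergence there gives convergence at every t.\<close>
    moreover have "yk k E t = U 0 t E *v ini E (q 0) (?F k E)" for k
      unfolding ini_Y0
      by (rule sol_unique[OF yk_sol U(2), where ?t0.0 = "of_real g * Ln (q 0)"]) (simp add: U(1))
    ultimately show ?thesis by simp
  qed
  have convY: "(\<lambda>k. Y E (yk k E) w) \<longlonglongrightarrow> Y E (\<lambda>t. y t E) w" if "E \<in> ball 0 R" for E w
    unfolding Y_def Y0_def by (intro tendsto_mult_vec tendsto_smult_vec conv[OF that])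
  have estC: "b (Y E (\<lambda>t. y t E) w - \<psi>) (Y E (\<lambda>t. y t E) w - \<psi>) \<le> \<Gamma> 0 (Re w)"
    if E: "cmod E < R" and w: "W \<le> Re w" for E w
  proof (rule tendsto_le[OF sequentially_bot])
    show "(\<lambda>k. \<Gamma> (dl k) (Re w)) \<longlonglongrightarrow> \<Gamma> 0 (Re w)"
      unfolding \<Gamma>_def by (intro tendsto_intros dl0)
    have E': "E \<in> ball 0 R" using E by simp
    show "(\<lambda>k. b (Y E (yk k E) w - \<psi>) (Y E (yk k E) w - \<psi>))
        \<longlonglongrightarrow> b (Y E (\<lambda>t. y t E) w - \<psi>) (Y E (\<lambda>t. y t E) w - \<psi>)"
      by (intro bounded_bilinear.tendsto[OF b] tendsto_diff convY[OF E'] tendsto_const)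
    \<comment> \<open>For k >= Re w + |Im w| / \<theta> the point w lies in the backward cone of
      \<open>q k\<close>, so every point of the half plane is eventually reached.\<close>
    have "filterlim (\<lambda>k. real k) at_top sequentially" by (rule filterlim_real_sequentially)
    then have "\<forall>\<^sub>F k in sequentially. Re w + \<bar>Im w\<bar> / \<theta> \<le> real k"
      unfolding filterlim_at_top by blast
    then show "\<forall>\<^sub>F k in sequentially. b (Y E (yk k E) w - \<psi>) (Y E (yk k E) w - \<psi>) \<le> \<Gamma> (dl k) (Re w)"
    proof eventually_elim
      case (elim k)
      have "0 \<le> \<bar>Im w\<bar> / \<theta>" using \<theta> by simp
      have "\<bar>Im w\<bar> / \<theta> \<le> W + real k - Re w" using elim W by linarith
      then have "\<bar>Im w\<bar> \<le> \<theta> * (W + real k - Re w)" using \<theta> by (simp add: pos_divide_le_eq mult.commute)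
      moreover have "Re w \<le> W + real k" using elim W \<open>0 \<le> \<bar>Im w\<bar> / \<theta>\<close> by linarith
      ultimately show ?case using E w by (intro estA) auto
    qed
  qed
  define h where "h r = sqrt (\<Gamma> 0 r / cb)" for r
  \<comment> \<open>\<open>h\<close> bounds |Y - psi|; the extra term bounds (1/w) X Y0, by which Y
    and Y0 differ.\<close>
  define f where "f r = h r + norm X / r * (2 * (h r + norm \<psi>))" for r
  have "(f \<longlongrightarrow> 0) at_top"
  proof -
    have "((\<lambda>r. r powr (- \<epsilon>)) \<longlongrightarrow> 0) at_top"
      using \<epsilon>_pos by (intro tendsto_neg_powr filterlim_ident) simp
    then have "(h \<longlongrightarrow> sqrt (((0 + n\<psi>) * exp (K * 0) - n\<psi>) / cb)) at_top"
      unfolding h_def \<Gamma>_def using cb by (intro tendsto_intros) auto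
    then have h: "(h \<longlongrightarrow> 0) at_top" by simp
    have "((\<lambda>r. norm X / r) \<longlongrightarrow> 0) at_top" by real_asymp
    then have "(f \<longlongrightarrow> 0 + 0 * (2 * (0 + norm \<psi>))) at_top"
      unfolding f_def by (intro tendsto_intros h)
    then show ?thesis by simp
  qed
  moreover have "norm (Y0 E (\<lambda>t. y t E) w - \<psi>) \<le> f (Re w)" if E: "cmod E < R" and w: "W \<le> Re w" for E w
  proof -
    let ?v = "Y E (\<lambda>t. y t E) w" and ?u = "Y0 E (\<lambda>t. y t E) w"
    have Wc: "W \<le> cmod w" using w complex_Re_le_cmod[of w] by linarith
    have "cb * (norm (?v - \<psi>))\<^sup>2 \<le> \<Gamma> 0 (Re w)" by (rule order.trans[OF b_lower estC[OF E w]])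
    then have "(norm (?v - \<psi>))\<^sup>2 \<le> \<Gamma> 0 (Re w) / cb" using cb by (simp add: pos_le_divide_eq mult.commute)
    then have h: "norm (?v - \<psi>) \<le> h (Re w)" unfolding h_def by (rule real_le_rsqrt)
    have "norm ?v \<le> norm (?v - \<psi>) + norm \<psi>" using norm_triangle_ineq[of "?v - \<psi>" \<psi>] by simp
    then have Y: "norm ?v \<le> h (Re w) + norm \<psi>" using h by linarith
    have "2 * norm X \<le> cmod w" "1 \<le> cmod w" using Wc WX W by linarith+
    from Y0_le_Y[OF this] have "norm ?u \<le> 2 * norm ?v" .
    also have "\<dots> \<le> 2 * (h (Re w) + norm \<psi>)" by (rule mult_left_mono[OF Y]) simp
    finally have Y0: "norm ?u \<le> 2 * (h (Re w) + norm \<psi>)" .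
    have "norm ((1 / w) *s (X *v ?u)) \<le> norm X / Re w * (2 * (h (Re w) + norm \<psi>))"
    proof -
      have Rw: "0 < Re w" using w W by linarith
      have "norm ((1 / w) *s (X *v ?u)) = 1 / cmod w * norm (X *v ?u)" by (simp add: norm_divide)
      also have "\<dots> \<le> 1 / Re w * (norm X * norm ?u)"
        using Rw complex_Re_le_cmod[of w]
        by (intro mult_mono norm_matrix_vector_le divide_left_mono mult_pos_pos) auto
      also have "\<dots> = norm X / Re w * norm ?u" by simp
      also have "\<dots> \<le> norm X / Re w * (2 * (h (Re w) + norm \<psi>))"
        using Rw by (intro mult_left_mono Y0) auto
      finally show ?thesis .
    qed
    moreover have "?u - \<psi> = (?v - \<psi>) - (1 / w) *s (X *v ?u)" unfolding Y_expand by simp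
    then have "norm (?u - \<psi>) \<le> norm (?v - \<psi>) + norm ((1 / w) *s (X *v ?u))"
      using norm_triangle_ineq4 by metis
    ultimately show ?thesis unfolding f_def using h by linarith
  qed
  moreover have "0 < Re (kap E w)" if "cmod E < R" "W \<le> Re w" for E w
    using that by (intro Rekap) auto
  ultimately show ?thesis using y_sol hol_y by blast
qed

end

section \<open>Return to the variable x on the slit plane\<close>

lemma open_ctilde: "open ctilde"
  unfolding ctilde_def Compl_eq_Diff_UNIV[symmetric] by (intro open_Compl closed_nonpos_Reals_complex)

lemma connected_ctilde: "connected ctilde"
proof -
  have "ctilde = - (complex_of_real ` {..0})"
    by (auto simp: ctilde_def nonpos_Reals_def)
  then show ?thesis using starlike_slotted_complex_plane_left starlike_imp_connected by metis
qed

lemma ctilde_nonzero: "x \<in> ctilde \<Longrightarrow> x \<noteq> 0" and ctilde_iff: "x \<in> ctilde \<longleftrightarrow> x \<notin> \<real>\<^sub>\<le>\<^sub>0"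
  by (auto simp: ctilde_def)

lemma exp_strip_ctilde:
  assumes "\<bar>Im t\<bar> < pi"
  shows "exp t \<in> ctilde" "Ln (exp t) = t"
proof -
  show L: "Ln (exp t) = t" using assms by simp
  moreover have "Im t \<noteq> pi" using assms by auto
  ultimately have "\<not> (Re (exp t) < 0 \<and> Im (exp t) = 0)"
    using Im_Ln_eq_pi[of "exp t"] by simp
  moreover have "\<not> (Re (exp t) = 0 \<and> Im (exp t) = 0)" by (metis complex_eq_0 exp_not_eq_zero power_zero_numeral add_0)
  ultimately show "exp t \<in> ctilde"
    unfolding ctilde_iff complex_nonpos_Reals_iff by linarith
qed

text \<open>Both gauge factors are invertible, so the o(1) term is determined by the solution and
  the asymptotics amounts to a single limit.\<close>

lemma asymp_along_iff:
  "asymp_along F S q H lam \<psi> \<Psi> \<longleftrightarrow>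
    ((\<lambda>x. exp (lam * S x) *s (mexp (cscale (Ln (q x)) H) *v \<Psi> x)) \<longlongrightarrow> \<psi>) F"
proof
  assume "asymp_along F S q H lam \<psi> \<Psi>"
  then obtain r where r: "(r \<longlongrightarrow> 0) F"
    and ev: "\<forall>\<^sub>F x in F. \<Psi> x = exp (- lam * S x) *s (mexp (cscale (- Ln (q x)) H) *v (\<psi> + r x))"
    unfolding asymp_along_def by blast
  have "((\<lambda>x. \<psi> + r x) \<longlongrightarrow> \<psi>) F" using tendsto_add[OF tendsto_const r, of \<psi>] by simp
  moreover have "\<forall>\<^sub>F x in F. \<psi> + r x = exp (lam * S x) *s (mexp (cscale (Ln (q x)) H) *v \<Psi> x)"
    using ev
  proof eventually_elim
    case (elim x)
    show ?case unfolding elim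
      by (simp add: vector_smult_assoc exp_add[symmetric] matrix_vector_mul_assoc mexp_right_inverse)
  qed
  ultimately show "((\<lambda>x. exp (lam * S x) *s (mexp (cscale (Ln (q x)) H) *v \<Psi> x)) \<longlongrightarrow> \<psi>) F"
    by (rule Lim_transform_eventually)
next
  let ?r = "\<lambda>x. exp (lam * S x) *s (mexp (cscale (Ln (q x)) H) *v \<Psi> x) - \<psi>"
  assume "((\<lambda>x. exp (lam * S x) *s (mexp (cscale (Ln (q x)) H) *v \<Psi> x)) \<longlongrightarrow> \<psi>) F"
  from tendsto_diff[OF this tendsto_const, of \<psi>] have "(?r \<longlongrightarrow> 0) F" by simp
  moreover have "\<Psi> x = exp (- lam * S x) *s (mexp (cscale (- Ln (q x)) H) *v (\<psi> + ?r x))" for x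
    by (simp add: vector_smult_assoc exp_add[symmetric] matrix_vector_mul_assoc mexp_left_inverse)
  ultimately show "asymp_along F S q H lam \<psi> \<Psi>"
    unfolding asymp_along_def by (intro exI[of _ ?r] conjI always_eventually allI)
qed

context wkb begin

definition Lop :: "complex \<Rightarrow> complex \<Rightarrow> complex^'v^'v" where
  "Lop E x = cscale (1 / x) l + e + cscale (pfun (real N) M E x) a"

definition gauge_inv :: "complex \<Rightarrow> (complex \<Rightarrow> complex^'v) \<Rightarrow> complex \<Rightarrow> complex^'v" where
  "gauge_inv E \<Phi> x = exp (lam * Sfun (real N) M E x) *s (mexp (cscale (Ln (qfun (real N) M E x)) H) *v \<Phi> x)"

lemma Lop_eq:
  assumes "x \<noteq> 0"
  shows "A0 (Ln x) + cscale E (A1 (Ln x)) = cscale (- x) (Lop E x)"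
proof -
  have "exp (of_real (1 + M * real N) * Ln x) = x * x powr of_real (M * real N)"
    using assms by (simp add: powr_def distrib_right exp_add)
  then show ?thesis
    using assms by (simp add: A0_def A1_def Lop_def pfun_def cscale_add_right cscale_diff_left
        cscale_diff_right cscale_minus_left right_diff_distrib mult_ac)
qed

lemma ode_sol_Ln:
  assumes "\<And>t. sol E y t"
  shows "ode_sol (Lop E) (\<lambda>x. y (Ln x))"
  unfolding ode_sol_def
proof (intro ballI allI)
  fix x :: complex and i assume x: "x \<in> ctilde"
  then have x0: "x \<noteq> 0" "x \<notin> \<real>\<^sub>\<le>\<^sub>0" using ctilde_nonzero ctilde_iff by auto
  have "has_vec_deriv (\<lambda>x. y (Ln x)) (inverse x *s ((A0 (Ln x) + cscale E (A1 (Ln x))) *v y (Ln x))) x"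
    by (rule has_vec_deriv_compose[OF has_field_derivative_Ln[OF x0(2)] assms[unfolded sol_def]])
  moreover have "inverse x *s ((A0 (Ln x) + cscale E (A1 (Ln x))) *v y (Ln x)) = - (Lop E x *v y (Ln x))"
    unfolding Lop_eq[OF x0(1)] using x0(1) by (simp add: vec_eq_iff)
  ultimately show "((\<lambda>x. y (Ln x) $ i) has_field_derivative - (Lop E x *v y (Ln x)) $ i) (at x)"
    by (simp add: has_vec_deriv_def)
qed

text \<open>A solution on the slit plane pulls back only to the strip |Im t| < pi, where Ln inverts
  exp; \<open>sol\<close> is a pointwise predicate for this reason.\<close>

lemma sol_of_ode_sol:
  assumes ode: "ode_sol (Lop E) \<Phi>" and t: "\<bar>Im t\<bar> < pi"
  shows "sol E (\<lambda>t. \<Phi> (exp t)) t"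
proof -
  note et = exp_strip_ctilde[OF t]
  have "has_vec_deriv \<Phi> (- (Lop E (exp t) *v \<Phi> (exp t))) (exp t)"
    using ode et(1) by (simp add: ode_sol_def has_vec_deriv_def)
  from has_vec_deriv_compose[OF DERIV_exp this]
  have "has_vec_deriv (\<lambda>t. \<Phi> (exp t)) (exp t *s (- (Lop E (exp t) *v \<Phi> (exp t)))) t" .
  moreover have "A0 t + cscale E (A1 t) = cscale (- exp t) (Lop E (exp t))"
    using Lop_eq[of "exp t" E] et(2) by simp
  ultimately show ?thesis unfolding sol_def by (simp add: minus_mult_vec cscale_minus_left)
qed

lemma Im_g_Ln:
  assumes "0 < Re w"
  shows "\<bar>Im (of_real g * Ln w)\<bar> < pi / 2"
proof -
  have "g * \<bar>Im (Ln w)\<bar> \<le> 1 * \<bar>Im (Ln w)\<bar>" using g_pos g_lt_1 by (intro mult_right_mono) auto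
  then show ?thesis using Re_Ln_pos_lt_imp[OF assms] g_pos by (simp add: abs_mult)
qed

text \<open>Since g M <= 1, and w and \<kappa> lie in the right half plane, the imaginary part of
  \<open>cq\<close> stays below pi in modulus. So \<open>cq\<close> is the principal logarithm of q,
  and both gauges use the same branch.\<close>

lemma gauge_inv_eq:
  assumes w: "0 < Re w" and k: "0 < Re (kap E w)"
  shows "gauge_inv E \<Phi> (exp (of_real g * Ln w)) = Y0 E (\<lambda>t. \<Phi> (exp t)) w"
proof -
  let ?x = "exp (of_real g * Ln w)"
  have "\<bar>Im (of_real g * Ln w)\<bar> < pi" using Im_g_Ln[OF w] pi_gt_zero by linarith
  then have Lx: "Ln ?x = of_real g * Ln w" by (rule exp_strip_ctilde)
  have k0: "kap E w \<noteq> 0" using k by auto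
  have "\<bar>Im (of_real (g * M) * Ln w)\<bar> \<le> 1 * \<bar>Im (Ln w)\<bar>"
  proof -
    have "g * M \<le> 1" using gM g_pos by (simp add: distrib_left)
    then have "g * M * \<bar>Im (Ln w)\<bar> \<le> 1 * \<bar>Im (Ln w)\<bar>" by (rule mult_right_mono) simp
    then show ?thesis using g_pos M by (simp add: abs_mult)
  qed
  then have "\<bar>Im (cq E w)\<bar> < pi"
    unfolding cq_def using Re_Ln_pos_lt_imp[OF w] Re_Ln_pos_lt_imp[OF k] by simp
  then have "Ln (exp (cq E w)) = cq E w" by simp
  moreover have "qfun (real N) M E ?x = exp (cq E w)"
    unfolding exp_cq[OF k0] by (rule qfun_eq[OF _ Lx]) simp
  ultimately show ?thesis
    unfolding gauge_inv_def Y0_def by (simp add: Sfun_eq Lx)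
qed

lemma sector_to_halfplane:
  assumes x: "x \<noteq> 0" and A: "\<bar>Arg x\<bar> < pi / (2 * (M + 1))"
  defines "w \<equiv> exp (of_real (M + 1) * Ln x)"
  shows "of_real g * Ln w = Ln x" "Re w = cmod x powr (M + 1) * cos ((M + 1) * Arg x)" "0 < Re w"
proof -
  have "(M + 1) * \<bar>Arg x\<bar> < pi / 2" using A M by (simp add: field_simps)
  then have ang: "\<bar>(M + 1) * Arg x\<bar> < pi / 2" using M by (simp add: abs_mult)
  then have "\<bar>Im (of_real (M + 1) * Ln x)\<bar> < pi"
    using x pi_gt_zero by (simp add: Arg_eq_Im_Ln)
  then have "Ln w = of_real (M + 1) * Ln x" unfolding w_def by (rule exp_strip_ctilde)
  moreover have "complex_of_real g * of_real (M + 1) = 1"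
    unfolding of_real_mult[symmetric] gM by simp
  ultimately show "of_real g * Ln w = Ln x" by (simp only: mult.assoc[symmetric]) simp
  show Re: "Re w = cmod x powr (M + 1) * cos ((M + 1) * Arg x)"
    unfolding w_def Re_exp using x by (simp add: Arg_eq_Im_Ln powr_def)
  have "0 < cos ((M + 1) * Arg x)" using ang by (intro cos_gt_zero_pi) linarith+
  then show "0 < Re w" unfolding Re using x by simp
qed

text \<open>Re w = |x|^(M+1) cos ((M+1) Arg x), and the margin \<delta> keeps the cosine above sin
  ((M+1) \<delta>) > 0.\<close>

lemma filterlim_sector:
  assumes \<delta>: "0 < \<delta>"
  shows "filterlim (\<lambda>x. Re (exp (of_real (M + 1) * Ln x))) at_top
    (sector_infinity \<delta>)" (is "filterlim ?f at_top ?F")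
proof (cases "\<delta> < pi / (2 * (M + 1))")
  case True
  define c where "c = sin ((M + 1) * \<delta>)"
  have d: "(M + 1) * \<delta> < pi / 2" using True M by (simp add: field_simps)
  have d0: "0 < (M + 1) * \<delta>" using \<delta> M by simp
  have c: "0 < c" unfolding c_def using d d0 by (intro sin_gt_zero) auto
  have ev: "\<forall>\<^sub>F x in ?F. c * cmod x powr (M + 1) \<le> ?f x"
  proof -
    have "\<forall>\<^sub>F x in ?F. x \<in> sector \<delta>"
      by (simp add: eventually_inf_principal)
    moreover have "\<forall>\<^sub>F x in ?F. x \<noteq> 0"
      using eventually_not_equal_at_infinity filter_leD inf_le1 by blast
    ultimately show ?thesis
    proof eventually_elim
      case (elim x)
      then have A: "\<bar>Arg x\<bar> < pi / (2 * (M + 1)) - \<delta>" "x \<noteq> 0" by auto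
      have "(M + 1) * \<bar>Arg x\<bar> \<le> (M + 1) * (pi / (2 * (M + 1)) - \<delta>)"
        using A M by (intro mult_left_mono) auto
      also have "\<dots> = pi / 2 - (M + 1) * \<delta>" using M by (simp add: field_simps)
      finally have "\<bar>(M + 1) * Arg x\<bar> \<le> pi / 2 - (M + 1) * \<delta>" using M by (simp add: abs_mult)
      then have "cos (pi / 2 - (M + 1) * \<delta>) \<le> cos \<bar>(M + 1) * Arg x\<bar>"
        using d0 by (intro cos_monotone_0_pi_le) auto
      then have "c \<le> cos ((M + 1) * Arg x)" by (simp add: c_def cos_diff)
      then have "c * cmod x powr (M + 1) \<le> cos ((M + 1) * Arg x) * cmod x powr (M + 1)"
        by (rule mult_right_mono) simp
      then show ?case using sector_to_halfplane(2)[of x] A \<delta> by (simp add: mult.commute)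
    qed
  qed
  have "filterlim (\<lambda>r. c * r powr (M + 1)) at_top at_top"
    using c M by real_asymp
  moreover have "filterlim cmod at_top ?F"
    by (rule filterlim_mono[OF filterlim_norm_at_top]) auto
  ultimately have "filterlim (\<lambda>x. c * cmod x powr (M + 1)) at_top ?F" by (rule filterlim_compose)
  then show ?thesis by (rule filterlim_at_top_mono[OF _ ev])
next
  case False
  \<comment> \<open>For large \<delta> the sector is empty and the filter is trivial.\<close>
  then have "sector \<delta> = {}" by auto
  then show ?thesis by (simp only: principal_eq_bot_iff[THEN iffD2] inf_bot_right) (simp add: filterlim_def)
qed

lemma gauge_inv_tendsto_sector:
  assumes f: "(f \<longlongrightarrow> 0) at_top" and \<delta>: "0 < \<delta>"
    and bd: "\<And>w. W \<le> Re w \<Longrightarrow> 0 < Re (kap E w) \<and> norm (Y0 E y w - \<psi>) \<le> f (Re w)"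
  shows "(gauge_inv E (\<lambda>x. y (Ln x)) \<longlongrightarrow> \<psi>)
    (sector_infinity \<delta>)" (is "(_ \<longlongrightarrow> _) ?F")
proof (rule Lim_null[THEN iffD2], rule Lim_null_comparison)
  let ?w = "\<lambda>x. exp (of_real (M + 1) * Ln x)"
  show "((\<lambda>x. f (Re (?w x))) \<longlongrightarrow> 0) ?F" by (rule filterlim_compose[OF f filterlim_sector[OF \<delta>]])
  have "\<forall>\<^sub>F x in ?F. W \<le> Re (?w x)"
    using filterlim_sector[OF \<delta>] unfolding filterlim_at_top by blast
  moreover have "\<forall>\<^sub>F x in ?F. x \<in> sector \<delta>"
    by (simp add: eventually_inf_principal)
  moreover have "\<forall>\<^sub>F x in ?F. x \<noteq> 0"
    using eventually_not_equal_at_infinity filter_leD inf_le1 by blast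
  ultimately show "\<forall>\<^sub>F x in ?F. norm (gauge_inv E (\<lambda>x. y (Ln x)) x - \<psi>) \<le> f (Re (?w x))"
  proof eventually_elim
    case (elim x)
    then have A: "\<bar>Arg x\<bar> < pi / (2 * (M + 1))" "x \<noteq> 0" using \<delta> by auto
    note sec = sector_to_halfplane[OF A(2,1)]
    have ex: "exp (of_real g * Ln (?w x)) = x" unfolding sec(1) using A by simp
    have "gauge_inv E (\<lambda>x. y (Ln x)) x = Y0 E (\<lambda>t. y (Ln (exp t))) (?w x)"
      using gauge_inv_eq[OF sec(3), of E "\<lambda>x. y (Ln x)"] bd[OF elim(1)] unfolding ex by blast
    also have "\<dots> = Y0 E y (?w x)"
      unfolding Y0_def sec(1) using A by simp
    finally show ?case using bd[OF elim(1)] by simp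
  qed
qed

lemma filtermap_of_real_le_sector:
  assumes "\<delta> < pi / (2 * (M + 1))"
  shows "filtermap complex_of_real at_top \<le> sector_infinity \<delta>"
proof -
  have "filterlim complex_of_real at_infinity at_top"
    by (intro filterlim_of_real_at_infinity filterlim_ident filterlim_mono[OF _ at_top_le_at_infinity order_refl])
  moreover have "\<forall>\<^sub>F r in at_top. complex_of_real r \<in> sector \<delta>"
    using eventually_gt_at_top[of 0] by eventually_elim (use assms in \<open>simp add: Arg_of_real\<close>)
  ultimately have "filterlim complex_of_real (sector_infinity \<delta>) at_top"
    by (simp add: filterlim_inf filterlim_principal)
  then show ?thesis by (simp add: filterlim_def)
qed

end

section \<open>Uniqueness, and dependence on E\<close>

context wkb_form begin

text \<open>The difference of the two solutions has gauged limit 0, so it vanishes for large real x;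
  the identity theorem on the connected slit plane does the rest.\<close>

lemma ode_sol_asymp_unique:
  assumes \<Phi>: "ode_sol (Lop E) \<Phi>" "(gauge_inv E \<Phi> \<longlongrightarrow> \<psi>) (filtermap complex_of_real at_top)"
    and \<Psi>: "ode_sol (Lop E) \<Psi>" "(gauge_inv E \<Psi> \<longlongrightarrow> \<psi>) (filtermap complex_of_real at_top)"
    and x: "x \<in> ctilde"
  shows "\<Phi> x = \<Psi> x"
proof -
  define y where "y t = \<Phi> (exp t) - \<Psi> (exp t)" for t
  have strip: "\<bar>Im (of_real g * Ln w)\<bar> < pi" if "0 < Re w" for w
    using Im_g_Ln[OF that] pi_gt_zero by linarith
  have ysol: "sol E y (of_real g * Ln w)" if "0 < Re w" for w
    unfolding y_def[abs_def] using strip[OF that]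
    by (intro sol_diff sol_of_ode_sol[OF \<Phi>(1)] sol_of_ode_sol[OF \<Psi>(1)])
  have "((\<lambda>r. Y0 E y (of_real r)) \<longlongrightarrow> 0) at_top"
  proof -
    have lim: "((\<lambda>r. gauge_inv E \<Phi> (of_real r) - gauge_inv E \<Psi> (of_real r)) \<longlongrightarrow> \<psi> - \<psi>) at_top"
      using \<Phi>(2) \<Psi>(2) by (intro tendsto_diff) (simp_all add: filterlim_filtermap)
    \<comment> \<open>The limits are given along real x; substituting x = r^g expresses them along w
      = r.\<close>
    have "filterlim (\<lambda>r. g * ln r) at_top at_top"
      using g_pos by (intro filterlim_tendsto_pos_mult_at_top[OF tendsto_const] ln_at_top)
    then have fl: "filterlim (\<lambda>r. exp (g * ln r)) at_top at_top"
      by (rule filterlim_compose[OF exp_at_top])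
    obtain W K \<theta> where W: "W \<ge> 1" and Rekap: "\<And>w. W \<le> Re w \<Longrightarrow> 0 < Re (kap E w)"
      using line_estimate[of "cmod E"] by blast
    have "\<forall>\<^sub>F r in at_top. gauge_inv E \<Phi> (of_real (exp (g * ln r))) - gauge_inv E \<Psi> (of_real (exp (g * ln r)))
        = Y0 E y (of_real r)"
      using eventually_ge_at_top[of W]
    proof eventually_elim
      case (elim r)
      then have r: "0 < Re (complex_of_real r)" "0 < Re (kap E (of_real r))" using W Rekap by auto
      have "complex_of_real (exp (g * ln r)) = exp (of_real g * Ln (of_real r))"
        using r by (simp add: exp_of_real[symmetric] Ln_of_real)
      then show ?case
        unfolding y_def[abs_def] Y0_diff by (simp only: gauge_inv_eq[OF r])
    qed
    from Lim_transform_eventually[OF filterlim_compose[OF lim fl] this] show ?thesis by simp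
  qed
  then obtain W where W: "W > 0" "\<And>r. r \<ge> W \<Longrightarrow> y (of_real (g * ln r)) = 0"
    using decaying_solution_zero[OF ysol] by blast
  define x0 where "x0 = exp (g * ln W)"
  have zero: "\<Phi> (of_real r) = \<Psi> (of_real r)" if "r \<ge> x0" for r
  proof -
    have r: "r > 0" using that exp_gt_zero[of "g * ln W"] unfolding x0_def by linarith
    have "g * ln W \<le> ln r" using that r unfolding x0_def by (simp add: ln_ge_iff)
    then have "ln W \<le> ln r / g" using g_pos by (simp add: pos_le_divide_eq mult.commute)
    then have "W \<le> exp (ln r / g)" using W(1) by (metis exp_le_cancel_iff exp_ln)
    from W(2)[OF this] have "y (of_real (ln r)) = 0" using g_pos by simp
    moreover have "exp (complex_of_real (ln r)) = of_real r" using r by (simp add: exp_of_real)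
    ultimately show ?thesis by (simp add: y_def)
  qed
  have "\<Phi> x $ i - \<Psi> x $ i = 0" for i
  proof (rule analytic_continuation[where f = "\<lambda>x. \<Phi> x $ i - \<Psi> x $ i" and S = ctilde
      and U = "complex_of_real ` {x0..}" and \<xi> = "complex_of_real x0"])
    have "(\<lambda>x. \<Phi> x $ i) holomorphic_on ctilde" "(\<lambda>x. \<Psi> x $ i) holomorphic_on ctilde"
      using \<Phi>(1) \<Psi>(1) unfolding ode_sol_def holomorphic_on_open[OF open_ctilde] by blast+
    then show "(\<lambda>x. \<Phi> x $ i - \<Psi> x $ i) holomorphic_on ctilde" by (intro holomorphic_intros)
    have "x0 > 0" by (simp add: x0_def)
    then show "complex_of_real ` {x0..} \<subseteq> ctilde" "complex_of_real x0 \<in> ctilde"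
      by (auto simp: ctilde_iff complex_nonpos_Reals_iff)
    show "complex_of_real x0 islimpt complex_of_real ` {x0..}"
      unfolding islimpt_approachable
    proof (intro allI impI)
      fix d :: real assume d: "d > 0"
      then have "complex_of_real (x0 + d / 2) \<in> complex_of_real ` {x0..}" by (intro imageI) simp
      moreover have "complex_of_real (x0 + d / 2) \<noteq> complex_of_real x0"
          "dist (complex_of_real (x0 + d / 2)) (complex_of_real x0) < d"
        using d by (auto simp: dist_norm)
      ultimately show "\<exists>x'\<in>complex_of_real ` {x0..}. x' \<noteq> complex_of_real x0 \<and> dist x' (complex_of_real x0) < d"
        by blast
    qed
  qed (use zero x open_ctilde connected_ctilde in auto)
  then show ?thesis by (simp add: vec_eq_iff)
qed

text \<open>Existence is available only on discs |E| < R, with a solution that may depend on R.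
  Uniqueness makes two of them agree on the smaller disc, so they fit together.\<close>

theorem subdominant_solution:
  assumes \<psi>: "Nm *v \<psi> = 0"
  shows "\<exists>\<Psi>. (\<forall>E. ode_sol (Lop E) (\<lambda>x. \<Psi> x E)
      \<and> (gauge_inv E (\<lambda>x. \<Psi> x E) \<longlongrightarrow> \<psi>) (filtermap complex_of_real at_top)
      \<and> (\<forall>\<delta>>0. (gauge_inv E (\<lambda>x. \<Psi> x E) \<longlongrightarrow> \<psi>)
          (sector_infinity \<delta>)))
    \<and> (\<forall>x\<in>ctilde. \<forall>i. (\<lambda>E. \<Psi> x E $ i) holomorphic_on UNIV)"
proof -
  define P where "P R y \<longleftrightarrow> (\<forall>E. cmod E < R \<longrightarrow> ode_sol (Lop E) (\<lambda>x. y (Ln x) E)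
      \<and> (\<forall>\<delta>>0. (gauge_inv E (\<lambda>x. y (Ln x) E) \<longlongrightarrow> \<psi>)
          (sector_infinity \<delta>)))
      \<and> (\<forall>t i. (\<lambda>E. y t E $ i) holomorphic_on ball 0 R)" for R and y :: "complex \<Rightarrow> complex \<Rightarrow> complex^'v"
  have "\<exists>y. P R y" if R: "R > 0" for R
  proof -
    obtain y f W where y: "\<And>E t. sol E (\<lambda>t. y t E) t" and f: "(f \<longlongrightarrow> 0) at_top"
      and bd: "\<And>E w. cmod E < R \<Longrightarrow> W \<le> Re w \<Longrightarrow> 0 < Re (kap E w) \<and> norm (Y0 E (\<lambda>t. y t E) w - \<psi>) \<le> f (Re w)"
      and hol: "\<And>t i. (\<lambda>E. y t E $ i) holomorphic_on ball 0 R"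
      using existence_bounded_energy[OF \<psi> R] by blast
    have "P R y"
      unfolding P_def
      using ode_sol_Ln[OF y] gauge_inv_tendsto_sector[OF f _ bd] hol by blast
    then show ?thesis by blast
  qed
  then have "\<forall>R. \<exists>y. R > 0 \<longrightarrow> P R y" by blast
  from this[unfolded choice_iff] obtain y where y: "\<And>R. R > 0 \<Longrightarrow> P R (y R)" by blast
  have real: "(gauge_inv E (\<lambda>x. y R (Ln x) E) \<longlongrightarrow> \<psi>) (filtermap complex_of_real at_top)"
    if "R > 0" "cmod E < R" for R E
  proof (rule tendsto_mono[OF filtermap_of_real_le_sector])
    \<comment> \<open>The positive axis lies in every sector with margin below pi/(2(M+1)); half of
      that value is taken.\<close>
    have "pi / (4 * (M + 1)) > 0" using M pi_gt_zero by simp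
    then show "(gauge_inv E (\<lambda>x. y R (Ln x) E) \<longlongrightarrow> \<psi>)
      (sector_infinity (pi / (4 * (M + 1))))"
      using y[OF that(1)] that(2) unfolding P_def by blast
    show "pi / (4 * (M + 1)) < pi / (2 * (M + 1))"
      using M pi_gt_zero by (intro divide_strict_left_mono) auto
  qed
  \<comment> \<open>The radius varies with E, so holomorphy is not visible from this definition;
    near E0 it follows by comparison with the fixed radius |E0| + 1.\<close>
  define \<Psi> where "\<Psi> x E = y (cmod E + 1) (Ln x) E" for x E
  have pos: "0 < cmod E + 1" for E :: complex by (simp add: add_nonneg_pos)
  have "(\<lambda>E. \<Psi> x E $ i) holomorphic_on UNIV" if x: "x \<in> ctilde" for x i
    unfolding holomorphic_on_def
  proof
    fix E0 :: complex
    define R where "R = cmod E0 + 1"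
    have eq: "\<Psi> x E = y R (Ln x) E" if "E \<in> ball 0 R" for E
      unfolding \<Psi>_def
      using that y[OF pos[of E]] y[OF pos[of E0]] real[of "cmod E + 1" E] real[of R E] pos[of E0] pos[of E]
      unfolding R_def[symmetric] P_def
      by (intro ode_sol_asymp_unique[where E = E and x = x and \<psi> = \<psi> and \<Phi> = "\<lambda>x. y (cmod E + 1) (Ln x) E"
          and \<Psi> = "\<lambda>x. y R (Ln x) E"] x) auto
    have "(\<lambda>E. y R (Ln x) E $ i) holomorphic_on ball 0 R"
      using y[OF pos[of E0]] unfolding R_def[symmetric] P_def by blast
    then have "(\<lambda>E. \<Psi> x E $ i) holomorphic_on ball 0 R"
      by (rule holomorphic_transform) (simp add: eq)
    then show "(\<lambda>E. \<Psi> x E $ i) field_differentiable at E0 within UNIV"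
      using holomorphic_on_imp_differentiable_at[of _ "ball 0 R" E0] by (simp add: R_def)
  qed
  moreover have "ode_sol (Lop E) (\<lambda>x. \<Psi> x E) \<and> (gauge_inv E (\<lambda>x. \<Psi> x E) \<longlongrightarrow> \<psi>) (filtermap complex_of_real at_top)
      \<and> (\<forall>\<delta>>0. (gauge_inv E (\<lambda>x. \<Psi> x E) \<longlongrightarrow> \<psi>)
          (sector_infinity \<delta>))" for E
    unfolding \<Psi>_def using y[OF pos[of E]] real[OF pos[of E], of E] unfolding P_def by simp
  ultimately show ?thesis by blast
qed

end

theorem theorem3p4:
  fixes n :: nat and A :: "nat \<Rightarrow> nat \<Rightarrow> int"
    and G :: "(complex^'n^'n) set" and e f h :: "nat \<Rightarrow> complex^'n^'n"
    and \<rho> :: "complex^'n^'n \<Rightarrow> complex^'v^'v"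
    and k0 :: "nat \<Rightarrow> int" and a0 hh ell :: "complex^'n^'n"
    and \<zeta> :: complex and M :: real and lam :: complex and \<psi> :: "complex^'v"
  assumes ADE: "ADE_cartan n A"
    and CS: "chevalley_serre G n A e f h"
    and rep: "lie_rep G \<rho>"
    and low: "lowest_root G n A h k0"
    and a0: "a0 \<in> root_space G n A h k0" "a0 \<noteq> 0"
    and zeta: "\<zeta> \<noteq> 0"
    and hh: "hh \<in> cartan_sub n h" "\<forall>i<n. lbr hh (e i) = e i"
    and ell: "ell \<in> cartan_sub n h"
    and M: "M > 0"
    and maxeig: "is_max_eig (cscale \<zeta> (\<rho> a0) + (\<Sum>i<n. \<rho> (e i))) lam"
    and psi: "\<psi> \<noteq> 0" "(cscale \<zeta> (\<rho> a0) + (\<Sum>i<n. \<rho> (e i))) *v \<psi> = lam *s \<psi>"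
  shows "\<exists>\<Psi> :: complex \<Rightarrow> complex \<Rightarrow> complex^'v.
     (\<forall>E. let hv = dual_coxeter n k0;
              L = (\<lambda>x. cscale (1 / x) (\<rho> ell) + (\<Sum>i<n. \<rho> (e i))
                        + cscale (pfun hv M E x * \<zeta>) (\<rho> a0))
          in ode_sol L (\<lambda>x. \<Psi> x E)
           \<and> asymp_along (filtermap complex_of_real at_top) (Sfun hv M E) (qfun hv M E)
                 (\<rho> hh) lam \<psi> (\<lambda>x. \<Psi> x E)
           \<and> (\<forall>\<Phi>. ode_sol L \<Phi> \<and>
                  asymp_along (filtermap complex_of_real at_top) (Sfun hv M E) (qfun hv M E)
                    (\<rho> hh) lam \<psi> \<Phi>
                  \<longrightarrow> (\<forall>x\<in>ctilde. \<Phi> x = \<Psi> x E))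
           \<and> (\<forall>\<delta>>0. asymp_along
                  (inf at_infinity (principal {x. \<bar>Arg x\<bar> < pi / (2 * (M + 1)) - \<delta>}))
                  (Sfun hv M E) (qfun hv M E) (\<rho> hh) lam \<psi> (\<lambda>x. \<Psi> x E)))
   \<and> (\<forall>x\<in>ctilde. \<forall>i. (\<lambda>E. \<Psi> x E $ i) holomorphic_on UNIV)"
proof -
  interpret chevalley n A G e f h \<rho> k0 a0
    by unfold_locales (rule ADE CS rep low a0)+
  \<comment> \<open>As the height is at most -1, this natural number is the dual Coxeter number and
    the height equals -(N - 1). An integral N lets the truncated root be compared with p through its
    N-th power, a polynomial in E w^(-\<beta>).\<close>
  define N where "N = nat (1 - height n k0)"
  have N0: "0 < N" and N1: "complex_of_int (height n k0) = - of_nat (N - 1)"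
    and hv: "dual_coxeter n k0 = real N"
    using height_k0 by (auto simp: N_def dual_coxeter_def of_nat_diff)
  define S where "S = (\<Sum>i<n. \<rho> (e i))"
  define a where "a = cscale \<zeta> (\<rho> a0)"
  obtain X where X: "lbr (S + a) X = \<rho> ell - cscale (of_real M) (\<rho> hh)"
    using rep_cartan_is_bracket[OF ell hh(1)] unfolding S_def a_def by metis
  obtain b c \<eta> where b: "bounded_bilinear b" "\<And>u v. b u v = b v u" "(0::real) < c" "(0::real) < \<eta>"
    "\<And>u. c * (norm u)\<^sup>2 \<le> b u u"
    "\<And>u z. \<bar>Im z\<bar> \<le> \<eta> * Re z \<Longrightarrow> b u (z *s (((S + a) - cscale lam (mat 1)) *v u)) \<le> 0"
    using lyapunov_form_max_eig[OF maxeig[unfolded add.commute[of "cscale \<zeta> (\<rho> a0)"]]]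
    unfolding S_def a_def by blast
  interpret w: wkb N M "\<rho> hh" S a "\<rho> ell" X lam
  proof unfold_locales
    show "lbr (\<rho> hh) S = S" unfolding S_def by (rule rep_principal_e[OF hh])
    show "lbr (\<rho> hh) a = cscale (- of_nat (N - 1)) a"
      unfolding a_def lbr_cscale_right rep_principal_a0[OF hh] N1 by (simp add: mult.commute)
    show "lbr (\<rho> hh) (\<rho> ell) = 0" by (rule rep_cartan_commute[OF hh(1) ell])
  qed (use N0 M X in auto)
  interpret wf: wkb_form N M "\<rho> hh" S a "\<rho> ell" X lam b c \<eta>
    by (rule wkb_form.intro[OF w.wkb_axioms wkb_form_axioms.intro]) (use b in \<open>simp_all add: w.Nm_def\<close>)
  have psi0: "w.Nm *v \<psi> = 0"
    using psi(2) unfolding w.Nm_def unfolding S_def a_def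
    by (simp add: matrix_vector_mult_diff_rdistrib add.commute)
  have L: "(\<lambda>x. cscale (1 / x) (\<rho> ell) + (\<Sum>i<n. \<rho> (e i)) + cscale (pfun (real N) M E x * \<zeta>) (\<rho> a0)) = w.Lop E" for E
    unfolding fun_eq_iff w.Lop_def unfolding S_def a_def by simp
  have asy: "asymp_along F (Sfun (real N) M E) (qfun (real N) M E) (\<rho> hh) lam \<psi> \<Phi>
      \<longleftrightarrow> (w.gauge_inv E \<Phi> \<longlongrightarrow> \<psi>) F" for F E \<Phi>
    unfolding asymp_along_iff w.gauge_inv_def ..
  obtain \<Psi> where \<Psi>: "\<And>E. ode_sol (w.Lop E) (\<lambda>x. \<Psi> x E)"
      "\<And>E. (w.gauge_inv E (\<lambda>x. \<Psi> x E) \<longlongrightarrow> \<psi>) (filtermap complex_of_real at_top)"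
      "\<And>E \<delta>. 0 < \<delta> \<Longrightarrow> (w.gauge_inv E (\<lambda>x. \<Psi> x E) \<longlongrightarrow> \<psi>)
          (inf at_infinity (principal {x. \<bar>Arg x\<bar> < pi / (2 * (M + 1)) - \<delta>}))"
      "\<And>x i. x \<in> ctilde \<Longrightarrow> (\<lambda>E. \<Psi> x E $ i) holomorphic_on UNIV"
    using wf.subdominant_solution[OF psi0] by blast
  show ?thesis
    unfolding hv Let_def L asy
    using \<Psi> wf.ode_sol_asymp_unique by blast
qed

end
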